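(* Let $s<0$. Then the initial value problem $$u_t-u_{xxt}+u_x+uu_x=0,\quad x,t\in\mathbb{R},\qquad u(x,0)=u_0(x),$$ for the Benjamin–Bona–Mahony (BBM) equation is ill-posed in $H^s(\mathbb{R})$ in the following sense: there exists $T>0$ such that for any $0<t<T$, the flow-map $u_0\mapsto u(t)$, which sends $u_0\in L^2(\mathbb{R})$ to the value at time $t$ of the solution $u$ with initial data $u_0$, is discontinuous at the origin as a map from $L^2(\mathbb{R})$ endowed with the topology induced by $H^s(\mathbb{R})$ into $\mathcal{D}'(\mathbb{R})$.
   Context: Functions $u=u(x,t)$ are real valued. The Fourier transform is $\hat f(\xi)=\frac{1}{\sqrt{2\pi}}\int_{\mathbb{R}}e^{-ix\xi}f(x)\,dx$, and $H^s(\mathbb{R})$ is the $L^2$-based Sobolev space with norm $\|f\|_{H^s(\mathbb{R})}=\left(\int_{\mathbb{R}}(1+|\xi|^2)^s|\hat f(\xi)|^2\,d\xi\right)^{1/2}$. For $s<0$ one has $L^2(\mathbb{R})\subset H^s(\mathbb{R})$, and the topology on $L^2(\mathbb{R})$ induced by $H^s(\mathbb{R})$ is the one given by the norm $\|\cdot\|_{H^s(\mathbb{R})}$ restricted to $L^2(\mathbb{R})$. $\mathcal{D}'(\mathbb{R})$ is the space of distributions on $\mathbb{R}$ with its usual topology. Let $\varphi(\xi)=\frac{\xi}{1+\xi^2}$, let $\varphi(D_x)$ be the Fourier multiplier operator $\widehat{\varphi(D_x)f}(\xi)=\varphi(\xi)\hat f(\xi)$, and let $S(t)=e^{-it\varphi(D_x)}$.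 The initial value problem is equivalently written $iu_t=\varphi(D_x)u+\frac12\varphi(D_x)(u^2)$, $u(x,0)=u_0(x)$, and is understood through the integral equation $$u(t)=S(t)u_0-\frac{i}{2}\int_0^tS(t-t')\,\varphi(D_x)\big(u(t')^2\big)\,dt'.$$ Flow-map: by a known theorem of Bona and Tzvetkov, the problem is globally well-posed in $H^r(\mathbb{R})$ for every $r\ge 0$. More precisely, for each fixed $r\ge0$ and any $u_0\in H^r(\mathbb{R})$ there exist a time $T=T(\|u_0\|_{H^r})>0$ and a unique solution $u\in C([0,T];H^r(\mathbb{R}))$; moreover, for $R>0$, if $\mathcal{B}_R$ is the ball of radius $R$ centered at the origin in $H^r(\mathbb{R})$ and $T=T(R)>0$ is a uniform existence time for data in $\mathcal{B}_R$, then $u_0\mapsto u$ is a real analytic mapping from $\mathcal{B}_R$ to $C([-T,T];H^r(\mathbb{R}))$. The flow-map in the claim is the one given by this theorem with $r=0$, i.e. for data $u_0\in L^2(\mathbb{R})$; by the global well-posedness, $u(t)\in L^2(\mathbb{R})$ is defined for every $u_0\in L^2(\mathbb{R})$ and every $t\ge0$. *)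

theory Defs
  imports "HOL-Analysis.Analysis"
begin

section \<open>The Hilbert space of square integrable functions on the line\<close>

definition square_integrable :: "(real \<Rightarrow> 'a::euclidean_space) \<Rightarrow> bool" where
  "square_integrable f \<longleftrightarrow>
     f \<in> borel_measurable lborel \<and> integrable lborel (\<lambda>x. (norm (f x))\<^sup>2)"

definition L2_rel :: "(real \<Rightarrow> 'a::euclidean_space) \<Rightarrow> (real \<Rightarrow> 'a) \<Rightarrow> bool" where
  "L2_rel f g \<longleftrightarrow>
     square_integrable f \<and> square_integrable g \<and> (AE x in lborel. f x = g x)"

lemma square_integrable_inner:
  fixes f g :: "real \<Rightarrow> 'a::euclidean_space"
  assumes "square_integrable f" "square_integrable g"
  shows "integrable lborel (\<lambda>x. f x \<bullet> g x)"
proof (rule Bochner_Integration.integrable_bound)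
  show "integrable lborel (\<lambda>x. (norm (f x))\<^sup>2 + (norm (g x))\<^sup>2)"
    using assms by (simp add: square_integrable_def)
  show "(\<lambda>x. f x \<bullet> g x) \<in> borel_measurable lborel"
    using assms by (auto simp: square_integrable_def)
  show "AE x in lborel. norm (f x \<bullet> g x) \<le> norm ((norm (f x))\<^sup>2 + (norm (g x))\<^sup>2)"
  proof (rule AE_I2)
    fix x
    have "\<bar>f x \<bullet> g x\<bar> \<le> norm (f x) * norm (g x)"
      by (rule Cauchy_Schwarz_ineq2)
    also have "\<dots> \<le> (norm (f x))\<^sup>2 + (norm (g x))\<^sup>2"
      using sum_squares_bound[of "norm (f x)" "norm (g x)"]
            mult_nonneg_nonneg[OF norm_ge_zero[of "f x"] norm_ge_zero[of "g x"]] by linarith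
    finally show "norm (f x \<bullet> g x) \<le> norm ((norm (f x))\<^sup>2 + (norm (g x))\<^sup>2)"
      by simp
  qed
qed

lemma square_integrable_iff_inner:
  fixes f :: "real \<Rightarrow> 'a::euclidean_space"
  shows "square_integrable f \<longleftrightarrow>
    f \<in> borel_measurable lborel \<and> integrable lborel (\<lambda>x. f x \<bullet> f x)"
  by (simp add: square_integrable_def power2_norm_eq_inner)

lemma square_integrable_add:
  assumes "square_integrable f" "square_integrable g"
  shows "square_integrable (\<lambda>x. f x + g x)"
proof -
  have "integrable lborel (\<lambda>x. f x \<bullet> f x + f x \<bullet> g x + (g x \<bullet> f x + g x \<bullet> g x))"
    by (intro Bochner_Integration.integrable_add square_integrable_inner assms)
  then show ?thesis
    using assms
    by (auto simp: square_integrable_iff_inner inner_add_left inner_add_right algebra_simps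
        intro: borel_measurable_add)
qed

lemma square_integrable_scaleR:
  assumes "square_integrable f"
  shows "square_integrable (\<lambda>x. c *\<^sub>R f x)"
  using assms by (auto simp: square_integrable_iff_inner)

lemma square_integrable_uminus: "square_integrable f \<Longrightarrow> square_integrable (\<lambda>x. - f x)"
  using square_integrable_scaleR[of f "-1"] by simp

lemma square_integrable_diff:
  "square_integrable f \<Longrightarrow> square_integrable g \<Longrightarrow> square_integrable (\<lambda>x. f x - g x)"
  using square_integrable_add[OF _ square_integrable_uminus, of f g] by simp

lemma square_integrable_zero: "square_integrable (\<lambda>x. 0)"
  by (simp add: square_integrable_def)

quotient_type (overloaded) 'a L2 = "real \<Rightarrow> 'a::euclidean_space" / partial: L2_rel
  morphisms rep_L2 abs_L2
proof (rule part_equivpI)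
  show "\<exists>f::real \<Rightarrow> 'a. L2_rel f f"
    by (rule exI[of _ "\<lambda>x. 0"]) (simp add: L2_rel_def square_integrable_zero)
  show "symp (L2_rel :: (real \<Rightarrow> 'a) \<Rightarrow> _)"
    by (rule sympI) (auto simp: L2_rel_def elim: AE_mp)
  show "transp (L2_rel :: (real \<Rightarrow> 'a) \<Rightarrow> _)"
    by (rule transpI) (auto simp: L2_rel_def elim: eventually_elim2)
qed

lemma rep_L2: "square_integrable (rep_L2 f)"
  using Quotient_rep_reflp[OF Quotient_L2] by (auto simp: L2_rel_def)

lemma rep_abs_L2: "square_integrable f \<Longrightarrow> AE x in lborel. rep_L2 (abs_L2 f) x = f x"
  using rep_abs_rsp[OF Quotient3_L2, of f f]
  by (auto simp: L2_rel_def elim: AE_mp)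

instantiation L2 :: (euclidean_space) real_inner
begin

lift_definition zero_L2 :: "'a L2" is "\<lambda>x. 0"
  by (simp add: L2_rel_def square_integrable_zero)

lift_definition plus_L2 :: "'a L2 \<Rightarrow> 'a L2 \<Rightarrow> 'a L2" is "\<lambda>f g x. f x + g x"
  by (auto simp: L2_rel_def square_integrable_add)

lift_definition scaleR_L2 :: "real \<Rightarrow> 'a L2 \<Rightarrow> 'a L2" is "\<lambda>c f x. c *\<^sub>R f x"
  by (auto simp: L2_rel_def square_integrable_scaleR)

lift_definition uminus_L2 :: "'a L2 \<Rightarrow> 'a L2" is "\<lambda>f x. - f x"
  by (auto simp: L2_rel_def square_integrable_uminus)

lift_definition minus_L2 :: "'a L2 \<Rightarrow> 'a L2 \<Rightarrow> 'a L2" is "\<lambda>f g x. f x - g x"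
  by (auto simp: L2_rel_def square_integrable_diff)

lift_definition inner_L2 :: "'a L2 \<Rightarrow> 'a L2 \<Rightarrow> real" is
  "\<lambda>f g. LINT x|lborel. f x \<bullet> g x"
proof (rule integral_cong_AE)
  fix f f' g g' :: "real \<Rightarrow> 'a"
  assume *: "L2_rel f f'" "L2_rel g g'"
  then show "(\<lambda>x. f x \<bullet> g x) \<in> borel_measurable lborel"
    "(\<lambda>x. f' x \<bullet> g' x) \<in> borel_measurable lborel"
    by (auto simp: L2_rel_def square_integrable_def)
  show "AE x in lborel. f x \<bullet> g x = f' x \<bullet> g' x"
    using * by (auto simp: L2_rel_def elim: eventually_elim2)
qed

definition norm_L2 :: "'a L2 \<Rightarrow> real" where
  "norm_L2 f = sqrt (f \<bullet> f)"

definition dist_L2 :: "'a L2 \<Rightarrow> 'a L2 \<Rightarrow> real" where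
  "dist_L2 f g = norm (f - g)"

definition sgn_L2 :: "'a L2 \<Rightarrow> 'a L2" where
  "sgn_L2 f = scaleR (inverse (norm f)) f"

definition uniformity_L2 :: "('a L2 \<times> 'a L2) filter" where
  "uniformity_L2 = (INF e\<in>{0<..}. principal {(f, g). dist f g < e})"

definition open_L2 :: "'a L2 set \<Rightarrow> bool" where
  "open_L2 U = (\<forall>f\<in>U. eventually (\<lambda>(f', g). f' = f \<longrightarrow> g \<in> U) uniformity)"

instance
proof
  fix f g h :: "'a L2" and a b c :: real
  show "f + g + h = f + (g + h)"
    by transfer (auto simp: L2_rel_def add.assoc square_integrable_add)
  show "f + g = g + f"
    by transfer (auto simp: L2_rel_def add.commute square_integrable_add)
  show "0 + f = f"
    by transfer (auto simp: L2_rel_def)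
  show "- f + f = 0"
    by transfer (auto simp: L2_rel_def square_integrable_zero)
  show "f - g = f + - g"
    by transfer (auto simp: L2_rel_def square_integrable_diff)
  show "a *\<^sub>R (f + g) = a *\<^sub>R f + a *\<^sub>R g"
    by transfer (auto simp: L2_rel_def scaleR_add_right square_integrable_add
        square_integrable_scaleR)
  show "(a + b) *\<^sub>R f = a *\<^sub>R f + b *\<^sub>R f"
    by transfer (auto simp: L2_rel_def scaleR_add_left square_integrable_add
        square_integrable_scaleR)
  show "a *\<^sub>R b *\<^sub>R f = (a * b) *\<^sub>R f"
    by transfer (auto simp: L2_rel_def square_integrable_scaleR)
  show "1 *\<^sub>R f = f"
    by transfer (auto simp: L2_rel_def)
  show "sgn f = scaleR (inverse (norm f)) f"
    by (rule sgn_L2_def)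
  show "dist f g = norm (f - g)"
    by (simp add: dist_L2_def)
  show "f \<bullet> g = g \<bullet> f"
    by transfer (simp add: inner_commute)
  show "(f + g) \<bullet> h = f \<bullet> h + g \<bullet> h"
    by transfer (simp add: L2_rel_def inner_add_left square_integrable_inner)
  show "(c *\<^sub>R f) \<bullet> g = c * (f \<bullet> g)"
    by transfer simp
  show "0 \<le> f \<bullet> f"
    by transfer simp
  show "(f \<bullet> f = 0) = (f = 0)"
    by transfer (auto simp: L2_rel_def square_integrable_zero square_integrable_inner
        integral_nonneg_eq_0_iff_AE)
  show "norm f = sqrt (f \<bullet> f)"
    by (simp add: norm_L2_def)
  show "(uniformity :: ('a L2 \<times> 'a L2) filter) =
      (INF e\<in>{0<..}. principal {(f, g). dist f g < e})"
    by (simp add: uniformity_L2_def)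
  fix U :: "'a L2 set"
  show "open U = (\<forall>f\<in>U. eventually (\<lambda>(f', g). f' = f \<longrightarrow> g \<in> U) uniformity)"
    by (simp add: open_L2_def)
qed

end

lift_definition complex_L2 :: "real L2 \<Rightarrow> complex L2" is "\<lambda>f x. complex_of_real (f x)"
  by (auto simp: L2_rel_def square_integrable_def)

lift_definition scaleC_L2 :: "complex \<Rightarrow> complex L2 \<Rightarrow> complex L2" is "\<lambda>c f x. c * f x"
  by (auto simp: L2_rel_def square_integrable_def norm_mult power_mult_distrib)


section \<open>Fourier transform, multipliers and Sobolev norms\<close>

definition fourier_integral :: "(real \<Rightarrow> complex) \<Rightarrow> real \<Rightarrow> complex" where
  "fourier_integral f \<xi> =
     complex_of_real (1 / sqrt (2 * pi)) *
     (LINT x|lborel. exp (- (\<i> * complex_of_real (x * \<xi>))) * f x)"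

text \<open>For square integrable functions the integral need not converge absolutely; the
  transform is the \<open>L\<^sup>2\<close>-limit of the transforms of the truncations, which are integrable
  with square integrable transforms by Plancherel's theorem.\<close>

definition fourier_L2 :: "complex L2 \<Rightarrow> complex L2" where
  "fourier_L2 f =
     lim (\<lambda>n::nat. abs_L2 (fourier_integral
            (\<lambda>x. indicator {- real n..real n} x *\<^sub>R rep_L2 f x)))"

text \<open>Both multiplier operators below are determined by the Fourier transform of their value,
  since the Fourier transform is a bijection of \<open>L\<^sup>2\<close>. The first one is meant for bounded
  measurable \<open>m\<close>. The second one acts on integrable functions \<open>h\<close>, whose Fourier transform is
  bounded, and is meant for square integrable \<open>m\<close>. It is needed because the nonlinearity
  \<open>u\<^sup>2\<close> is in general only integrable for square integrable \<open>u\<close>.\<close>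

definition multiplier_L2 :: "(real \<Rightarrow> complex) \<Rightarrow> complex L2 \<Rightarrow> complex L2" where
  "multiplier_L2 m f = (THE g. fourier_L2 g = abs_L2 (\<lambda>\<xi>. m \<xi> * rep_L2 (fourier_L2 f) \<xi>))"

definition multiplier_L1 :: "(real \<Rightarrow> complex) \<Rightarrow> (real \<Rightarrow> complex) \<Rightarrow> complex L2" where
  "multiplier_L1 m h = (THE g. fourier_L2 g = abs_L2 (\<lambda>\<xi>. m \<xi> * fourier_integral h \<xi>))"

text \<open>The integral is finite for every square integrable \<open>f\<close> when \<open>s \<le> 0\<close>, the only case
  used here.\<close>

definition sobolev_norm :: "real \<Rightarrow> complex L2 \<Rightarrow> real" where
  "sobolev_norm s f =
     sqrt (LINT \<xi>|lborel. (1 + \<xi>\<^sup>2) powr s * (norm (rep_L2 (fourier_L2 f) \<xi>))\<^sup>2)"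

definition L2_sobolev_topology :: "real \<Rightarrow> real L2 topology" where
  "L2_sobolev_topology s =
     topology (\<lambda>U. \<forall>f\<in>U. \<exists>r>0. \<forall>g. sobolev_norm s (complex_L2 (g - f)) < r \<longrightarrow> g \<in> U)"

lemma openin_L2_sobolev_topology:
  "openin (L2_sobolev_topology s) U \<longleftrightarrow>
     (\<forall>f\<in>U. \<exists>r>0. \<forall>g. sobolev_norm s (complex_L2 (g - f)) < r \<longrightarrow> g \<in> U)"
proof -
  have "istopology (\<lambda>U. \<forall>f\<in>U. \<exists>r>0. \<forall>g. sobolev_norm s (complex_L2 (g - f)) < r \<longrightarrow> g \<in> U)"
    (is "istopology ?open")
    unfolding istopology_def
  proof (intro conjI allI impI)
    fix U V assume "?open U" "?open V"
    show "?open (U \<inter> V)"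
    proof
      fix f assume "f \<in> U \<inter> V"
      then obtain r r' where "r > 0" "r' > 0"
        "\<forall>g. sobolev_norm s (complex_L2 (g - f)) < r \<longrightarrow> g \<in> U"
        "\<forall>g. sobolev_norm s (complex_L2 (g - f)) < r' \<longrightarrow> g \<in> V"
        using \<open>?open U\<close> \<open>?open V\<close> by blast
      then show "\<exists>r>0. \<forall>g. sobolev_norm s (complex_L2 (g - f)) < r \<longrightarrow> g \<in> U \<inter> V"
        by (intro exI[of _ "min r r'"]) simp
    qed
  next
    fix \<U> assume "\<forall>U\<in>\<U>. ?open U"
    then show "?open (\<Union>\<U>)"
      by (meson Union_iff)
  qed
  then show ?thesis
    by (simp add: L2_sobolev_topology_def)
qed

lemma topspace_L2_sobolev_topology [simp]: "topspace (L2_sobolev_topology s) = UNIV"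
proof -
  have "openin (L2_sobolev_topology s) UNIV"
    unfolding openin_L2_sobolev_topology by (auto intro: exI[of _ 1])
  then show ?thesis
    using openin_subset by blast
qed


section \<open>Distributions on the line\<close>

definition nth_deriv :: "nat \<Rightarrow> (real \<Rightarrow> complex) \<Rightarrow> real \<Rightarrow> complex" where
  "nth_deriv n = (\<lambda>\<psi> x. vector_derivative \<psi> (at x)) ^^ n"

definition test_functions_on :: "real set \<Rightarrow> (real \<Rightarrow> complex) set" where
  "test_functions_on K =
     {\<psi>. (\<forall>n x. nth_deriv n \<psi> differentiable (at x)) \<and> (\<forall>x. x \<notin> K \<longrightarrow> \<psi> x = 0)}"

definition test_functions :: "(real \<Rightarrow> complex) set" where
  "test_functions = (\<Union>K\<in>{K. compact K}. test_functions_on K)"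

text \<open>A distribution is a linear functional on the test functions that is bounded on the
  functions supported in a compact set by finitely many of their derivatives. Functionals are
  made undefined off the test functions, so that equality of distributions is equality of
  functionals on test functions.\<close>

definition distributions :: "((real \<Rightarrow> complex) \<Rightarrow> complex) set" where
  "distributions =
     {F \<in> extensional test_functions.
        (\<forall>\<psi>\<in>test_functions. \<forall>\<eta>\<in>test_functions. F (\<lambda>x. \<psi> x + \<eta> x) = F \<psi> + F \<eta>) \<and>
        (\<forall>c. \<forall>\<psi>\<in>test_functions. F (\<lambda>x. c * \<psi> x) = c * F \<psi>) \<and>
        (\<forall>K. compact K \<longrightarrow> (\<exists>C N. \<forall>\<psi>\<in>test_functions_on K.
           norm (F \<psi>) \<le> C * (\<Sum>k\<le>N. SUP x. norm (nth_deriv k \<psi> x))))}"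

text \<open>The weak-* topology, i.e. the topology of pointwise convergence on test functions.
  It has the same convergent sequences as the strong dual topology, hence both topologies
  give the same continuity statements for maps defined on a metrizable space.\<close>

definition distribution_topology :: "((real \<Rightarrow> complex) \<Rightarrow> complex) topology" where
  "distribution_topology =
     subtopology (product_topology (\<lambda>_. euclidean) test_functions) distributions"

definition distribution_of :: "real L2 \<Rightarrow> (real \<Rightarrow> complex) \<Rightarrow> complex" where
  "distribution_of f =
     (\<lambda>\<psi>\<in>test_functions. LINT x|lborel. complex_of_real (rep_L2 f x) * \<psi> x)"

lemma topspace_distribution_topology [simp]:
  "topspace distribution_topology = distributions"
  by (auto simp: distribution_topology_def distributions_def PiE_def)

lemma test_function_continuous:
  assumes "\<psi> \<in> test_functions_on K"
  shows "continuous_on UNIV \<psi>"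
proof -
  have "nth_deriv 0 \<psi> differentiable (at x)" for x
    using assms unfolding test_functions_on_def by blast
  then have "\<psi> differentiable (at x)" for x
    by (simp add: nth_deriv_def)
  then show ?thesis
    by (simp add: continuous_on_eq_continuous_at differentiable_imp_continuous_within)
qed

lemma test_function_bdd_above:
  assumes "\<psi> \<in> test_functions_on K" "compact K"
  shows "bdd_above (range (\<lambda>x. norm (\<psi> x)))"
proof -
  have "compact (\<psi> ` K)"
    using assms test_function_continuous continuous_on_subset
    by (blast intro: compact_continuous_image)
  then obtain B where B: "\<forall>y\<in>\<psi> ` K. norm y \<le> B"
    using compact_imp_bounded bounded_iff by blast
  have "norm (\<psi> x) \<le> max B 0" for x
    using assms B by (cases "x \<in> K") (auto simp: test_functions_on_def le_max_iff_disj)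
  then show ?thesis
    by (auto intro!: bdd_aboveI2)
qed

lemma rep_L2_integrable_on_compact:
  fixes f :: "real L2"
  assumes "compact K"
  shows "integrable lborel (\<lambda>x. indicator K x * rep_L2 f x)"
proof (rule Bochner_Integration.integrable_bound)
  have K: "K \<in> sets lborel" "emeasure lborel K < \<infinity>"
    using assms emeasure_bounded_finite[OF compact_imp_bounded]
    by (auto simp: compact_imp_closed borel_closed)
  show "integrable lborel (\<lambda>x. indicator K x + (norm (rep_L2 f x))\<^sup>2 :: real)"
    using rep_L2[of f] K
    by (intro Bochner_Integration.integrable_add) (auto simp: square_integrable_def)
  show "(\<lambda>x. indicator K x * rep_L2 f x) \<in> borel_measurable lborel"
    using rep_L2[of f] K(1) by (auto simp: square_integrable_def)
  have "\<bar>y\<bar> \<le> 1 + y\<^sup>2" for y :: real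
    using sum_squares_bound[of 1 "\<bar>y\<bar>"] by auto
  then show "AE x in lborel. norm (indicator K x * rep_L2 f x)
      \<le> norm (indicator K x + (norm (rep_L2 f x))\<^sup>2)"
    by (auto simp: indicator_def)
qed

lemma integrable_rep_L2_test_function:
  assumes \<psi>: "\<psi> \<in> test_functions_on K" and K: "compact K"
  shows "integrable lborel (\<lambda>x. complex_of_real (rep_L2 f x) * \<psi> x)"
    and "norm (LINT x|lborel. complex_of_real (rep_L2 f x) * \<psi> x) \<le>
      (LINT x|lborel. \<bar>indicator K x * rep_L2 f x\<bar>) * (SUP x. norm (\<psi> x))"
proof -
  let ?S = "SUP x. norm (\<psi> x)"
  have le: "norm (complex_of_real (rep_L2 f x) * \<psi> x)
      \<le> \<bar>indicator K x * rep_L2 f x\<bar> * ?S" for x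
  proof (cases "x \<in> K")
    case True
    have "norm (\<psi> x) \<le> ?S"
      by (rule cSUP_upper[OF UNIV_I test_function_bdd_above[OF assms]])
    with True show ?thesis
      by (simp add: norm_mult mult_left_mono)
  next
    case False
    then show ?thesis
      using \<psi> by (simp add: test_functions_on_def)
  qed
  have int: "integrable lborel (\<lambda>x. \<bar>indicator K x * rep_L2 f x\<bar> * ?S)"
    using rep_L2_integrable_on_compact[OF K, of f] by auto
  have [measurable]: "\<psi> \<in> borel_measurable borel" "rep_L2 f \<in> borel_measurable borel"
    using test_function_continuous[OF \<psi>] rep_L2[of f]
    by (auto simp: square_integrable_def borel_measurable_continuous_onI)
  show 1: "integrable lborel (\<lambda>x. complex_of_real (rep_L2 f x) * \<psi> x)"
    by (rule Bochner_Integration.integrable_bound[OF int])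
      (use le in \<open>auto intro!: AE_I2 intro: order_trans[OF _ abs_ge_self]\<close>)
  have "norm (LINT x|lborel. complex_of_real (rep_L2 f x) * \<psi> x)
      \<le> (LINT x|lborel. norm (complex_of_real (rep_L2 f x) * \<psi> x))"
    by (rule integral_norm_bound)
  also have "\<dots> \<le> (LINT x|lborel. \<bar>indicator K x * rep_L2 f x\<bar> * ?S)"
    by (rule integral_mono[OF integrable_norm[OF 1] int le])
  finally show "norm (LINT x|lborel. complex_of_real (rep_L2 f x) * \<psi> x) \<le>
      (LINT x|lborel. \<bar>indicator K x * rep_L2 f x\<bar>) * ?S"
    by simp
qed

lemma nth_deriv_add:
  assumes "\<And>n x. nth_deriv n \<psi> differentiable (at x)" "\<And>n x. nth_deriv n \<eta> differentiable (at x)"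
  shows "nth_deriv n (\<lambda>x. \<psi> x + \<eta> x) = (\<lambda>x. nth_deriv n \<psi> x + nth_deriv n \<eta> x)"
proof (induction n)
  case (Suc n)
  have "vector_derivative (\<lambda>x. nth_deriv n \<psi> x + nth_deriv n \<eta> x) (at x)
      = nth_deriv (Suc n) \<psi> x + nth_deriv (Suc n) \<eta> x" for x
    using assms[of n x] by (simp add: nth_deriv_def)
  with Suc show ?case
    by (simp add: nth_deriv_def)
qed (simp add: nth_deriv_def)

lemma nth_deriv_cmult:
  assumes "\<And>n x. nth_deriv n \<psi> differentiable (at x)"
  shows "nth_deriv n (\<lambda>x. c * \<psi> x) = (\<lambda>x. c * nth_deriv n \<psi> x)"
proof (induction n)
  case (Suc n)
  have "vector_derivative (\<lambda>x. c * nth_deriv n \<psi> x) (at x) = c * nth_deriv (Suc n) \<psi> x" for x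
    using assms[of n x] by (simp add: nth_deriv_def)
  with Suc show ?case
    by (simp add: nth_deriv_def)
qed (simp add: nth_deriv_def)

lemma test_functions_add:
  assumes "\<psi> \<in> test_functions" "\<eta> \<in> test_functions"
  shows "(\<lambda>x. \<psi> x + \<eta> x) \<in> test_functions"
proof -
  obtain K L where K: "compact K" "\<psi> \<in> test_functions_on K"
    and L: "compact L" "\<eta> \<in> test_functions_on L"
    using assms by (auto simp: test_functions_def)
  have "(\<lambda>x. \<psi> x + \<eta> x) \<in> test_functions_on (K \<union> L)"
    using K L by (simp add: test_functions_on_def nth_deriv_add)
  moreover have "compact (K \<union> L)"
    using K L by (simp add: compact_Un)
  ultimately show ?thesis
    unfolding test_functions_def by blast
qed

lemma test_functions_cmult:
  assumes "\<psi> \<in> test_functions"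
  shows "(\<lambda>x. c * \<psi> x) \<in> test_functions"
  using assms by (auto simp: test_functions_def test_functions_on_def nth_deriv_cmult)

lemma distribution_of_in_distributions: "distribution_of f \<in> distributions"
proof -
  have "distribution_of f (\<lambda>x. \<psi> x + \<eta> x) = distribution_of f \<psi> + distribution_of f \<eta>"
    if \<psi>\<eta>: "\<psi> \<in> test_functions" "\<eta> \<in> test_functions" for \<psi> \<eta>
  proof -
    have "integrable lborel (\<lambda>x. complex_of_real (rep_L2 f x) * \<psi> x)"
      "integrable lborel (\<lambda>x. complex_of_real (rep_L2 f x) * \<eta> x)"
      using \<psi>\<eta> integrable_rep_L2_test_function(1) by (auto simp: test_functions_def)
    then show ?thesis
      using \<psi>\<eta> test_functions_add by (simp add: distribution_of_def distrib_left)
  qed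
  moreover have "distribution_of f (\<lambda>x. c * \<psi> x) = c * distribution_of f \<psi>"
    if "\<psi> \<in> test_functions" for \<psi> c
    using that test_functions_cmult
    by (simp add: distribution_of_def mult.left_commute)
  moreover have "\<exists>C N. \<forall>\<psi>\<in>test_functions_on K.
      norm (distribution_of f \<psi>) \<le> C * (\<Sum>k\<le>N. SUP x. norm (nth_deriv k \<psi> x))"
    if "compact K" for K
  proof (intro exI[of _ "LINT x|lborel. \<bar>indicator K x * rep_L2 f x\<bar>"] exI[of _ 0] ballI)
    fix \<psi> assume "\<psi> \<in> test_functions_on K"
    moreover from this have "\<psi> \<in> test_functions"
      using that by (auto simp: test_functions_def)
    ultimately show "norm (distribution_of f \<psi>) \<le>
        (LINT x|lborel. \<bar>indicator K x * rep_L2 f x\<bar>) *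
        (\<Sum>k\<le>0. SUP x. norm (nth_deriv k \<psi> x))"
      using integrable_rep_L2_test_function(2)[OF _ that, of \<psi> f]
      by (simp add: distribution_of_def nth_deriv_def)
  qed
  ultimately show ?thesis
    by (auto simp: distributions_def distribution_of_def)
qed


section \<open>The BBM equation\<close>

definition bbm_symbol :: "real \<Rightarrow> real" where
  "bbm_symbol \<xi> = \<xi> / (1 + \<xi>\<^sup>2)"

definition bbm_group :: "real \<Rightarrow> complex L2 \<Rightarrow> complex L2" where
  "bbm_group t = multiplier_L2 (\<lambda>\<xi>. exp (- (\<i> * complex_of_real (t * bbm_symbol \<xi>))))"

definition bbm_nonlinearity :: "real L2 \<Rightarrow> complex L2" where
  "bbm_nonlinearity u =
     multiplier_L1 (\<lambda>\<xi>. complex_of_real (bbm_symbol \<xi>)) (\<lambda>x. complex_of_real ((rep_L2 u x)\<^sup>2))"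

text \<open>Solutions in \<open>C([0,T]; L\<^sup>2)\<close> of the integral equation
  \<open>u(t) = S(t)u\<^sub>0 - (i/2) \<integral>\<^sub>0\<^sup>t S(t-t') \<phi>(D)(u(t')\<^sup>2) dt'\<close>,
  where \<open>S\<close> is \<^term>\<open>bbm_group\<close>. The equation is an identity in \<open>L\<^sup>2\<close> and the integral, of a
  continuous function of \<open>t'\<close>, is that of an \<open>L\<^sup>2\<close>-valued function.\<close>

definition bbm_solution :: "real \<Rightarrow> real L2 \<Rightarrow> (real \<Rightarrow> real L2) \<Rightarrow> bool" where
  "bbm_solution T u0 u \<longleftrightarrow>
     continuous_on {0..T} u \<and>
     (\<forall>t\<in>{0..T}. \<exists>I.
        ((\<lambda>t'. bbm_group (t - t') (bbm_nonlinearity (u t'))) has_integral I) {0..t} \<and>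
        complex_L2 (u t) = bbm_group t (complex_L2 u0) - scaleC_L2 (\<i> / 2) I)"

text \<open>The value at time \<open>t \<ge> 0\<close> of the solution with initial data \<open>u0\<close>. By the theorem of
  Bona and Tzvetkov there is exactly one solution on \<open>[0,t]\<close>, namely the restriction of the
  global one.\<close>

definition bbm_flow :: "real \<Rightarrow> real L2 \<Rightarrow> real L2" where
  "bbm_flow t u0 = (THE v. \<exists>u. bbm_solution t u0 u \<and> u t = v)"

end

theory Submission
  imports Defs "HOL-Probability.Characteristic_Functions" "HOL-Probability.Sinc_Integral"
begin

text \<open>
  Take the data \<open>\<epsilon> v\<^sub>n\<close> with \<open>v\<^sub>n(x) = g(x) cos (n x)\<close>, where \<open>g\<^sup>2 = \<eta>\<close> is a bump function. They have
  bounded \<open>L\<^sup>2\<close> norm, but tend to \<open>0\<close> in \<open>H\<^sup>s\<close> for every \<open>s < 0\<close>. In the expansion of the solution in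
  powers of \<open>\<epsilon>\<close>, the linear term \<open>\<epsilon> S(t) v\<^sub>n\<close> tends to \<open>0\<close> weakly. As \<open>\<phi>(D)\<close> is smoothing,
  \<open>S(t) v\<^sub>n - v\<^sub>n\<close> tends to \<open>0\<close> strongly in \<open>L\<^sup>2\<close>, and \<open>\<phi>(D)(v\<^sub>n\<^sup>2)\<close> to \<open>\<phi>(D)\<eta> / 2\<close>, because
  \<open>v\<^sub>n\<^sup>2 = (\<eta> + \<eta> cos (2 n x)) / 2\<close>. So the quadratic term has a nonzero limit, namely \<open>\<epsilon>\<^sup>2\<close> times
  \<open>t h + O(t\<^sup>2)\<close> with \<open>h = - (\<i>/4) \<phi>(D) \<eta>\<close>, and \<open>\<langle>h, \<eta>'\<rangle> = - 1/4 \<integral> \<xi>\<^sup>2 / (1 + \<xi>\<^sup>2) \<bar>\<F>\<eta>\<bar>\<^sup>2 \<noteq> 0\<close>. The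
  remainder is \<open>O(\<epsilon>\<^sup>3)\<close> uniformly in \<open>n\<close>, hence the solutions do not tend to \<open>0\<close> in the sense
  of distributions when \<open>\<epsilon>\<close> is small.
\<close>

section \<open>Completeness and density in \<open>L\<^sup>2\<close>\<close>

text \<open>\<open>bbm_flow\<close> is a definite description, so its value can be used only once
  existence and uniqueness on \<open>[0,t]\<close> are established for the data at hand. Both are
  obtained on real L2 by contraction and by Gronwall. The bilinear term is bounded there because
  \<open>\<phi>\<close> is square integrable: the transform of a product of two L2 functions is
  bounded, and \<open>\<phi>\<close> times a bounded function is in L2. The contraction asks for
  smallness of t times the size of the data, so every t is reached by shrinking
  \<open>\<epsilon>\<close>. The restriction \<open>t < T\<close> comes only from the O(t^2) error
  in the limit of the quadratic term, which must not cancel the leading part \<open>t h\<close>. The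
  order of choices is: t, then \<open>\<epsilon>\<close> depending on t, then n to infinity. The
  remainder does not become small in n; it loses only because \<open>\<epsilon>^3\<close> is beaten
  by \<open>\<epsilon>^2\<close>. The pairing is with \<open>\<eta>'\<close> and not with
  \<open>\<eta>\<close>: \<open>\<phi>\<close> is odd, so the pairing with \<open>\<eta>\<close>
  vanishes, while the extra factor \<open>\<xi>\<close> makes the integrand of one sign.\<close>

lemma square_integrable_measurable [measurable_dest]:
  "square_integrable f \<Longrightarrow> f \<in> borel_measurable borel"
  by (simp add: square_integrable_def)

lemma measurable_rep_L2 [measurable]: "rep_L2 f \<in> borel_measurable borel"
  using rep_L2 by (rule square_integrable_measurable)

lemma abs_L2_cong:
  assumes "square_integrable f" "square_integrable g" "AE x in lborel. f x = g x"
  shows "abs_L2 f = abs_L2 g"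
  using Quotient3_rel_abs[OF Quotient3_L2, of f g] assms by (simp add: L2_rel_def)

lemma abs_rep_L2 [simp]: "abs_L2 (rep_L2 f) = f"
  by (rule Quotient3_abs_rep[OF Quotient3_L2])

lemma L2_eqI: "(AE x in lborel. rep_L2 f x = rep_L2 g x) \<Longrightarrow> f = g"
  using abs_L2_cong[OF rep_L2 rep_L2] by fastforce

lemma abs_L2_add:
  "square_integrable f \<Longrightarrow> square_integrable g \<Longrightarrow> abs_L2 f + abs_L2 g = abs_L2 (\<lambda>x. f x + g x)"
  by (rule plus_L2.abs_eq) (auto simp: L2_rel_def)

lemma abs_L2_diff:
  "square_integrable f \<Longrightarrow> square_integrable g \<Longrightarrow> abs_L2 f - abs_L2 g = abs_L2 (\<lambda>x. f x - g x)"
  by (rule minus_L2.abs_eq) (auto simp: L2_rel_def)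

lemma abs_L2_scaleR: "square_integrable f \<Longrightarrow> c *\<^sub>R abs_L2 f = abs_L2 (\<lambda>x. c *\<^sub>R f x)"
  by (rule scaleR_L2.abs_eq) (auto simp: L2_rel_def)

lemma inner_abs_L2:
  "square_integrable f \<Longrightarrow> square_integrable g \<Longrightarrow> abs_L2 f \<bullet> abs_L2 g = (LINT x|lborel. f x \<bullet> g x)"
  by (rule inner_L2.abs_eq) (auto simp: L2_rel_def)

lemma norm_abs_L2: "square_integrable f \<Longrightarrow> (norm (abs_L2 f))\<^sup>2 = (LINT x|lborel. (norm (f x))\<^sup>2)"
  by (simp add: power2_norm_eq_inner inner_abs_L2)

lemma norm_rep_L2: "(norm f)\<^sup>2 = (LINT x|lborel. (norm (rep_L2 f x))\<^sup>2)"
  using norm_abs_L2[OF rep_L2, of f] by simp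

lemma rep_L2_add: "AE x in lborel. rep_L2 (f + g) x = rep_L2 f x + rep_L2 g x"
  using rep_abs_L2[OF square_integrable_add[OF rep_L2 rep_L2], of f g]
  by (simp add: abs_L2_add[OF rep_L2 rep_L2, symmetric])

lemma rep_L2_scaleR: "AE x in lborel. rep_L2 (c *\<^sub>R f) x = c *\<^sub>R rep_L2 f x"
  using rep_abs_L2[OF square_integrable_scaleR[OF rep_L2], of c f]
  by (simp add: abs_L2_scaleR[OF rep_L2, symmetric])

lemma square_integrable_bound:
  fixes f :: "real \<Rightarrow> 'a::euclidean_space" and g :: "real \<Rightarrow> 'b::euclidean_space"
  assumes g: "square_integrable g" and [measurable]: "f \<in> borel_measurable borel"
    and le: "AE x in lborel. norm (f x) \<le> norm (g x)"
  shows "square_integrable f"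
  unfolding square_integrable_def
proof
  show "integrable lborel (\<lambda>x. (norm (f x))\<^sup>2)"
  proof (rule Bochner_Integration.integrable_bound)
    show "integrable lborel (\<lambda>x. (norm (g x))\<^sup>2)"
      using g by (simp add: square_integrable_def)
    show "AE x in lborel. norm ((norm (f x))\<^sup>2) \<le> norm ((norm (g x))\<^sup>2)"
      using le by eventually_elim (simp add: power_mono)
  qed simp
qed simp

text \<open>Fatou's lemma for the squared norms yields membership in L2 and the bound at once. The
  bound is asked only eventually, so that the lemma applies to the tail of a Cauchy
  sequence.\<close>

lemma L2_fatou:
  fixes f :: "nat \<Rightarrow> real \<Rightarrow> 'a::euclidean_space"
  assumes f: "\<And>n. square_integrable (f n)" and [measurable]: "g \<in> borel_measurable borel"
    and lim: "AE x in lborel. (\<lambda>n. f n x) \<longlonglongrightarrow> g x"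
    and c: "\<forall>\<^sub>F n in sequentially. norm (abs_L2 (f n)) \<le> c" and "0 \<le> c"
  shows "square_integrable g \<and> norm (abs_L2 g) \<le> c"
proof -
  have [measurable]: "f n \<in> borel_measurable borel" for n
    using f by (rule square_integrable_measurable)
  have eq: "(\<integral>\<^sup>+x. ennreal ((norm (f n x))\<^sup>2) \<partial>lborel) = ennreal ((norm (abs_L2 (f n)))\<^sup>2)" for n
    using f[of n] by (subst nn_integral_eq_integral) (auto simp: square_integrable_def norm_abs_L2)
  have "(\<integral>\<^sup>+x. ennreal ((norm (g x))\<^sup>2) \<partial>lborel)
      = (\<integral>\<^sup>+x. liminf (\<lambda>n. ennreal ((norm (f n x))\<^sup>2)) \<partial>lborel)"
  proof (rule nn_integral_cong_AE)
    show "AE x in lborel. ennreal ((norm (g x))\<^sup>2) = liminf (\<lambda>n. ennreal ((norm (f n x))\<^sup>2))"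
      using lim
    proof eventually_elim
      case (elim x)
      have "(\<lambda>n. ennreal ((norm (f n x))\<^sup>2)) \<longlonglongrightarrow> ennreal ((norm (g x))\<^sup>2)"
        by (intro tendsto_ennrealI tendsto_intros elim)
      then show ?case
        by (intro lim_imp_Liminf[symmetric]) simp_all
    qed
  qed
  also have "\<dots> \<le> liminf (\<lambda>n. \<integral>\<^sup>+x. ennreal ((norm (f n x))\<^sup>2) \<partial>lborel)"
    by (rule nn_integral_liminf) simp
  also have "\<dots> \<le> liminf (\<lambda>n. ennreal (c\<^sup>2))"
    unfolding eq by (rule Liminf_mono, use c in eventually_elim) (simp add: ennreal_leI power_mono)
  finally have le: "(\<integral>\<^sup>+x. ennreal ((norm (g x))\<^sup>2) \<partial>lborel) \<le> ennreal (c\<^sup>2)"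
    by (simp add: Liminf_const)
  have "integrable lborel (\<lambda>x. (norm (g x))\<^sup>2)"
    by (rule integrableI_bounded) (use le in \<open>auto simp: less_top[symmetric] top_unique\<close>)
  then have sq: "square_integrable g"
    by (simp add: square_integrable_def)
  then have "ennreal ((norm (abs_L2 g))\<^sup>2) \<le> ennreal (c\<^sup>2)"
    using le by (subst (asm) nn_integral_eq_integral) (auto simp: square_integrable_def norm_abs_L2)
  then have "norm (abs_L2 g) \<le> c"
    using \<open>0 \<le> c\<close> by (simp add: abs_le_square_iff[symmetric] ennreal_le_iff)
  with sq show ?thesis by simp
qed

text \<open>Dominated convergence for the squared difference, with \<open>w\<close> squared as
  integrable majorant.\<close>

lemma abs_L2_tendsto_dominated:
  fixes f :: "nat \<Rightarrow> real \<Rightarrow> 'a::euclidean_space"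
  assumes f: "\<And>n. square_integrable (f n)" and g: "square_integrable g"
    and lim: "AE x in lborel. (\<lambda>n. f n x) \<longlonglongrightarrow> g x"
    and w: "square_integrable (w :: real \<Rightarrow> real)" "\<And>n. AE x in lborel. norm (f n x - g x) \<le> w x"
  shows "(\<lambda>n. abs_L2 (f n)) \<longlonglongrightarrow> abs_L2 g"
proof -
  have [measurable]: "f n \<in> borel_measurable borel" "g \<in> borel_measurable borel" for n
    using f g by (auto intro: square_integrable_measurable)
  have "(\<lambda>n. LINT x|lborel. (norm (f n x - g x))\<^sup>2) \<longlonglongrightarrow> (LINT (x::real)|lborel. (0::real))"
  proof (rule integral_dominated_convergence)
    show "integrable lborel (\<lambda>x. (w x)\<^sup>2)"
      using w(1) by (simp add: square_integrable_def)
    show "AE x in lborel. (\<lambda>n. (norm (f n x - g x))\<^sup>2) \<longlonglongrightarrow> 0"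
      using lim
    proof eventually_elim
      case (elim x)
      have "(\<lambda>n. (norm (f n x - g x))\<^sup>2) \<longlonglongrightarrow> (norm (g x - g x))\<^sup>2"
        by (intro tendsto_intros elim)
      then show ?case by simp
    qed
    show "AE x in lborel. norm ((norm (f n x - g x))\<^sup>2) \<le> (w x)\<^sup>2" for n
      using w(2)[of n] by eventually_elim (simp add: power_mono)
  qed auto
  moreover have "(LINT x|lborel. (norm (f n x - g x))\<^sup>2) = (norm (abs_L2 (f n) - abs_L2 g))\<^sup>2" for n
    using f g by (simp add: abs_L2_diff norm_abs_L2 square_integrable_diff)
  ultimately have "(\<lambda>n. (norm (abs_L2 (f n) - abs_L2 g))\<^sup>2) \<longlonglongrightarrow> 0"
    by simp
  then have "(\<lambda>n. norm (abs_L2 (f n) - abs_L2 g)) \<longlonglongrightarrow> 0"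
    using tendsto_real_sqrt[of "\<lambda>n. (norm (abs_L2 (f n) - abs_L2 g))\<^sup>2" 0] by simp
  then show ?thesis
    by (simp add: LIM_zero_iff tendsto_norm_zero_iff)
qed

text \<open>Riesz-Fischer: a subsequence with geometrically small gaps converges almost everywhere,
  Fatou's lemma turns the pointwise limit into an L2 limit, and a Cauchy sequence with a convergent
  subsequence converges.\<close>

instance L2 :: (euclidean_space) banach
proof
  fix X :: "nat \<Rightarrow> 'a L2"
  assume X: "Cauchy X"
  have "\<exists>N. \<forall>m\<ge>N. \<forall>n\<ge>N. norm (X m - X n) < (1/4)^k" for k :: nat
    using X by (simp add: Cauchy_iff)
  then obtain N where N: "\<And>k m n. N k \<le> m \<Longrightarrow> N k \<le> n \<Longrightarrow> norm (X m - X n) < (1/4)^k"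
    by metis
  \<comment> \<open>The partial sum dominates \<open>N k\<close>, and the summand \<open>k\<close>
    makes \<open>r\<close> strictly increasing.\<close>
  define r where "r k = (\<Sum>j\<le>k. N j) + k" for k
  have r_mono: "strict_mono r"
    by (rule strict_monoI_Suc) (simp add: r_def)
  have rN: "N k \<le> r k" for k
    using member_le_sum[of k "{..k}" N] by (auto simp: r_def)
  have r: "norm (X (r m) - X (r n)) < (1/4)^k" if "k \<le> m" "k \<le> n" for k m n
    using N[of k "r m" "r n"] rN[of k] strict_mono_leD[OF r_mono] that le_trans by meson
  define f where "f n = rep_L2 (X (r n))" for n
  have f: "square_integrable (f n)" and abs_f: "abs_L2 (f n) = X (r n)" for n
    by (simp_all add: f_def rep_L2)
  have [measurable]: "f n \<in> borel_measurable borel" for n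
    by (simp add: f_def)
  \<comment> \<open>The gaps squared are at most \<open>(1/16)^n\<close>, so the weight
    \<open>4^n\<close> leaves a summable \<open>(1/4)^n\<close>. Conversely, boundedness of the
    weighted squares at a point gives gaps of order \<open>(1/2)^n\<close> there, hence pointwise
    convergence.\<close>
  let ?d = "\<lambda>n x. 4^n * (norm (f (Suc n) x - f n x))\<^sup>2"
  have d: "(\<integral>\<^sup>+x. ennreal (?d n x) \<partial>lborel) \<le> ennreal ((1/4)^n)" for n
  proof -
    have "(\<integral>\<^sup>+x. ennreal (?d n x) \<partial>lborel) = ennreal (LINT x|lborel. ?d n x)"
      using square_integrable_diff[OF f[of "Suc n"] f[of n]]
      by (subst nn_integral_eq_integral) (auto simp: square_integrable_def)
    also have "(LINT x|lborel. ?d n x) = 4^n * (norm (X (r (Suc n)) - X (r n)))\<^sup>2"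
      using f by (simp add: norm_abs_L2[symmetric] square_integrable_diff abs_L2_diff[symmetric] abs_f)
    also have "\<dots> \<le> 4^n * ((1/4)^n)\<^sup>2"
      using r[of n "Suc n" n] by (intro mult_left_mono power_mono) auto
    also have "\<dots> = (1/4)^n"
      by (simp add: power2_eq_square power_mult_distrib[symmetric] mult.assoc[symmetric])
    finally show ?thesis
      by (simp add: ennreal_leI)
  qed
  have "(\<integral>\<^sup>+x. (\<Sum>n. ennreal (?d n x)) \<partial>lborel) = (\<Sum>n. \<integral>\<^sup>+x. ennreal (?d n x) \<partial>lborel)"
    by (rule nn_integral_suminf) simp
  also have "\<dots> \<le> (\<Sum>n. ennreal ((1/4)^n))"
    by (intro suminf_le d) auto
  also have "\<dots> < \<infinity>"
    using summable_geometric[of "1/4::real"]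
    by (subst suminf_ennreal2) auto
  finally have "(\<integral>\<^sup>+x. (\<Sum>n. ennreal (?d n x)) \<partial>lborel) \<noteq> \<infinity>"
    by simp
  then have "AE x in lborel. (\<Sum>n. ennreal (?d n x)) \<noteq> \<infinity>"
    by (intro nn_integral_PInf_AE) auto
  then have conv: "AE x in lborel. convergent (\<lambda>n. f n x)"
  proof eventually_elim
    case (elim x)
    then have "summable (\<lambda>n. ?d n x)"
      by (intro summable_suminf_not_top) auto
    then have "(\<lambda>n. ?d n x) \<longlonglongrightarrow> 0"
      by (rule summable_LIMSEQ_zero)
    then have "Bseq (\<lambda>n. ?d n x)"
      by (intro convergent_imp_Bseq) (auto simp: convergent_def)
    then obtain K where K: "K > 0" "\<And>n. norm (?d n x) \<le> K"
      by (auto elim: BseqE)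
    have le: "norm (f (Suc n) x - f n x) \<le> sqrt K * (1/2)^n" for n
    proof -
      have "(2^n * norm (f (Suc n) x - f n x))\<^sup>2 \<le> K"
        using K(2)[of n] by (simp add: power_mult_distrib power_mult[symmetric] mult.commute[of n] power_mult)
      then have "2^n * norm (f (Suc n) x - f n x) \<le> sqrt K"
        by (rule real_le_rsqrt)
      then show ?thesis
        by (simp add: field_simps)
    qed
    have "summable (\<lambda>n. sqrt K * (1/2)^n)"
      by (intro summable_mult) (simp add: summable_geometric)
    then have "summable (\<lambda>n. f (Suc n) x - f n x)"
      by (rule summable_comparison_test') (rule le)
    then have "convergent (\<lambda>n. \<Sum>i<n. f (Suc i) x - f i x)"
      by (simp add: summable_iff_convergent)
    then have "convergent (\<lambda>n. f n x - f 0 x)"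
      by (simp add: sum_lessThan_telescope[of "\<lambda>n. f n x"])
    then show ?case
      using convergent_diff_const_right_iff by blast
  qed
  define g where "g x = lim (\<lambda>n. f n x)" for x
  have [measurable]: "g \<in> borel_measurable borel"
    unfolding g_def by measurable
  have lim: "AE x in lborel. (\<lambda>n. f n x) \<longlonglongrightarrow> g x"
    using conv by eventually_elim (simp add: g_def convergent_LIMSEQ_iff)
  \<comment> \<open>The estimate between \<open>f m\<close> and all later \<open>f n\<close>
    survives the limit in \<open>n\<close> by Fatou's lemma.\<close>
  have fg: "square_integrable (\<lambda>x. f m x - g x) \<and> norm (abs_L2 (\<lambda>x. f m x - g x)) \<le> (1/4)^m" for m
  proof (rule L2_fatou)
    show "AE x in lborel. (\<lambda>n. f m x - f n x) \<longlonglongrightarrow> f m x - g x"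
      using lim by eventually_elim (intro tendsto_intros)
    show "\<forall>\<^sub>F n in sequentially. norm (abs_L2 (\<lambda>x. f m x - f n x)) \<le> (1/4)^m"
      using eventually_ge_at_top[of m]
      by eventually_elim (use r[of m m] in \<open>simp add: abs_L2_diff[symmetric] f abs_f less_imp_le\<close>)
  qed (auto intro: square_integrable_diff f)
  then have g: "square_integrable g"
    using square_integrable_diff[OF f[of 0], of "\<lambda>x. f 0 x - g x"] by simp
  have "(\<lambda>m. norm (X (r m) - abs_L2 g)) \<longlonglongrightarrow> 0"
  proof (rule tendsto_sandwich[OF _ _ tendsto_const])
    show "(\<lambda>m. (1/4)^m :: real) \<longlonglongrightarrow> 0"
      by (rule LIMSEQ_realpow_zero) auto
    show "\<forall>\<^sub>F m in sequentially. norm (X (r m) - abs_L2 g) \<le> (1/4)^m"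
      using fg by (simp add: abs_f[symmetric] abs_L2_diff f g)
  qed simp
  then have "(\<lambda>m. X (r m)) \<longlonglongrightarrow> abs_L2 g"
    by (simp add: LIM_zero_iff tendsto_norm_zero_iff)
  with X r_mono have "X \<longlonglongrightarrow> abs_L2 g"
    by (intro Cauchy_converges_subseq[of X r]) (simp_all add: comp_def)
  then show "convergent X"
    by (auto simp: convergent_def)
qed

section \<open>Compact supports and approximation by continuous functions\<close>

lemma square_integrable_bounded_support:
  fixes f :: "real \<Rightarrow> 'a::euclidean_space"
  assumes [measurable]: "f \<in> borel_measurable borel"
    and "\<And>x. norm (f x) \<le> B" "\<And>x. \<bar>x\<bar> > R \<Longrightarrow> f x = 0"
  shows "square_integrable f"
  unfolding square_integrable_def
proof
  have B: "0 \<le> B"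
    using assms(2)[of 0] norm_ge_zero order_trans by blast
  have sq: "(norm (f x))\<^sup>2 \<le> B\<^sup>2" for x
    using assms(2) by (intro power_mono) auto
  have ind: "integrable lborel (\<lambda>x. indicator {- R..R} x *\<^sub>R B\<^sup>2)"
    by (intro integrable_scaleR_left integrable_real_indicator) (auto simp: emeasure_lborel_Icc_eq)
  show "integrable lborel (\<lambda>x. (norm (f x))\<^sup>2)"
  proof (rule Bochner_Integration.integrable_bound[OF ind])
    show "AE x in lborel. norm ((norm (f x))\<^sup>2) \<le> norm (indicator {- R..R} x *\<^sub>R B\<^sup>2)"
      using sq assms(3) by (intro AE_I2) (auto simp: indicator_def abs_if)
  qed simp
qed simp

text \<open>Cauchy-Schwarz against the indicator of an interval containing the support. On a fixed
  bounded set, L2 convergence thus implies L1 convergence, and with it uniform convergence of the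
  Fourier integrals.\<close>

lemma integrable_square_integrable_support:
  fixes f :: "real \<Rightarrow> 'a::euclidean_space"
  assumes f: "square_integrable f" and supp: "\<And>x. \<bar>x\<bar> > R \<Longrightarrow> f x = 0"
  shows "integrable lborel f"
    and "(LINT x|lborel. norm (f x)) \<le> sqrt (2 * \<bar>R\<bar>) * norm (abs_L2 f)"
proof -
  note [measurable] = square_integrable_measurable[OF f]
  let ?i = "indicator {- \<bar>R\<bar>..\<bar>R\<bar>} :: real \<Rightarrow> real"
  have i: "square_integrable ?i"
    by (rule square_integrable_bounded_support[where B = 1 and R = "\<bar>R\<bar>"]) (auto simp: indicator_def)
  have n: "square_integrable (\<lambda>x. norm (f x))"
    by (rule square_integrable_bound[OF f]) auto
  have eq: "?i x \<bullet> norm (f x) = norm (f x)" for x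
    using supp[of x] by (cases "\<bar>x\<bar> > R") (auto simp: indicator_def)
  have "integrable lborel (\<lambda>x. norm (f x))"
    using square_integrable_inner[OF i n] unfolding eq .
  then show "integrable lborel f"
    by (simp add: integrable_norm_iff)
  have "(norm (abs_L2 ?i))\<^sup>2 = 2 * \<bar>R\<bar>"
    by (subst norm_abs_L2[OF i]) (simp add: power2_eq_square indicator_inter_arith[symmetric])
  then have ni: "norm (abs_L2 ?i) = sqrt (2 * \<bar>R\<bar>)"
    by (metis norm_ge_zero real_sqrt_unique)
  have "(norm (abs_L2 (\<lambda>x. norm (f x))))\<^sup>2 = (norm (abs_L2 f))\<^sup>2"
    using f n by (simp add: norm_abs_L2)
  then have nf: "norm (abs_L2 (\<lambda>x. norm (f x))) = norm (abs_L2 f)"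
    by simp
  have "(LINT x|lborel. norm (f x)) = abs_L2 ?i \<bullet> abs_L2 (\<lambda>x. norm (f x))"
    unfolding inner_abs_L2[OF i n] eq ..
  also have "\<dots> \<le> norm (abs_L2 ?i) * norm (abs_L2 (\<lambda>x. norm (f x)))"
    by (rule norm_cauchy_schwarz)
  finally show "(LINT x|lborel. norm (f x)) \<le> sqrt (2 * \<bar>R\<bar>) * norm (abs_L2 f)"
    by (simp add: ni nf)
qed

text \<open>A measurable function is an almost everywhere limit of continuous functions
  \<open>g n\<close>. Cutting these off in value and in space keeps them continuous and makes
  dominated convergence applicable.\<close>

lemma bounded_support_approx_continuous:
  fixes f :: "real \<Rightarrow> 'a::euclidean_space"
  assumes [measurable]: "f \<in> borel_measurable borel"
    and B: "\<And>x. norm (f x) \<le> B" and supp: "\<And>x. \<bar>x\<bar> > R \<Longrightarrow> f x = 0" and "0 < e"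
  obtains h where "continuous_on UNIV h" "\<And>x. \<bar>x\<bar> > R + 1 \<Longrightarrow> h x = 0"
    "square_integrable h" "norm (abs_L2 (\<lambda>x. f x - h x)) < e"
proof -
  have "0 \<le> B"
    using B[of 0] norm_ge_zero order_trans by blast
  have "f measurable_on UNIV"
    by (intro lebesgue_measurable_imp_measurable_on measurable_completion) auto
  then obtain N g where N: "negligible N" and g: "\<And>n. continuous_on UNIV (g n)"
    and lim: "\<And>x. x \<notin> N \<Longrightarrow> (\<lambda>n. g n x) \<longlonglongrightarrow> f x"
    unfolding measurable_on_def by auto
  \<comment> \<open>The radial retraction onto the ball of radius \<open>B\<close>. Its denominator
    can vanish only if \<open>B = 0\<close>, which is why \<open>h\<close> treats that case
    separately.\<close>
  define c where "c y = (B / max B (norm y)) *\<^sub>R y" for y :: 'a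
  \<comment> \<open>A piecewise linear cutoff, equal to 1 on \<open>[-R,R]\<close> and to 0 outside
    \<open>[-R-1,R+1]\<close>.\<close>
  define v where "v x = max 0 (min 1 (R + 1 - \<bar>x\<bar>))" for x :: real
  define h where "h n x = (if B = 0 then 0 else v x *\<^sub>R c (g n x))" for n x
  have v: "0 \<le> v x" "v x \<le> 1" "\<bar>x\<bar> \<le> R \<Longrightarrow> v x = 1" "R + 1 < \<bar>x\<bar> \<Longrightarrow> v x = 0" for x
    by (auto simp: v_def)
  have nc: "norm (c y) \<le> B" for y
    using \<open>0 \<le> B\<close> by (auto simp: c_def max_def field_simps)
  have h_cont: "continuous_on UNIV (h n)" for n
  proof (cases "B = 0")
    case False
    then have "max B (norm y) \<noteq> 0" for y :: 'a
      using \<open>0 \<le> B\<close> by auto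
    then show ?thesis
      using False unfolding h_def v_def c_def
      by (auto intro!: continuous_intros g)
  qed (simp add: h_def)
  then have [measurable]: "h n \<in> borel_measurable borel" for n
    by (rule borel_measurable_continuous_onI)
  have h_supp: "h n x = 0" if "\<bar>x\<bar> > R + 1" for n x
    using v(4)[OF that] by (simp add: h_def)
  have hB: "norm (h n x) \<le> B" for n x
    using mult_mono[OF v(2) nc[of "g n x"], of x] \<open>0 \<le> B\<close> v(1)[of x] by (simp add: h_def)
  have h_sq: "square_integrable (h n)" for n
    by (rule square_integrable_bounded_support[where B = B and R = "R + 1"]) (auto simp: hB h_supp)
  have f_sq: "square_integrable f"
    by (rule square_integrable_bounded_support[where B = B and R = R]) (auto simp: B supp)
  have h_lim: "(\<lambda>n. h n x) \<longlonglongrightarrow> f x" if "x \<notin> N" for x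
  proof (cases "B = 0")
    case True
    then show ?thesis using B[of x] by (simp add: h_def)
  next
    case False
    then have "B > 0" using \<open>0 \<le> B\<close> by simp
    have "(\<lambda>n. v x *\<^sub>R c (g n x)) \<longlonglongrightarrow> v x *\<^sub>R c (f x)"
      unfolding c_def using \<open>B > 0\<close> by (intro tendsto_intros lim that) auto
    moreover have "c (f x) = f x"
      using B[of x] \<open>B > 0\<close> by (simp add: c_def max_absorb1)
    moreover have "v x *\<^sub>R f x = f x"
      using v(3)[of x] supp[of x] by (cases "\<bar>x\<bar> \<le> R") auto
    ultimately show ?thesis
      using False by (simp add: h_def)
  qed
  have "AE x in lborel. x \<notin> N"
    using N by (metis AE_completion_iff AE_not_in negligible_iff_null_sets)
  then have ae: "AE x in lborel. (\<lambda>n. h n x) \<longlonglongrightarrow> f x"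
    by eventually_elim (rule h_lim)
  have "(\<lambda>n. abs_L2 (h n)) \<longlonglongrightarrow> abs_L2 f"
  proof (rule abs_L2_tendsto_dominated[OF h_sq f_sq ae])
    show "square_integrable (\<lambda>x. 2 * B * indicator {- (R + 1)..R + 1} x)"
      by (rule square_integrable_bounded_support[where B = "2 * B" and R = "R + 1"])
        (use \<open>0 \<le> B\<close> in \<open>auto simp: indicator_def\<close>)
    show "AE x in lborel. norm (h n x - f x) \<le> 2 * B * indicator {- (R + 1)..R + 1} x" for n
    proof (rule AE_I2)
      fix x
      have "norm (h n x - f x) \<le> B + B"
        by (rule norm_triangle_le_diff) (use hB[of n x] B[of x] in linarith)
      moreover have "norm (h n x - f x) = 0" if "\<bar>x\<bar> > R + 1"
        using h_supp[OF that] supp[of x] that by simp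
      ultimately show "norm (h n x - f x) \<le> 2 * B * indicator {- (R + 1)..R + 1} x"
        by (cases "\<bar>x\<bar> > R + 1") (auto simp: indicator_def)
    qed
  qed
  then have "(\<lambda>n. norm (abs_L2 f - abs_L2 (h n))) \<longlonglongrightarrow> norm (abs_L2 f - abs_L2 f)"
    by (intro tendsto_intros)
  then have "\<forall>\<^sub>F n in sequentially. norm (abs_L2 f - abs_L2 (h n)) < e"
    using \<open>0 < e\<close> by (intro order_tendstoD(2)) auto
  then obtain n where "norm (abs_L2 f - abs_L2 (h n)) < e"
    by (auto simp: eventually_sequentially)
  then show ?thesis
    using that[of "h n"] h_cont h_supp h_sq f_sq by (simp add: abs_L2_diff)
qed

text \<open>Setting large values to zero reduces this to bounded functions; each of the two
  approximations costs \<open>e / 2\<close>.\<close>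

lemma square_integrable_approx_continuous:
  fixes f :: "real \<Rightarrow> 'a::euclidean_space"
  assumes f: "square_integrable f" and supp: "\<And>x. \<bar>x\<bar> > R \<Longrightarrow> f x = 0" and "0 < e"
  obtains h where "continuous_on UNIV h" "\<And>x. \<bar>x\<bar> > R + 1 \<Longrightarrow> h x = 0"
    "square_integrable h" "norm (abs_L2 (\<lambda>x. f x - h x)) < e"
proof -
  note [measurable] = square_integrable_measurable[OF f]
  define g where "g n x = (if norm (f x) \<le> real n then f x else 0)" for n x
  have [measurable]: "g n \<in> borel_measurable borel" for n
    unfolding g_def by measurable
  have g: "square_integrable (g n)" for n
    by (rule square_integrable_bound[OF f]) (auto simp: g_def)
  have "(\<lambda>n. abs_L2 (g n)) \<longlonglongrightarrow> abs_L2 f"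
  proof (rule abs_L2_tendsto_dominated[OF g f])
    show "AE x in lborel. (\<lambda>n. g n x) \<longlonglongrightarrow> f x"
    proof (rule AE_I2)
      fix x
      obtain m where m: "norm (f x) \<le> real m"
        using real_arch_simple by blast
      have "\<forall>\<^sub>F n in sequentially. g n x = f x"
        using eventually_ge_at_top[of m] by eventually_elim (use m in \<open>simp add: g_def\<close>)
      then show "(\<lambda>n. g n x) \<longlonglongrightarrow> f x"
        by (rule tendsto_eventually)
    qed
    show "square_integrable (\<lambda>x. norm (f x))"
      by (rule square_integrable_bound[OF f]) auto
  qed (auto simp: g_def)
  then have "(\<lambda>n. norm (abs_L2 f - abs_L2 (g n))) \<longlonglongrightarrow> norm (abs_L2 f - abs_L2 f)"
    by (intro tendsto_intros)
  then have "\<forall>\<^sub>F n in sequentially. norm (abs_L2 f - abs_L2 (g n)) < e / 2"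
    using \<open>0 < e\<close> by (intro order_tendstoD(2)) auto
  then obtain n where n: "norm (abs_L2 f - abs_L2 (g n)) < e / 2"
    by (auto simp: eventually_sequentially)
  have gB: "norm (g n x) \<le> real n" and gs: "\<bar>x\<bar> > R \<Longrightarrow> g n x = 0" and e2: "0 < e / 2" for n x
    using \<open>0 < e\<close> supp by (auto simp: g_def)
  have "\<exists>h. continuous_on UNIV h \<and> (\<forall>x. \<bar>x\<bar> > R + 1 \<longrightarrow> h x = 0) \<and> square_integrable h \<and>
      norm (abs_L2 (\<lambda>x. g n x - h x)) < e / 2"
    by (rule bounded_support_approx_continuous[OF \<open>g n \<in> _\<close> gB gs e2]) auto
  then obtain h where h: "continuous_on UNIV h" "\<And>x. \<bar>x\<bar> > R + 1 \<Longrightarrow> h x = 0"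
    "square_integrable h" "norm (abs_L2 (\<lambda>x. g n x - h x)) < e / 2"
    by blast
  have "norm (abs_L2 f - abs_L2 h) < e"
    using n h(4) norm_triangle_ineq[of "abs_L2 f - abs_L2 (g n)" "abs_L2 (g n) - abs_L2 h"]
    by (simp add: abs_L2_diff[symmetric] g h(3))
  then show ?thesis
    using that[of h] h f by (simp add: abs_L2_diff)
qed

section \<open>The Fourier integral of integrable functions\<close>

lemma norm_exp_ii_real [simp]: "norm (exp (- (\<i> * complex_of_real a))) = 1"
  by (simp add: norm_exp_eq_Re)

lemma integrable_exp_ii_mult:
  assumes "integrable lborel f"
  shows "integrable lborel (\<lambda>x::real. exp (- (\<i> * complex_of_real (x * \<xi>))) * f x)"
  by (rule Bochner_Integration.integrable_bound[OF assms])
    (use borel_measurable_integrable[OF assms] in \<open>auto simp: norm_mult intro!: borel_measurable_times borel_measurable_continuous_onI continuous_intros\<close>)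

lemma measurable_fourier_integral [measurable]:
  assumes [measurable]: "f \<in> borel_measurable borel"
  shows "fourier_integral f \<in> borel_measurable borel"
proof -
  have "(\<lambda>\<xi>. LINT x|lborel. exp (- (\<i> * complex_of_real (x * \<xi>))) * f x) \<in> borel_measurable borel"
    by (rule lborel.borel_measurable_lebesgue_integral) measurable
  then show ?thesis
    unfolding fourier_integral_def[abs_def] by measurable
qed

lemma norm_fourier_integral_le:
  "norm (fourier_integral f \<xi>) \<le> 1 / sqrt (2 * pi) * (LINT x|lborel. norm (f x))"
proof -
  have "norm (fourier_integral f \<xi>)
      = 1 / sqrt (2 * pi) * norm (LINT x|lborel. exp (- (\<i> * complex_of_real (x * \<xi>))) * f x)"
    by (simp add: fourier_integral_def norm_mult norm_divide)
  also have "\<dots> \<le> 1 / sqrt (2 * pi) * (LINT x|lborel. norm (exp (- (\<i> * complex_of_real (x * \<xi>))) * f x))"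
    by (intro mult_left_mono integral_norm_bound) auto
  finally show ?thesis
    by (simp add: norm_mult)
qed

lemma fourier_integral_add:
  "integrable lborel f \<Longrightarrow> integrable lborel g \<Longrightarrow>
    fourier_integral (\<lambda>x. f x + g x) \<xi> = fourier_integral f \<xi> + fourier_integral g \<xi>"
  by (simp add: fourier_integral_def distrib_left integrable_exp_ii_mult add_divide_distrib del: of_real_mult)

lemma fourier_integral_diff:
  "integrable lborel f \<Longrightarrow> integrable lborel g \<Longrightarrow>
    fourier_integral (\<lambda>x. f x - g x) \<xi> = fourier_integral f \<xi> - fourier_integral g \<xi>"
  by (simp add: fourier_integral_def right_diff_distrib integrable_exp_ii_mult diff_divide_distrib del: of_real_mult)

lemma fourier_integral_cmult:
  "fourier_integral (\<lambda>x. c * f x) \<xi> = c * fourier_integral f \<xi>"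
  by (simp add: fourier_integral_def mult.left_commute[of _ c])

lemma fourier_integral_cong_AE:
  assumes [measurable]: "f \<in> borel_measurable borel" "g \<in> borel_measurable borel"
    and "AE x in lborel. f x = g x"
  shows "fourier_integral f = fourier_integral g"
proof
  fix \<xi>
  have "(LINT x|lborel. exp (- (\<i> * complex_of_real (x * \<xi>))) * f x)
      = (LINT x|lborel. exp (- (\<i> * complex_of_real (x * \<xi>))) * g x)"
    by (rule integral_cong_AE) (use assms(3) in \<open>auto elim: eventually_mono\<close>)
  then show "fourier_integral f \<xi> = fourier_integral g \<xi>"
    by (simp add: fourier_integral_def)
qed

lemma fourier_integral_cnj:
  "fourier_integral (\<lambda>x. cnj (f x)) \<xi> = cnj (fourier_integral f (- \<xi>))"
proof -
  have "cnj (LINT x|lborel. exp (- (\<i> * complex_of_real (x * (- \<xi>)))) * f x)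
      = (LINT x|lborel. cnj (exp (- (\<i> * complex_of_real (x * (- \<xi>)))) * f x))"
    by (rule Bochner_Integration.integral_cnj[symmetric])
  then show ?thesis
    by (simp add: fourier_integral_def exp_cnj)
qed

lemma fourier_integral_modulate:
  "fourier_integral (\<lambda>x. exp (\<i> * complex_of_real (x * a)) * f x) \<xi> = fourier_integral f (\<xi> - a)"
proof -
  have "exp (- (\<i> * complex_of_real (x * \<xi>))) * (exp (\<i> * complex_of_real (x * a)) * f x)
      = exp (- (\<i> * complex_of_real (x * (\<xi> - a)))) * f x" for x
    by (simp only: mult.assoc[symmetric] exp_add[symmetric]) (simp add: algebra_simps)
  then show ?thesis
    by (simp only: fourier_integral_def)
qed

text \<open>Fubini, as the kernel is symmetric in the two variables. This one identity is behind
  both the Plancherel theorem and the adjoint of the transform.\<close>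

lemma fourier_integral_multiplication:
  assumes f: "integrable lborel f" and k: "integrable lborel k"
  shows "(LINT \<xi>|lborel. fourier_integral f \<xi> * k \<xi>) = (LINT x|lborel. f x * fourier_integral k x)"
proof -
  note [measurable] = borel_measurable_integrable[OF f] borel_measurable_integrable[OF k]
  let ?e = "\<lambda>x \<xi>. exp (- (\<i> * complex_of_real (x * \<xi>)))"
  have int: "integrable (lborel \<Otimes>\<^sub>M lborel) (\<lambda>(x, \<xi>). ?e x \<xi> * f x * k \<xi>)"
  proof (rule lborel_pair.Fubini_integrable)
    show "(\<lambda>(x, \<xi>). ?e x \<xi> * f x * k \<xi>) \<in> borel_measurable (lborel \<Otimes>\<^sub>M lborel)"
      by measurable
    show "integrable lborel (\<lambda>x. LINT \<xi>|lborel. norm (case (x, \<xi>) of (x, \<xi>) \<Rightarrow> ?e x \<xi> * f x * k \<xi>))"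
      using f k by (simp add: norm_mult)
    show "AE x in lborel. integrable lborel (\<lambda>\<xi>. case (x, \<xi>) of (x, \<xi>) \<Rightarrow> ?e x \<xi> * f x * k \<xi>)"
    proof (rule AE_I2)
      fix x
      have "integrable lborel (\<lambda>\<xi>. f x * (?e \<xi> x * k \<xi>))"
        by (intro integrable_mult_right integrable_exp_ii_mult k)
      then show "integrable lborel (\<lambda>\<xi>. case (x, \<xi>) of (x, \<xi>) \<Rightarrow> ?e x \<xi> * f x * k \<xi>)"
        by (simp add: mult_ac)
    qed
  qed
  have "(LINT \<xi>|lborel. fourier_integral f \<xi> * k \<xi>)
      = complex_of_real (1 / sqrt (2 * pi)) * (LINT \<xi>|lborel. LINT x|lborel. ?e x \<xi> * f x * k \<xi>)"
  proof -
    have "fourier_integral f \<xi> * k \<xi> = complex_of_real (1 / sqrt (2 * pi)) * (LINT x|lborel. ?e x \<xi> * f x * k \<xi>)" for \<xi>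
    proof -
      have "(LINT x|lborel. ?e x \<xi> * f x) * k \<xi> = (LINT x|lborel. ?e x \<xi> * f x * k \<xi>)"
        by (rule integral_mult_left_zero[symmetric])
      then show ?thesis
        by (simp only: fourier_integral_def mult.assoc)
    qed
    then show ?thesis
      by (simp only: integral_mult_right_zero)
  qed
  also have "(LINT \<xi>|lborel. LINT x|lborel. ?e x \<xi> * f x * k \<xi>)
      = (LINT x|lborel. LINT \<xi>|lborel. ?e x \<xi> * f x * k \<xi>)"
    by (rule lborel_pair.Fubini_integral[OF int])
  also have "\<dots> = (LINT x|lborel. f x * (LINT \<xi>|lborel. ?e \<xi> x * k \<xi>))"
  proof (rule Bochner_Integration.integral_cong[OF refl])
    fix x
    have "(LINT \<xi>|lborel. ?e x \<xi> * f x * k \<xi>) = (LINT \<xi>|lborel. f x * (?e \<xi> x * k \<xi>))"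
      by (simp add: mult_ac)
    then show "(LINT \<xi>|lborel. ?e x \<xi> * f x * k \<xi>) = f x * (LINT \<xi>|lborel. ?e \<xi> x * k \<xi>)"
      by (simp only: integral_mult_right_zero)
  qed
  finally show ?thesis
    by (simp only: fourier_integral_def mult.left_commute[of _ "complex_of_real (1 / sqrt (2 * pi))"]
        integral_mult_right_zero)
qed

section \<open>Plancherel theorem\<close>

lemma measurable_cnj [measurable]: "cnj \<in> borel_measurable borel"
  by (intro borel_measurable_continuous_onI continuous_intros)

text \<open>Read off from the characteristic function of the standard normal distribution.\<close>

lemma gauss_fourier:
  "(LINT z|lborel. exp (\<i> * complex_of_real (t * z)) * complex_of_real (std_normal_density z))
     = complex_of_real (exp (- t\<^sup>2 / 2))"
proof -
  have "char std_normal_distribution t = (CLINT z|lborel. std_normal_density z *\<^sub>R exp (\<i> * complex_of_real (t * z)))"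
    unfolding char_def by (rule integral_density) auto
  then show ?thesis
    by (simp add: char_std_normal_distribution scaleR_conv_of_real mult.commute)
qed

lemma fourier_integral_gauss:
  assumes "e > 0"
  shows "fourier_integral (\<lambda>\<xi>. complex_of_real (exp (- (e * \<xi>)\<^sup>2 / 2))) z
    = complex_of_real (1 / e * exp (- (z / e)\<^sup>2 / 2))"
proof -
  let ?F = "\<lambda>\<xi>. exp (- (\<i> * complex_of_real (\<xi> * z))) * complex_of_real (exp (- (e * \<xi>)\<^sup>2 / 2))"
  have "(LINT \<xi>|lborel. ?F \<xi>) = (1 / e) *\<^sub>R (LINT y|lborel. ?F (0 + (1 / e) * y))"
    using lborel_integral_real_affine[of "1 / e" ?F 0] assms by simp
  also have "(LINT y|lborel. ?F (0 + (1 / e) * y))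
      = (LINT y|lborel. complex_of_real (sqrt (2 * pi)) *
          (exp (\<i> * complex_of_real ((- z / e) * y)) * complex_of_real (std_normal_density y)))"
    using assms by (intro Bochner_Integration.integral_cong refl)
      (simp add: std_normal_density_def field_simps)
  also have "\<dots> = complex_of_real (sqrt (2 * pi)) * complex_of_real (exp (- (- z / e)\<^sup>2 / 2))"
    by (simp only: integral_mult_right_zero gauss_fourier)
  finally show ?thesis
    using assms by (simp add: fourier_integral_def scaleR_conv_of_real)
qed

text \<open>Moving one of the two transforms to the other side turns the Gaussian weight into an
  approximate identity.\<close>

lemma fourier_integral_gauss_regularised:
  assumes f: "integrable lborel f" and e: "e > 0"
  shows "(LINT \<xi>|lborel. complex_of_real ((norm (fourier_integral f \<xi>))\<^sup>2 * exp (- (e * \<xi>)\<^sup>2 / 2)))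
    = (LINT x|lborel. f x * cnj (LINT z|lborel. f (x + e * z) * complex_of_real (std_normal_density z)))"
proof -
  note [measurable] = borel_measurable_integrable[OF f]
  let ?F = "fourier_integral f"
  let ?\<gamma> = "\<lambda>\<xi>. complex_of_real (exp (- (e * \<xi>)\<^sup>2 / 2))"
  let ?k = "\<lambda>\<xi>. cnj (?F \<xi>) * ?\<gamma> \<xi>"
  have "integrable lborel (\<lambda>\<xi>. complex_of_real (sqrt (2 * pi) * std_normal_density (0 + e * \<xi>)))"
    using e by (intro integrable_of_real integrable_mult_right lborel_integrable_real_affine
        integrable_normal_density) auto
  then have \<gamma>: "integrable lborel ?\<gamma>"
    by (simp add: std_normal_density_def)
  define C where "C = 1 / sqrt (2 * pi) * (LINT x|lborel. norm (f x))"
  have C: "norm (?F \<xi>) \<le> C" for \<xi>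
    unfolding C_def by (rule norm_fourier_integral_le)
  have "0 \<le> C" using C[of 0] norm_ge_zero order_trans by blast
  have k: "integrable lborel ?k"
  proof (rule Bochner_Integration.integrable_bound)
    show "integrable lborel (\<lambda>\<xi>. complex_of_real C * ?\<gamma> \<xi>)"
      by (intro integrable_mult_right \<gamma>)
    show "AE \<xi> in lborel. norm (?k \<xi>) \<le> norm (complex_of_real C * ?\<gamma> \<xi>)"
      using C \<open>0 \<le> C\<close> by (intro AE_I2) (simp add: norm_mult mult_right_mono)
  qed measurable
  have "(LINT \<xi>|lborel. complex_of_real ((norm (?F \<xi>))\<^sup>2 * exp (- (e * \<xi>)\<^sup>2 / 2)))
      = (LINT \<xi>|lborel. ?F \<xi> * ?k \<xi>)"
    by (intro Bochner_Integration.integral_cong refl)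
      (simp only: of_real_mult complex_norm_square mult.assoc)
  also have "\<dots> = (LINT x|lborel. f x * fourier_integral ?k x)"
    by (rule fourier_integral_multiplication[OF f k])
  also have "\<dots> = (LINT x|lborel. f x * cnj (LINT z|lborel. f (x + e * z) * complex_of_real (std_normal_density z)))"
  proof (rule Bochner_Integration.integral_cong[OF refl])
    fix x
    let ?m = "\<lambda>\<xi>. exp (\<i> * complex_of_real (\<xi> * x)) * ?\<gamma> \<xi>"
    have m: "integrable lborel ?m"
      by (rule Bochner_Integration.integrable_bound[OF \<gamma>]) (auto simp: norm_mult)
    have "fourier_integral ?k x = fourier_integral (\<lambda>\<xi>. cnj (?F \<xi> * ?\<gamma> \<xi>)) x"
      by simp
    also have "\<dots> = cnj (fourier_integral (\<lambda>\<xi>. ?F \<xi> * ?\<gamma> \<xi>) (- x))"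
      by (rule fourier_integral_cnj)
    also have "fourier_integral (\<lambda>\<xi>. ?F \<xi> * ?\<gamma> \<xi>) (- x)
        = complex_of_real (1 / sqrt (2 * pi)) * (LINT \<xi>|lborel. ?F \<xi> * ?m \<xi>)"
      unfolding fourier_integral_def[of "\<lambda>\<xi>. ?F \<xi> * ?\<gamma> \<xi>"] by (simp add: mult_ac)
    \<comment> \<open>The multiplication formula is applied a second time: it moves the transform
      from \<open>f\<close> to the modulated Gaussian. The transform of the latter is a Gaussian of
      width \<open>e\<close> centred at \<open>x\<close>, and the substitution
      \<open>y = x + e z\<close> makes the width disappear.\<close>
    also have "(LINT \<xi>|lborel. ?F \<xi> * ?m \<xi>) = (LINT y|lborel. f y * fourier_integral ?m y)"
      by (rule fourier_integral_multiplication[OF f m])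
    also have "\<dots> = (LINT y|lborel. f y * complex_of_real (1 / e * exp (- ((y - x) / e)\<^sup>2 / 2)))"
      by (simp only: fourier_integral_modulate fourier_integral_gauss[OF e])
    also have "\<dots> = e *\<^sub>R (LINT z|lborel. f (x + e * z) * complex_of_real (1 / e * exp (- z\<^sup>2 / 2)))"
      using e by (subst lborel_integral_real_affine[of e _ x]) auto
    also have "\<dots> = (LINT z|lborel. f (x + e * z) * complex_of_real (exp (- z\<^sup>2 / 2)))"
    proof -
      have "f (x + e * z) * complex_of_real (1 / e * exp (- z\<^sup>2 / 2))
        = complex_of_real (1 / e) * (f (x + e * z) * complex_of_real (exp (- z\<^sup>2 / 2)))" for z
        by simp
      then show ?thesis
        using e by (simp only: integral_mult_right_zero) (simp add: scaleR_conv_of_real)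
    qed
    also have "complex_of_real (1 / sqrt (2 * pi)) * \<dots>
      = (LINT z|lborel. f (x + e * z) * complex_of_real (std_normal_density z))"
      by (simp only: integral_mult_right_zero[symmetric]) (simp add: std_normal_density_def mult_ac)
    finally show "f x * fourier_integral ?k x
      = f x * cnj (LINT z|lborel. f (x + e * z) * complex_of_real (std_normal_density z))"
      by (rule arg_cong)
  qed
  finally show ?thesis .
qed

text \<open>As the width tends to 0, continuity of \<open>f\<close> turns the Gaussian averages into
  \<open>f x\<close>, so the regularised integrals tend to the squared norm of \<open>f\<close>.
  They are also the squared norms of damped transforms, from which the transform itself is recovered
  by Fatou's lemma and dominated convergence.\<close>

lemma plancherel_continuous:
  assumes cont: "continuous_on UNIV f" and supp: "\<And>x. \<bar>x\<bar> > R \<Longrightarrow> f x = 0"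
  shows "square_integrable (fourier_integral f)"
    and "norm (abs_L2 (fourier_integral f)) = norm (abs_L2 f)"
proof -
  have [measurable]: "f \<in> borel_measurable borel"
    by (rule borel_measurable_continuous_onI[OF cont])
  have "compact (f ` {- R..R})"
    by (intro compact_continuous_image continuous_on_subset[OF cont]) auto
  then obtain B where B: "\<And>y. y \<in> f ` {- R..R} \<Longrightarrow> norm y \<le> B"
    using compact_imp_bounded bounded_iff by metis
  have fB: "norm (f x) \<le> max B 0" for x
  proof (cases "\<bar>x\<bar> > R")
    case False
    then have "f x \<in> f ` {- R..R}"
      by (intro imageI) auto
    then show ?thesis
      using B by (simp add: le_max_iff_disj)
  qed (simp add: supp)
  define M where "M = max B 0"
  have M: "norm (f x) \<le> M" "0 \<le> M" for x
    using fB by (auto simp: M_def)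
  have f_sq: "square_integrable f"
    by (rule square_integrable_bounded_support[OF _ M(1) supp]) measurable
  have f_int: "integrable lborel f"
    by (rule integrable_square_integrable_support[OF f_sq supp])
  let ?F = "fourier_integral f"
  define e where "e n = 1 / real (Suc n)" for n
  have e: "e n > 0" for n
    by (simp add: e_def)
  have e_lim: "e \<longlonglongrightarrow> 0"
    unfolding e_def[abs_def] by (rule LIMSEQ_Suc[OF lim_1_over_n])
  define A where "A n = (LINT \<xi>|lborel. (norm (?F \<xi>))\<^sup>2 * exp (- (e n * \<xi>)\<^sup>2 / 2))" for n
  have inner_lim: "(\<lambda>n. LINT z|lborel. f (x + e n * z) * complex_of_real (std_normal_density z)) \<longlonglongrightarrow> f x" for x
  proof -
    have "(\<lambda>n. LINT z|lborel. f (x + e n * z) * complex_of_real (std_normal_density z))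
        \<longlonglongrightarrow> (LINT z|lborel. f x * complex_of_real (std_normal_density z))"
    proof (rule integral_dominated_convergence)
      show "integrable lborel (\<lambda>z. M * std_normal_density z)"
        by (intro integrable_mult_right integrable_normal_density) auto
      show "AE z in lborel. (\<lambda>n. f (x + e n * z) * complex_of_real (std_normal_density z))
          \<longlonglongrightarrow> f x * complex_of_real (std_normal_density z)"
      proof (rule AE_I2)
        fix z
        have "(\<lambda>n. x + e n * z) \<longlonglongrightarrow> x + 0 * z"
          by (intro tendsto_intros e_lim)
        then have "(\<lambda>n. f (x + e n * z)) \<longlonglongrightarrow> f x"
          using cont by (intro continuous_on_tendsto_compose[of UNIV f]) auto
        then show "(\<lambda>n. f (x + e n * z) * complex_of_real (std_normal_density z))
            \<longlonglongrightarrow> f x * complex_of_real (std_normal_density z)"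
          by (intro tendsto_intros)
      qed
      show "AE z in lborel. norm (f (x + e n * z) * complex_of_real (std_normal_density z))
          \<le> M * std_normal_density z" for n
        using M by (intro AE_I2) (simp add: norm_mult mult_right_mono)
    qed measurable
    moreover have "(LINT z|lborel. f x * complex_of_real (std_normal_density z)) = f x"
      by (simp add: integral_complex_of_real)
    ultimately show ?thesis by simp
  qed
  have "(\<lambda>n. complex_of_real (A n)) \<longlonglongrightarrow> (LINT x|lborel. f x * cnj (f x))"
  proof -
    have "(\<lambda>n. LINT x|lborel. f x * cnj (LINT z|lborel. f (x + e n * z) * complex_of_real (std_normal_density z)))
        \<longlonglongrightarrow> (LINT x|lborel. f x * cnj (f x))"
    proof (rule integral_dominated_convergence)
      show "integrable lborel (\<lambda>x. norm (f x) * M)"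
        using f_int by auto
      show "AE x in lborel. (\<lambda>n. f x * cnj (LINT z|lborel. f (x + e n * z) * complex_of_real (std_normal_density z)))
          \<longlonglongrightarrow> f x * cnj (f x)"
        by (intro AE_I2 tendsto_intros inner_lim)
      show "AE x in lborel. norm (f x * cnj (LINT z|lborel. f (x + e n * z) * complex_of_real (std_normal_density z)))
          \<le> norm (f x) * M" for n
      proof (rule AE_I2)
        fix x
        have "norm (LINT z|lborel. f (x + e n * z) * complex_of_real (std_normal_density z))
            \<le> (LINT z|lborel. M * std_normal_density z)"
        proof (rule order_trans[OF integral_norm_bound integral_mono'])
          show "integrable lborel (\<lambda>z. M * std_normal_density z)"
            by (intro integrable_mult_right integrable_normal_density) auto
        qed (use M in \<open>auto simp: norm_mult mult_right_mono\<close>)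
        then have "norm (LINT z|lborel. f (x + e n * z) * complex_of_real (std_normal_density z)) \<le> M"
          by simp
        then show "norm (f x * cnj (LINT z|lborel. f (x + e n * z) * complex_of_real (std_normal_density z)))
          \<le> norm (f x) * M"
          by (simp add: norm_mult mult_left_mono)
      qed
    qed measurable
    moreover have "complex_of_real (A n)
        = (LINT x|lborel. f x * cnj (LINT z|lborel. f (x + e n * z) * complex_of_real (std_normal_density z)))" for n
      unfolding A_def using fourier_integral_gauss_regularised[OF f_int e[of n]]
      by (simp only: integral_complex_of_real)
    ultimately show ?thesis by simp
  qed
  moreover have "(LINT x|lborel. f x * cnj (f x)) = complex_of_real ((norm (abs_L2 f))\<^sup>2)"
    by (simp only: norm_abs_L2[OF f_sq] integral_complex_of_real[symmetric] complex_norm_square)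
  ultimately have A_lim: "A \<longlonglongrightarrow> (norm (abs_L2 f))\<^sup>2"
    by (simp only: tendsto_of_real_iff)
  define C where "C = 1 / sqrt (2 * pi) * (LINT x|lborel. norm (f x))"
  have C: "norm (?F \<xi>) \<le> C" for \<xi>
    unfolding C_def by (rule norm_fourier_integral_le)
  have "0 \<le> C" using C[of 0] norm_ge_zero order_trans by blast
  \<comment> \<open>Half of the Gaussian exponent, so that squaring gives the weight in
    \<open>A\<close>.\<close>
  define h where "h n \<xi> = exp (- (e n * \<xi>)\<^sup>2 / 4) *\<^sub>R ?F \<xi>" for n \<xi>
  have nh: "(norm (h n \<xi>))\<^sup>2 = (norm (?F \<xi>))\<^sup>2 * exp (- (e n * \<xi>)\<^sup>2 / 2)" for n \<xi>
    by (simp add: h_def power_mult_distrib exp_double[symmetric])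
  have h: "square_integrable (h n)" for n
    unfolding square_integrable_def
  proof
    show [measurable]: "h n \<in> borel_measurable lborel"
      unfolding h_def[abs_def] by measurable
    have i: "integrable lborel (\<lambda>\<xi>. C\<^sup>2 * (sqrt (2 * pi) * std_normal_density (0 + e n * \<xi>)))"
      using e[of n] by (intro integrable_mult_right lborel_integrable_real_affine
          integrable_normal_density) auto
    show "integrable lborel (\<lambda>\<xi>. (norm (h n \<xi>))\<^sup>2)"
    proof (rule Bochner_Integration.integrable_bound[OF i])
      show "AE \<xi> in lborel. norm ((norm (h n \<xi>))\<^sup>2) \<le> norm (C\<^sup>2 * (sqrt (2 * pi) * std_normal_density (0 + e n * \<xi>)))"
        using C \<open>0 \<le> C\<close> by (intro AE_I2) (simp add: nh std_normal_density_def power_mono mult_right_mono)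
    qed measurable
  qed
  have A: "A n = (norm (abs_L2 (h n)))\<^sup>2" for n
    by (simp add: norm_abs_L2[OF h] nh A_def)
  have h_lim: "(\<lambda>n. h n \<xi>) \<longlonglongrightarrow> ?F \<xi>" for \<xi>
  proof -
    have "(\<lambda>n. h n \<xi>) \<longlonglongrightarrow> exp (- (0 * \<xi>)\<^sup>2 / 4) *\<^sub>R ?F \<xi>"
      unfolding h_def by (intro tendsto_intros e_lim) simp
    then show ?thesis by simp
  qed
  have "(\<lambda>n. sqrt (A n)) \<longlonglongrightarrow> sqrt ((norm (abs_L2 f))\<^sup>2)"
    by (intro tendsto_intros A_lim)
  then have h_norm: "(\<lambda>n. norm (abs_L2 (h n))) \<longlonglongrightarrow> norm (abs_L2 f)"
    by (simp add: A)
  have "\<forall>\<^sub>F n in sequentially. norm (abs_L2 (h n)) < norm (abs_L2 f) + 1"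
    by (rule order_tendstoD(2)[OF h_norm]) simp
  then have "\<forall>\<^sub>F n in sequentially. norm (abs_L2 (h n)) \<le> norm (abs_L2 f) + 1"
    by eventually_elim simp
  \<comment> \<open>Membership has to come first, from Fatou's lemma: the dominated convergence
    below uses the norm of the transform itself as majorant.\<close>
  then show F: "square_integrable ?F"
    using L2_fatou[of h ?F "norm (abs_L2 f) + 1"] h h_lim by auto
  have "(\<lambda>n. abs_L2 (h n)) \<longlonglongrightarrow> abs_L2 ?F"
  proof (rule abs_L2_tendsto_dominated[OF h F])
    show "square_integrable (\<lambda>\<xi>. norm (?F \<xi>))"
      by (rule square_integrable_bound[OF F]) auto
    show "AE \<xi> in lborel. norm (h n \<xi> - ?F \<xi>) \<le> norm (?F \<xi>)" for n
    proof (rule AE_I2)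
      fix \<xi>
      have "h n \<xi> - ?F \<xi> = (exp (- (e n * \<xi>)\<^sup>2 / 4) - 1) *\<^sub>R ?F \<xi>"
        by (simp add: h_def scaleR_diff_left)
      moreover have "\<bar>exp (- (e n * \<xi>)\<^sup>2 / 4) - 1\<bar> \<le> 1"
      proof -
        have "0 < exp (- (e n * \<xi>)\<^sup>2 / 4)" "exp (- (e n * \<xi>)\<^sup>2 / 4) \<le> 1"
          by (simp_all)
        then show ?thesis by linarith
      qed
      ultimately show "norm (h n \<xi> - ?F \<xi>) \<le> norm (?F \<xi>)"
        by (simp add: mult_left_le_one_le)
    qed
  qed (use h_lim in auto)
  then have "(\<lambda>n. norm (abs_L2 (h n))) \<longlonglongrightarrow> norm (abs_L2 ?F)"
    by (rule tendsto_norm)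
  with h_norm show "norm (abs_L2 ?F) = norm (abs_L2 f)"
    by (metis LIMSEQ_unique)
qed

text \<open>Density argument. The approximants share one bounded support, so their transforms
  converge pointwise; the isometry on their differences, which are continuous again, turns this into
  convergence in L2.\<close>

lemma plancherel_support:
  assumes f: "square_integrable f" and supp: "\<And>x. \<bar>x\<bar> > R \<Longrightarrow> f x = 0"
  shows "square_integrable (fourier_integral f)"
    and "norm (abs_L2 (fourier_integral f)) = norm (abs_L2 f)"
proof -
  note [measurable] = square_integrable_measurable[OF f]
  have "\<exists>h. continuous_on UNIV h \<and> (\<forall>x. \<bar>x\<bar> > R + 1 \<longrightarrow> h x = 0) \<and> square_integrable h \<and>
      norm (abs_L2 (\<lambda>x. f x - h x)) < 1 / real (Suc n)" for n
    by (rule square_integrable_approx_continuous[OF f supp, where e = "1 / real (Suc n)"]) auto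
  then obtain h where h_cont: "\<And>n. continuous_on UNIV (h n)"
    and h_supp: "\<And>n x. \<bar>x\<bar> > R + 1 \<Longrightarrow> h n x = 0" and h: "\<And>n. square_integrable (h n)"
    and h_close: "\<And>n. norm (abs_L2 (\<lambda>x. f x - h n x)) < 1 / real (Suc n)"
    by metis
  note [measurable] = square_integrable_measurable[OF h]
  let ?F = "fourier_integral f" and ?H = "\<lambda>n. fourier_integral (h n)"
  have f_supp: "\<bar>x\<bar> > R + 1 \<Longrightarrow> f x = 0" for x
    using supp[of x] by linarith
  have f_int: "integrable lborel f" and h_int: "integrable lborel (h n)" for n
    using integrable_square_integrable_support(1)[OF f f_supp]
      integrable_square_integrable_support(1)[OF h h_supp] by auto
  have inv_lim: "(\<lambda>n. 1 / real (Suc n)) \<longlonglongrightarrow> 0"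
    by (rule LIMSEQ_Suc[OF lim_1_over_n])
  have h_lim: "(\<lambda>n. ?H n \<xi>) \<longlonglongrightarrow> ?F \<xi>" for \<xi>
  proof -
    let ?c = "1 / sqrt (2 * pi) * sqrt (2 * \<bar>R + 1\<bar>)"
    have "norm (?H n \<xi> - ?F \<xi>) \<le> ?c * (1 / real (Suc n))" for n
    proof -
      have d: "square_integrable (\<lambda>x. f x - h n x)"
        by (intro square_integrable_diff f h)
      have "norm (?H n \<xi> - ?F \<xi>) = norm (fourier_integral (\<lambda>x. f x - h n x) \<xi>)"
        by (simp add: fourier_integral_diff f_int h_int norm_minus_commute)
      also have "\<dots> \<le> 1 / sqrt (2 * pi) * (LINT x|lborel. norm (f x - h n x))"
        by (rule norm_fourier_integral_le)
      also have "\<dots> \<le> 1 / sqrt (2 * pi) * (sqrt (2 * \<bar>R + 1\<bar>) * norm (abs_L2 (\<lambda>x. f x - h n x)))"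
        by (intro mult_left_mono integrable_square_integrable_support(2) d) (auto simp: f_supp h_supp)
      also have "\<dots> \<le> 1 / sqrt (2 * pi) * (sqrt (2 * \<bar>R + 1\<bar>) * (1 / real (Suc n)))"
        by (intro mult_left_mono less_imp_le[OF h_close]) auto
      finally show ?thesis by simp
    qed
    then have "\<forall>\<^sub>F n in sequentially. norm (?H n \<xi> - ?F \<xi>) \<le> ?c * (1 / real (Suc n))"
      by (intro always_eventually allI)
    then have "(\<lambda>n. ?H n \<xi> - ?F \<xi>) \<longlonglongrightarrow> 0"
      by (rule Lim_null_comparison) (rule tendsto_mult_right_zero[OF inv_lim])
    then show ?thesis
      by (simp add: LIM_zero_iff)
  qed
  have H: "square_integrable (?H n)" for n
    by (rule plancherel_continuous(1)[OF h_cont h_supp])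
  \<comment> \<open>For \<open>m\<close> at least \<open>n\<close> the isometry and the triangle
    inequality bound the distance of \<open>?H n\<close> and \<open>?H m\<close> by twice
    \<open>1 / real (Suc n)\<close>; then \<open>m\<close> tends to infinity.\<close>
  have close: "square_integrable (\<lambda>\<xi>. ?H n \<xi> - ?F \<xi>) \<and>
      norm (abs_L2 (\<lambda>\<xi>. ?H n \<xi> - ?F \<xi>)) \<le> 2 / real (Suc n)" for n
  proof (rule L2_fatou)
    show "square_integrable (\<lambda>\<xi>. ?H n \<xi> - ?H m \<xi>)" for m
      by (intro square_integrable_diff H)
    show "AE \<xi> in lborel. (\<lambda>m. ?H n \<xi> - ?H m \<xi>) \<longlonglongrightarrow> ?H n \<xi> - ?F \<xi>"
      by (intro AE_I2 tendsto_intros h_lim)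
    show "\<forall>\<^sub>F m in sequentially. norm (abs_L2 (\<lambda>\<xi>. ?H n \<xi> - ?H m \<xi>)) \<le> 2 / real (Suc n)"
      using eventually_ge_at_top[of n]
    proof eventually_elim
      case (elim m)
      have "(\<lambda>\<xi>. ?H n \<xi> - ?H m \<xi>) = fourier_integral (\<lambda>x. h n x - h m x)"
        by (simp add: fourier_integral_diff h_int fun_eq_iff)
      then have "norm (abs_L2 (\<lambda>\<xi>. ?H n \<xi> - ?H m \<xi>)) = norm (abs_L2 (\<lambda>x. h n x - h m x))"
        using plancherel_continuous(2)[of "\<lambda>x. h n x - h m x" "R + 1"] h_supp h_cont
        by (auto intro!: continuous_intros)
      also have "\<dots> = norm ((abs_L2 f - abs_L2 (h m)) - (abs_L2 f - abs_L2 (h n)))"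
        by (simp add: abs_L2_diff[symmetric] h)
      also have "\<dots> \<le> norm (abs_L2 f - abs_L2 (h m)) + norm (abs_L2 f - abs_L2 (h n))"
        by (rule norm_triangle_ineq4)
      also have "\<dots> \<le> 1 / real (Suc m) + 1 / real (Suc n)"
        using h_close[of m] h_close[of n] by (simp add: abs_L2_diff f h)
      also have "\<dots> \<le> 1 / real (Suc n) + 1 / real (Suc n)"
        using elim by (intro add_right_mono divide_left_mono) auto
      finally show ?case by simp
    qed
  qed auto
  show F: "square_integrable ?F"
    using square_integrable_diff[OF H[of 0], of "\<lambda>\<xi>. ?H 0 \<xi> - ?F \<xi>"] close[of 0] by simp
  have "(\<lambda>n. norm (abs_L2 (?H n) - abs_L2 ?F)) \<longlonglongrightarrow> 0"
  proof (rule tendsto_sandwich[OF _ _ tendsto_const])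
    show "(\<lambda>n. 2 / real (Suc n)) \<longlonglongrightarrow> 0"
      using tendsto_mult_right_zero[OF inv_lim, of 2] by simp
    show "\<forall>\<^sub>F n in sequentially. norm (abs_L2 (?H n) - abs_L2 ?F) \<le> 2 / real (Suc n)"
      using close by (simp add: abs_L2_diff H F)
  qed simp
  then have "(\<lambda>n. abs_L2 (?H n)) \<longlonglongrightarrow> abs_L2 ?F"
    by (simp add: LIM_zero_iff tendsto_norm_zero_iff)
  then have 1: "(\<lambda>n. norm (abs_L2 (?H n))) \<longlonglongrightarrow> norm (abs_L2 ?F)"
    by (rule tendsto_norm)
  have "(\<lambda>n. norm (abs_L2 f - abs_L2 (h n))) \<longlonglongrightarrow> 0"
  proof (rule tendsto_sandwich[OF _ _ tendsto_const inv_lim])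
    show "\<forall>\<^sub>F n in sequentially. norm (abs_L2 f - abs_L2 (h n)) \<le> 1 / real (Suc n)"
      using h_close by (simp add: abs_L2_diff h f less_imp_le)
  qed simp
  then have "(\<lambda>n. abs_L2 f - (abs_L2 f - abs_L2 (h n))) \<longlonglongrightarrow> abs_L2 f - 0"
    by (intro tendsto_intros) (simp add: tendsto_norm_zero_iff)
  then have 2: "(\<lambda>n. norm (abs_L2 (h n))) \<longlonglongrightarrow> norm (abs_L2 f)"
    by (simp add: tendsto_norm)
  have "norm (abs_L2 (?H n)) = norm (abs_L2 (h n))" for n
    by (rule plancherel_continuous(2)[OF h_cont h_supp])
  with 1 2 show "norm (abs_L2 ?F) = norm (abs_L2 f)"
    by (auto intro: LIMSEQ_unique)
qed

section \<open>Extension of the Fourier transform to L2\<close>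

definition truncate_L2 :: "nat \<Rightarrow> complex L2 \<Rightarrow> real \<Rightarrow> complex" where
  "truncate_L2 n f = (\<lambda>x. indicator {- real n..real n} x *\<^sub>R rep_L2 f x)"

lemma measurable_truncate_L2 [measurable]: "truncate_L2 n f \<in> borel_measurable borel"
  unfolding truncate_L2_def by measurable

lemma square_integrable_truncate_L2: "square_integrable (truncate_L2 n f)"
  by (rule square_integrable_bound[OF rep_L2[of f]]) (auto simp: truncate_L2_def indicator_def)

lemma truncate_L2_support: "\<bar>x\<bar> > real n \<Longrightarrow> truncate_L2 n f x = 0"
  by (auto simp: truncate_L2_def indicator_def)

lemma truncate_L2_tendsto: "(\<lambda>n. abs_L2 (truncate_L2 n f)) \<longlonglongrightarrow> f"
proof -
  have "(\<lambda>n. abs_L2 (truncate_L2 n f)) \<longlonglongrightarrow> abs_L2 (rep_L2 f)"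
  proof (rule abs_L2_tendsto_dominated[OF square_integrable_truncate_L2 rep_L2])
    show "AE x in lborel. (\<lambda>n. truncate_L2 n f x) \<longlonglongrightarrow> rep_L2 f x"
    proof (rule AE_I2)
      fix x :: real
      obtain m where m: "\<bar>x\<bar> \<le> real m"
        using real_arch_simple by blast
      have "\<forall>\<^sub>F n in sequentially. truncate_L2 n f x = rep_L2 f x"
        using eventually_ge_at_top[of m]
        by eventually_elim (use m in \<open>auto simp: truncate_L2_def indicator_def\<close>)
      then show "(\<lambda>n. truncate_L2 n f x) \<longlonglongrightarrow> rep_L2 f x"
        by (rule tendsto_eventually)
    qed
    show "square_integrable (\<lambda>x. norm (rep_L2 f x))"
      by (rule square_integrable_bound[OF rep_L2[of f]]) auto
  qed (auto simp: truncate_L2_def indicator_def)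
  then show ?thesis by simp
qed

lemma integrable_truncate_L2: "integrable lborel (truncate_L2 n f)"
  by (rule integrable_square_integrable_support(1)[OF square_integrable_truncate_L2 truncate_L2_support])

lemma square_integrable_fourier_truncate: "square_integrable (fourier_integral (truncate_L2 n f))"
  by (rule plancherel_support(1)[OF square_integrable_truncate_L2 truncate_L2_support])

text \<open>\<open>lim\<close> is meaningful only for convergent sequences. The truncations converge
  in L2, Plancherel applied to their differences makes the transforms Cauchy, and completeness
  supplies the limit.\<close>

lemma fourier_L2_tendsto: "(\<lambda>n. abs_L2 (fourier_integral (truncate_L2 n f))) \<longlonglongrightarrow> fourier_L2 f"
proof -
  have "norm (abs_L2 (fourier_integral (truncate_L2 m f)) - abs_L2 (fourier_integral (truncate_L2 n f)))
      = norm (abs_L2 (truncate_L2 m f) - abs_L2 (truncate_L2 n f))" for m n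
  proof -
    have "(\<lambda>\<xi>. fourier_integral (truncate_L2 m f) \<xi> - fourier_integral (truncate_L2 n f) \<xi>)
        = fourier_integral (\<lambda>x. truncate_L2 m f x - truncate_L2 n f x)"
      by (simp add: fun_eq_iff fourier_integral_diff integrable_truncate_L2)
    moreover have "norm (abs_L2 (fourier_integral (\<lambda>x. truncate_L2 m f x - truncate_L2 n f x)))
        = norm (abs_L2 (\<lambda>x. truncate_L2 m f x - truncate_L2 n f x))"
      by (rule plancherel_support(2)[where R = "max (real m) (real n)"])
        (auto intro!: square_integrable_diff square_integrable_truncate_L2 simp: truncate_L2_support)
    ultimately show ?thesis
      by (simp add: abs_L2_diff square_integrable_fourier_truncate square_integrable_truncate_L2)
  qed
  moreover have "Cauchy (\<lambda>n. abs_L2 (truncate_L2 n f))"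
    by (rule LIMSEQ_imp_Cauchy[OF truncate_L2_tendsto])
  ultimately have "Cauchy (\<lambda>n. abs_L2 (fourier_integral (truncate_L2 n f)))"
    by (simp add: Cauchy_iff)
  then show ?thesis
    unfolding fourier_L2_def truncate_L2_def[symmetric]
    by (simp add: Cauchy_convergent_iff convergent_LIMSEQ_iff)
qed

lemma norm_fourier_L2 [simp]: "norm (fourier_L2 f) = norm f"
proof -
  have "norm (abs_L2 (fourier_integral (truncate_L2 n f))) = norm (abs_L2 (truncate_L2 n f))" for n
    by (rule plancherel_support(2)[OF square_integrable_truncate_L2 truncate_L2_support])
  then show ?thesis
    using tendsto_norm[OF fourier_L2_tendsto[of f]] tendsto_norm[OF truncate_L2_tendsto[of f]]
    by (auto intro: LIMSEQ_unique)
qed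

lemma fourier_L2_add: "fourier_L2 (f + g) = fourier_L2 f + fourier_L2 g"
proof -
  have "abs_L2 (fourier_integral (truncate_L2 n (f + g)))
      = abs_L2 (fourier_integral (truncate_L2 n f)) + abs_L2 (fourier_integral (truncate_L2 n g))" for n
  proof -
    have "fourier_integral (truncate_L2 n (f + g))
        = fourier_integral (\<lambda>x. truncate_L2 n f x + truncate_L2 n g x)"
      using rep_L2_add[of f g]
      by (intro fourier_integral_cong_AE) (auto simp: truncate_L2_def scaleR_add_right elim: eventually_mono)
    also have "\<dots> = (\<lambda>\<xi>. fourier_integral (truncate_L2 n f) \<xi> + fourier_integral (truncate_L2 n g) \<xi>)"
      by (simp add: fun_eq_iff fourier_integral_add integrable_truncate_L2)
    finally show ?thesis
      by (simp add: abs_L2_add square_integrable_fourier_truncate)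
  qed
  then have "(\<lambda>n. abs_L2 (fourier_integral (truncate_L2 n (f + g)))) \<longlonglongrightarrow> fourier_L2 f + fourier_L2 g"
    by (simp add: tendsto_add fourier_L2_tendsto)
  then show ?thesis
    using fourier_L2_tendsto LIMSEQ_unique by blast
qed

lemma square_integrable_cmult:
  fixes c :: complex
  assumes f: "square_integrable f"
  shows "square_integrable (\<lambda>x. c * f x)"
  using f by (auto simp: square_integrable_def norm_mult power_mult_distrib)

lemma scaleC_abs_L2: "square_integrable f \<Longrightarrow> scaleC_L2 c (abs_L2 f) = abs_L2 (\<lambda>x. c * f x)"
  by (rule scaleC_L2.abs_eq) (auto simp: L2_rel_def)

lemma rep_scaleC_L2: "AE x in lborel. rep_L2 (scaleC_L2 c f) x = c * rep_L2 f x"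
  using rep_abs_L2[OF square_integrable_cmult[OF rep_L2[of f]], of c]
  by (simp add: scaleC_abs_L2[OF rep_L2, symmetric])

lemma norm_scaleC_L2 [simp]: "norm (scaleC_L2 c f) = norm c * norm f"
proof -
  have "(norm (scaleC_L2 c f))\<^sup>2 = (norm c * norm f)\<^sup>2"
    using scaleC_abs_L2[OF rep_L2, of c f] norm_abs_L2[OF square_integrable_cmult[OF rep_L2[of f]], of c]
    by (simp add: norm_mult power_mult_distrib norm_rep_L2)
  then show ?thesis
    by (simp add: power2_eq_iff_nonneg)
qed

lemma bounded_linear_scaleC_L2: "bounded_linear (scaleC_L2 c)"
proof (rule bounded_linear_intro)
  show "scaleC_L2 c (f + g) = scaleC_L2 c f + scaleC_L2 c g" for f g
    by transfer (auto simp: L2_rel_def distrib_left intro: square_integrable_add square_integrable_cmult)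
  show "scaleC_L2 c (r *\<^sub>R f) = r *\<^sub>R scaleC_L2 c f" for r f
    by transfer (auto simp: L2_rel_def intro: square_integrable_scaleR square_integrable_cmult)
  show "norm (scaleC_L2 c f) \<le> norm f * norm c" for f
    by simp
qed

lemma scaleC_scaleC_L2 [simp]: "scaleC_L2 a (scaleC_L2 b f) = scaleC_L2 (a * b) f"
  by transfer (auto simp: L2_rel_def mult.assoc intro: square_integrable_cmult)

lemma scaleC_L2_of_real: "scaleC_L2 (complex_of_real r) f = r *\<^sub>R f"
  by transfer (auto simp: L2_rel_def scaleR_conv_of_real intro: square_integrable_cmult)

lemma scaleC_L2_one [simp]: "scaleC_L2 1 f = f"
  using scaleC_L2_of_real[of 1 f] by simp

lemma scaleC_L2_minus: "scaleC_L2 c (- f) = scaleC_L2 (- c) f"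
proof -
  have "- f = scaleC_L2 (- 1) f"
    using scaleC_L2_of_real[of "- 1" f] by simp
  then show ?thesis
    by (simp only: scaleC_scaleC_L2) simp
qed

lemma fourier_L2_scaleC: "fourier_L2 (scaleC_L2 c f) = scaleC_L2 c (fourier_L2 f)"
proof -
  have "abs_L2 (fourier_integral (truncate_L2 n (scaleC_L2 c f)))
      = scaleC_L2 c (abs_L2 (fourier_integral (truncate_L2 n f)))" for n
  proof -
    have "fourier_integral (truncate_L2 n (scaleC_L2 c f)) = fourier_integral (\<lambda>x. c * truncate_L2 n f x)"
      using rep_scaleC_L2[of c f]
      by (intro fourier_integral_cong_AE) (auto simp: truncate_L2_def elim: eventually_mono)
    then show ?thesis
      by (simp add: fourier_integral_cmult[abs_def] scaleC_abs_L2 square_integrable_fourier_truncate)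
  qed
  moreover have "(\<lambda>n. scaleC_L2 c (abs_L2 (fourier_integral (truncate_L2 n f)))) \<longlonglongrightarrow> scaleC_L2 c (fourier_L2 f)"
    by (intro bounded_linear.tendsto[OF bounded_linear_scaleC_L2] fourier_L2_tendsto)
  ultimately have "(\<lambda>n. abs_L2 (fourier_integral (truncate_L2 n (scaleC_L2 c f)))) \<longlonglongrightarrow> scaleC_L2 c (fourier_L2 f)"
    by simp
  then show ?thesis
    using fourier_L2_tendsto LIMSEQ_unique by blast
qed

lemma bounded_linear_fourier_L2: "bounded_linear fourier_L2"
proof (rule bounded_linear_intro)
  show "fourier_L2 (r *\<^sub>R f) = r *\<^sub>R fourier_L2 f" for r f
    using fourier_L2_scaleC[of "complex_of_real r" f] by (simp add: scaleC_L2_of_real)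
  show "norm (fourier_L2 f) \<le> norm f * 1" for f by simp
qed (rule fourier_L2_add)

text \<open>The sequence defining \<open>fourier_L2\<close> is eventually constant, as truncation at
  a radius beyond \<open>R\<close> changes \<open>f\<close> only on a null set.\<close>

lemma fourier_L2_abs:
  assumes f: "square_integrable f" and supp: "\<And>x. \<bar>x\<bar> > R \<Longrightarrow> f x = 0"
  shows "fourier_L2 (abs_L2 f) = abs_L2 (fourier_integral f)"
proof -
  note [measurable] = square_integrable_measurable[OF f]
  obtain m where m: "R \<le> real m"
    using real_arch_simple by blast
  have "\<forall>\<^sub>F n in sequentially. abs_L2 (fourier_integral (truncate_L2 n (abs_L2 f))) = abs_L2 (fourier_integral f)"
    using eventually_ge_at_top[of m]
  proof eventually_elim
    case (elim n)
    have "f x = 0" if "x \<notin> {- real n..real n}" for x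
      using that elim m supp[of x] by auto
    then have "truncate_L2 n (abs_L2 f) x = f x" if "rep_L2 (abs_L2 f) x = f x" for x
      using that by (auto simp: truncate_L2_def indicator_def)
    then have "fourier_integral (truncate_L2 n (abs_L2 f)) = fourier_integral f"
      using rep_abs_L2[OF f] by (intro fourier_integral_cong_AE) (auto elim: eventually_mono)
    then show ?case by simp
  qed
  then have "(\<lambda>n. abs_L2 (fourier_integral (truncate_L2 n (abs_L2 f)))) \<longlonglongrightarrow> abs_L2 (fourier_integral f)"
    by (rule tendsto_eventually)
  then show ?thesis
    using fourier_L2_tendsto LIMSEQ_unique by blast
qed

section \<open>Conjugation and unitarity of the Fourier transform\<close>

lemma square_integrable_cnj:
  assumes f: "square_integrable f"
  shows "square_integrable (\<lambda>x. cnj (f x))"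
proof -
  note [measurable] = square_integrable_measurable[OF f]
  show ?thesis
    by (rule square_integrable_bound[OF f]) auto
qed

lift_definition cnj_L2 :: "complex L2 \<Rightarrow> complex L2" is "\<lambda>f x. cnj (f x)"
  unfolding L2_rel_def by (auto intro: square_integrable_cnj elim: eventually_mono)

lemma AE_lborel_uminus:
  fixes f g :: "real \<Rightarrow> complex"
  assumes "f \<in> borel_measurable borel" "g \<in> borel_measurable borel"
    and "AE x in lborel. f x = g x"
  shows "AE x in lborel. f (- x) = g (- x)"
  using AE_borel_affine[of "- 1" "\<lambda>x. f x = g x" 0] assms by auto

lemma square_integrable_affine:
  assumes f: "square_integrable f" and "c \<noteq> 0"
  shows "square_integrable (\<lambda>x. f (t + c * x))"
  using f lborel_integrable_real_affine[OF _ \<open>c \<noteq> 0\<close>, of "\<lambda>x. (norm (f x))\<^sup>2" t]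
  by (auto simp: square_integrable_def)

lemma square_integrable_cnj_reflect:
  "square_integrable f \<Longrightarrow> square_integrable (\<lambda>x. cnj (f (- x)))"
  using square_integrable_cnj[OF square_integrable_affine[of f "- 1" 0]] by simp

lift_definition cnj_reflect_L2 :: "complex L2 \<Rightarrow> complex L2" is "\<lambda>f x. cnj (f (- x))"
proof -
  fix f g :: "real \<Rightarrow> complex"
  assume fg: "L2_rel f g"
  then have "AE x in lborel. f (- x) = g (- x)"
    by (intro AE_lborel_uminus square_integrable_measurable) (auto simp: L2_rel_def)
  then show "L2_rel (\<lambda>x. cnj (f (- x))) (\<lambda>x. cnj (g (- x)))"
    using fg unfolding L2_rel_def
    by (auto intro: square_integrable_cnj_reflect elim: eventually_mono)
qed

lemma cnj_abs_L2: "square_integrable f \<Longrightarrow> cnj_L2 (abs_L2 f) = abs_L2 (\<lambda>x. cnj (f x))"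
  by (rule cnj_L2.abs_eq) (auto simp: L2_rel_def)

lemma cnj_reflect_abs_L2:
  "square_integrable f \<Longrightarrow> cnj_reflect_L2 (abs_L2 f) = abs_L2 (\<lambda>x. cnj (f (- x)))"
  by (rule cnj_reflect_L2.abs_eq) (auto simp: L2_rel_def)

lemma rep_cnj_L2: "AE x in lborel. rep_L2 (cnj_L2 f) x = cnj (rep_L2 f x)"
  using rep_abs_L2[OF square_integrable_cnj[OF rep_L2[of f]]]
  by (simp add: cnj_abs_L2[OF rep_L2, symmetric])

lemma inner_cnj_L2 [simp]: "cnj_L2 f \<bullet> cnj_L2 g = f \<bullet> g"
  by transfer (simp add: inner_complex_def)

lemma norm_cnj_L2 [simp]: "norm (cnj_L2 f) = norm f"
  by (simp add: norm_eq_sqrt_inner)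

lemma cnj_cnj_L2 [simp]: "cnj_L2 (cnj_L2 f) = f"
  by transfer (auto simp: L2_rel_def)

lemma bounded_linear_cnj_L2: "bounded_linear cnj_L2"
proof (rule bounded_linear_intro)
  show "cnj_L2 (f + g) = cnj_L2 f + cnj_L2 g" for f g
    by transfer (auto simp: L2_rel_def intro: square_integrable_add square_integrable_cnj)
  show "cnj_L2 (r *\<^sub>R f) = r *\<^sub>R cnj_L2 f" for r f
    by transfer (auto simp: L2_rel_def intro: square_integrable_scaleR square_integrable_cnj)
  show "norm (cnj_L2 f) \<le> norm f * 1" for f
    by simp
qed

lemma cnj_scaleC_L2: "cnj_L2 (scaleC_L2 c f) = scaleC_L2 (cnj c) (cnj_L2 f)"
  by transfer (auto simp: L2_rel_def intro: square_integrable_cmult square_integrable_cnj)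

lemma norm_cnj_reflect_L2 [simp]: "norm (cnj_reflect_L2 f) = norm f"
proof -
  have "(norm (cnj_reflect_L2 f))\<^sup>2 = (LINT x|lborel. (norm (rep_L2 f (- x)))\<^sup>2)"
    using cnj_reflect_abs_L2[OF rep_L2, of f] norm_abs_L2[OF square_integrable_cnj_reflect[OF rep_L2[of f]]]
    by simp
  also have "\<dots> = (norm f)\<^sup>2"
    using lborel_integral_real_affine[of "- 1" "\<lambda>x. (norm (rep_L2 f x))\<^sup>2" 0] by (simp add: norm_rep_L2)
  finally show ?thesis
    by (simp add: power2_eq_iff_nonneg)
qed

lemma bounded_linear_cnj_reflect_L2: "bounded_linear cnj_reflect_L2"
proof (rule bounded_linear_intro)
  show "cnj_reflect_L2 (f + g) = cnj_reflect_L2 f + cnj_reflect_L2 g" for f g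
    by transfer (auto simp: L2_rel_def intro: square_integrable_add square_integrable_cnj_reflect
        square_integrable_cnj_reflect[OF square_integrable_add, simplified])
  show "cnj_reflect_L2 (r *\<^sub>R f) = r *\<^sub>R cnj_reflect_L2 f" for r f
    by transfer (auto simp: L2_rel_def intro: square_integrable_scaleR[OF square_integrable_cnj_reflect])
  show "norm (cnj_reflect_L2 f) \<le> norm f * 1" for f
    by simp
qed

text \<open>Conjugation becomes conjugation with reflection on the Fourier side; this is what later
  decides which multipliers preserve real functions.\<close>

lemma fourier_L2_cnj: "fourier_L2 (cnj_L2 f) = cnj_reflect_L2 (fourier_L2 f)"
proof -
  have "abs_L2 (fourier_integral (truncate_L2 n (cnj_L2 f)))
      = cnj_reflect_L2 (abs_L2 (fourier_integral (truncate_L2 n f)))" for n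
  proof -
    have "fourier_integral (truncate_L2 n (cnj_L2 f)) = fourier_integral (\<lambda>x. cnj (truncate_L2 n f x))"
      using rep_cnj_L2[of f]
      by (intro fourier_integral_cong_AE) (auto simp: truncate_L2_def elim: eventually_mono)
    then show ?thesis
      by (simp add: fourier_integral_cnj[abs_def] cnj_reflect_abs_L2 square_integrable_fourier_truncate)
  qed
  moreover have "(\<lambda>n. cnj_reflect_L2 (abs_L2 (fourier_integral (truncate_L2 n f)))) \<longlonglongrightarrow> cnj_reflect_L2 (fourier_L2 f)"
    by (intro bounded_linear.tendsto[OF bounded_linear_cnj_reflect_L2] fourier_L2_tendsto)
  ultimately have "(\<lambda>n. abs_L2 (fourier_integral (truncate_L2 n (cnj_L2 f)))) \<longlonglongrightarrow> cnj_reflect_L2 (fourier_L2 f)"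
    by simp
  then show ?thesis
    using fourier_L2_tendsto LIMSEQ_unique by blast
qed

text \<open>The inner product on \<open>complex L2\<close> is the real one, so the pairing of
  \<open>f\<close> with \<open>cnj_L2 g\<close> is the real part of the integral of
  \<open>f * g\<close>, without conjugation. In this form the multiplication formula for truncations
  passes to the limit.\<close>

lemma fourier_L2_adjoint: "fourier_L2 f \<bullet> cnj_L2 g = f \<bullet> cnj_L2 (fourier_L2 g)"
proof -
  let ?f = "\<lambda>n. truncate_L2 n f" and ?g = "\<lambda>n. truncate_L2 n g"
  have inner: "abs_L2 u \<bullet> cnj_L2 (abs_L2 v) = Re (LINT x|lborel. u x * v x)"
    if uv: "square_integrable u" "square_integrable v" and int: "integrable lborel (\<lambda>x. u x * v x)" for u v
  proof -
    have "abs_L2 u \<bullet> cnj_L2 (abs_L2 v) = (LINT x|lborel. Re (u x * v x))"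
      by (simp add: cnj_abs_L2 uv inner_abs_L2 square_integrable_cnj inner_complex_def)
    then show ?thesis
      by (simp only: integral_Re[OF int])
  qed
  have prod: "integrable lborel (\<lambda>x. fourier_integral (truncate_L2 n h) x * truncate_L2 n k x)" for n h k
  proof -
    define C where "C = 1 / sqrt (2 * pi) * (LINT x|lborel. norm (truncate_L2 n h x))"
    have C: "norm (fourier_integral (truncate_L2 n h) x) \<le> C" for x
      unfolding C_def by (rule norm_fourier_integral_le)
    have "0 \<le> C" using C[of 0] norm_ge_zero order_trans by blast
    show ?thesis
    proof (rule Bochner_Integration.integrable_bound)
      show "integrable lborel (\<lambda>x. C * norm (truncate_L2 n k x))"
        by (intro integrable_mult_right integrable_norm integrable_truncate_L2)
      show "AE x in lborel. norm (fourier_integral (truncate_L2 n h) x * truncate_L2 n k x)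
          \<le> norm (C * norm (truncate_L2 n k x))"
        using C \<open>0 \<le> C\<close> by (intro AE_I2) (simp add: norm_mult mult_right_mono)
    qed measurable
  qed
  have "abs_L2 (fourier_integral (?f n)) \<bullet> cnj_L2 (abs_L2 (?g n))
      = abs_L2 (?f n) \<bullet> cnj_L2 (abs_L2 (fourier_integral (?g n)))" for n
  proof -
    have prod': "integrable lborel (\<lambda>x. ?f n x * fourier_integral (?g n) x)"
      using prod[of n g f] by (subst mult.commute)
    show ?thesis
      unfolding inner[OF square_integrable_fourier_truncate square_integrable_truncate_L2 prod]
        inner[OF square_integrable_truncate_L2 square_integrable_fourier_truncate prod']
      by (simp only: fourier_integral_multiplication[OF integrable_truncate_L2 integrable_truncate_L2])
  qed
  moreover have "(\<lambda>n. abs_L2 (fourier_integral (?f n)) \<bullet> cnj_L2 (abs_L2 (?g n))) \<longlonglongrightarrow> fourier_L2 f \<bullet> cnj_L2 g"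
    by (intro tendsto_inner bounded_linear.tendsto[OF bounded_linear_cnj_L2] fourier_L2_tendsto truncate_L2_tendsto)
  moreover have "(\<lambda>n. abs_L2 (?f n) \<bullet> cnj_L2 (abs_L2 (fourier_integral (?g n)))) \<longlonglongrightarrow> f \<bullet> cnj_L2 (fourier_L2 g)"
    by (intro tendsto_inner bounded_linear.tendsto[OF bounded_linear_cnj_L2] fourier_L2_tendsto truncate_L2_tendsto)
  ultimately show ?thesis
    by (auto intro: LIMSEQ_unique)
qed

text \<open>Polarisation.\<close>

lemma isometry_inner:
  fixes A :: "'a::real_inner \<Rightarrow> 'b::real_inner"
  assumes "linear A" "\<And>x. norm (A x) = norm x"
  shows "A x \<bullet> A y = x \<bullet> y"
  by (simp add: dot_norm[of "A x" "A y"] dot_norm[of x y] linear_add[OF assms(1), symmetric] assms(2))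

lemma fourier_L2_inner: "fourier_L2 f \<bullet> fourier_L2 g = f \<bullet> g"
  by (intro isometry_inner bounded_linear.linear bounded_linear_fourier_L2 norm_fourier_L2)

text \<open>The adjoint \<open>C F C\<close> of the isometry \<open>F\<close> (with \<open>C\<close> the conjugation) is itself
  isometric, so \<open>F\<close> is unitary.\<close>

lemma fourier_L2_inverse: "fourier_L2 (cnj_L2 (fourier_L2 (cnj_L2 g))) = g"
proof -
  define A where "A g = cnj_L2 (fourier_L2 (cnj_L2 g))" for g
  have "linear A"
    unfolding A_def using bounded_linear_compose[OF bounded_linear_cnj_L2
        bounded_linear_compose[OF bounded_linear_fourier_L2 bounded_linear_cnj_L2]]
    by (simp add: bounded_linear.linear)
  then have iso: "A g \<bullet> A k = g \<bullet> k" for g k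
    by (rule isometry_inner) (simp add: A_def)
  have adj: "fourier_L2 f \<bullet> k = f \<bullet> A k" for f k
    using fourier_L2_adjoint[of f "cnj_L2 k"] by (simp add: A_def)
  have "(fourier_L2 (A g) - g) \<bullet> k = 0" for k
    by (simp add: inner_diff_left adj iso)
  then have "fourier_L2 (A g) - g = 0"
    using inner_eq_zero_iff by blast
  then show ?thesis
    by (simp add: A_def)
qed

lemma fourier_L2_diff: "fourier_L2 (f - g) = fourier_L2 f - fourier_L2 g"
  by (rule linear_diff[OF bounded_linear.linear[OF bounded_linear_fourier_L2]])

lemma fourier_L2_eq_iff [simp]: "fourier_L2 f = fourier_L2 g \<longleftrightarrow> f = g"
proof
  assume "fourier_L2 f = fourier_L2 g"
  then have "norm (fourier_L2 (f - g)) = 0"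
    by (simp add: fourier_L2_diff)
  then show "f = g" by simp
qed simp

text \<open>Surjectivity and injectivity make this description well defined for every
  \<open>h\<close>. \<open>multiplier_L2\<close> and \<open>multiplier_L1\<close> are defined by
  descriptions of this form, so both can be computed on the Fourier side.\<close>

lemma fourier_L2_the: "fourier_L2 (THE g. fourier_L2 g = h) = h"
proof (rule theI)
  show "fourier_L2 (cnj_L2 (fourier_L2 (cnj_L2 h))) = h"
    by (rule fourier_L2_inverse)
  show "g = cnj_L2 (fourier_L2 (cnj_L2 h))" if "fourier_L2 g = h" for g
    using that fourier_L2_inverse[of h] by (metis fourier_L2_eq_iff)
qed

section \<open>Fourier multipliers\<close>

definition bounded_symbol :: "(real \<Rightarrow> complex) \<Rightarrow> bool" where
  "bounded_symbol m \<longleftrightarrow> m \<in> borel_measurable borel \<and> bounded (range m)"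

text \<open>The action of a multiplier on the Fourier side, where it is a pointwise product;
  \<open>bounded_symbol\<close> keeps the product in L2.\<close>

definition mult_L2 :: "(real \<Rightarrow> complex) \<Rightarrow> complex L2 \<Rightarrow> complex L2" where
  "mult_L2 m f = abs_L2 (\<lambda>\<xi>. m \<xi> * rep_L2 f \<xi>)"

lemma bounded_symbolI:
  "m \<in> borel_measurable borel \<Longrightarrow> (\<And>\<xi>. norm (m \<xi>) \<le> K) \<Longrightarrow> bounded_symbol m"
  by (auto simp: bounded_symbol_def bounded_iff)

lemma bounded_symbol_measurable [measurable_dest]:
  "bounded_symbol m \<Longrightarrow> m \<in> borel_measurable borel"
  by (simp add: bounded_symbol_def)

lemma square_integrable_mult:
  assumes m: "bounded_symbol m" and f: "square_integrable f"
  shows "square_integrable (\<lambda>\<xi>. m \<xi> * f \<xi>)"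
proof -
  note [measurable] = bounded_symbol_measurable[OF m] square_integrable_measurable[OF f]
  obtain K where K: "\<And>\<xi>. norm (m \<xi>) \<le> K"
    using m by (auto simp: bounded_symbol_def bounded_iff)
  have "0 \<le> K" using K[of 0] norm_ge_zero order_trans by blast
  show ?thesis
  proof (rule square_integrable_bound[OF square_integrable_scaleR[OF f, of K]])
    show "AE \<xi> in lborel. norm (m \<xi> * f \<xi>) \<le> norm (K *\<^sub>R f \<xi>)"
      using K \<open>0 \<le> K\<close> by (intro AE_I2) (simp add: norm_mult mult_right_mono)
  qed measurable
qed

lemma mult_abs_L2:
  assumes m: "bounded_symbol m" and f: "square_integrable f"
  shows "mult_L2 m (abs_L2 f) = abs_L2 (\<lambda>\<xi>. m \<xi> * f \<xi>)"
  unfolding mult_L2_def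
  by (rule abs_L2_cong[OF square_integrable_mult[OF m rep_L2] square_integrable_mult[OF m f]])
    (use rep_abs_L2[OF f] in \<open>auto elim: eventually_mono\<close>)

lemma rep_mult_L2:
  "bounded_symbol m \<Longrightarrow> AE \<xi> in lborel. rep_L2 (mult_L2 m f) \<xi> = m \<xi> * rep_L2 f \<xi>"
  unfolding mult_L2_def by (intro rep_abs_L2 square_integrable_mult rep_L2)

lemma norm_mult_L2:
  assumes "bounded_symbol m"
  shows "(norm (mult_L2 m f))\<^sup>2 = (LINT \<xi>|lborel. (norm (m \<xi>))\<^sup>2 * (norm (rep_L2 f \<xi>))\<^sup>2)"
  unfolding mult_L2_def using norm_abs_L2[OF square_integrable_mult[OF assms rep_L2[of f]]]
  by (simp add: norm_mult power_mult_distrib)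

text \<open>The source of the operator bounds for \<open>multiplier_L2\<close> below: by Plancherel,
  comparing two multipliers amounts to comparing their symbols pointwise.\<close>

lemma norm_mult_L2_mono:
  assumes m: "bounded_symbol m" and m': "bounded_symbol m'"
    and le: "\<And>\<xi>. norm (m \<xi>) \<le> norm (m' \<xi>)"
  shows "norm (mult_L2 m f) \<le> norm (mult_L2 m' f)"
proof -
  have int: "integrable lborel (\<lambda>\<xi>. (norm (m \<xi>))\<^sup>2 * (norm (rep_L2 f \<xi>))\<^sup>2)" if "bounded_symbol m" for m
    using square_integrable_mult[OF that rep_L2[of f]]
    by (simp add: square_integrable_def norm_mult power_mult_distrib)
  have "(norm (mult_L2 m f))\<^sup>2 \<le> (norm (mult_L2 m' f))\<^sup>2"
    unfolding norm_mult_L2[OF m] norm_mult_L2[OF m']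
    by (intro integral_mono int m m' mult_right_mono power_mono le) auto
  then show ?thesis
    by (rule power2_le_imp_le) simp
qed

lemma bounded_symbol_const: "bounded_symbol (\<lambda>\<xi>. c)"
  by (rule bounded_symbolI[of _ "norm c"]) auto

lemma mult_L2_const: "mult_L2 (\<lambda>\<xi>. c) f = scaleC_L2 c f"
  using scaleC_abs_L2[OF rep_L2, of c f] by (simp add: mult_L2_def)

lemma norm_mult_L2_le:
  assumes "bounded_symbol m" "\<And>\<xi>. norm (m \<xi>) \<le> K"
  shows "norm (mult_L2 m f) \<le> K * norm f"
proof -
  have "0 \<le> K" using assms(2)[of 0] norm_ge_zero order_trans by blast
  then have "norm (mult_L2 m f) \<le> norm (mult_L2 (\<lambda>\<xi>. complex_of_real K) f)"
    using assms by (intro norm_mult_L2_mono bounded_symbol_const) auto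
  then show ?thesis
    using \<open>0 \<le> K\<close> by (simp add: mult_L2_const)
qed

lemma bounded_linear_mult_L2:
  assumes m: "bounded_symbol m"
  shows "bounded_linear (mult_L2 m)"
proof -
  obtain K where K: "\<And>\<xi>. norm (m \<xi>) \<le> K"
    using m by (auto simp: bounded_symbol_def bounded_iff)
  show ?thesis
  proof (rule bounded_linear_intro)
    show "norm (mult_L2 m f) \<le> norm f * K" for f
      using norm_mult_L2_le[OF m K] by (simp add: mult.commute)
    show "mult_L2 m (f + g) = mult_L2 m f + mult_L2 m g" for f g
      by (rule L2_eqI) (use rep_L2_add[of f g] rep_L2_add[of "mult_L2 m f" "mult_L2 m g"]
          rep_mult_L2[OF m, of f] rep_mult_L2[OF m, of g] rep_mult_L2[OF m, of "f + g"]
          in \<open>eventually_elim; simp add: distrib_left\<close>)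
    show "mult_L2 m (r *\<^sub>R f) = r *\<^sub>R mult_L2 m f" for r f
      by (rule L2_eqI) (use rep_L2_scaleR[of r f] rep_L2_scaleR[of r "mult_L2 m f"]
          rep_mult_L2[OF m, of f] rep_mult_L2[OF m, of "r *\<^sub>R f"]
          in \<open>eventually_elim; simp\<close>)
  qed
qed

lemma bounded_symbol_mult:
  assumes m: "bounded_symbol m" and k: "bounded_symbol k"
  shows "bounded_symbol (\<lambda>\<xi>. m \<xi> * k \<xi>)"
proof -
  note [measurable] = bounded_symbol_measurable[OF m] bounded_symbol_measurable[OF k]
  obtain K L where K: "\<And>\<xi>. norm (m \<xi>) \<le> K" and L: "\<And>\<xi>. norm (k \<xi>) \<le> L"
    using m k by (auto simp: bounded_symbol_def bounded_iff)
  show ?thesis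
  proof (rule bounded_symbolI)
    show "norm (m \<xi> * k \<xi>) \<le> K * L" for \<xi>
      unfolding norm_mult using order_trans[OF norm_ge_zero K] by (intro mult_mono K L) auto
  qed measurable
qed

lemma mult_mult_L2:
  assumes m: "bounded_symbol m" and k: "bounded_symbol k"
  shows "mult_L2 m (mult_L2 k f) = mult_L2 (\<lambda>\<xi>. m \<xi> * k \<xi>) f"
  by (rule L2_eqI) (use rep_mult_L2[OF m, of "mult_L2 k f"] rep_mult_L2[OF k, of f]
      rep_mult_L2[OF bounded_symbol_mult[OF m k], of f] in \<open>eventually_elim; simp\<close>)

lemma mult_L2_diff_symbol:
  assumes m: "bounded_symbol m" and k: "bounded_symbol k"
  shows "mult_L2 m f - mult_L2 k f = mult_L2 (\<lambda>\<xi>. m \<xi> - k \<xi>) f"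
  unfolding mult_L2_def
  by (simp add: abs_L2_diff square_integrable_mult m k rep_L2 left_diff_distrib)

lemma fourier_multiplier_L2: "fourier_L2 (multiplier_L2 m f) = mult_L2 m (fourier_L2 f)"
  unfolding multiplier_L2_def mult_L2_def by (rule fourier_L2_the)

lemma fourier_multiplier_L1: "fourier_L2 (multiplier_L1 m h) = abs_L2 (\<lambda>\<xi>. m \<xi> * fourier_integral h \<xi>)"
  unfolding multiplier_L1_def by (rule fourier_L2_the)

lemma norm_multiplier_L2: "norm (multiplier_L2 m f) = norm (mult_L2 m (fourier_L2 f))"
  by (metis norm_fourier_L2 fourier_multiplier_L2)

lemma bounded_linear_multiplier_L2:
  assumes m: "bounded_symbol m"
  shows "bounded_linear (multiplier_L2 m)"
proof -
  interpret F: bounded_linear fourier_L2 by (rule bounded_linear_fourier_L2)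
  interpret M: bounded_linear "mult_L2 m" by (rule bounded_linear_mult_L2[OF m])
  obtain K where "\<And>f. norm (mult_L2 m f) \<le> norm f * K"
    using M.bounded by blast
  then have "norm (multiplier_L2 m f) \<le> norm f * K" for f
    unfolding norm_multiplier_L2 by (metis norm_fourier_L2)
  moreover have "multiplier_L2 m (f + g) = multiplier_L2 m f + multiplier_L2 m g" for f g
    by (subst fourier_L2_eq_iff[symmetric]) (simp only: F.add fourier_multiplier_L2 M.add)
  moreover have "multiplier_L2 m (r *\<^sub>R f) = r *\<^sub>R multiplier_L2 m f" for r f
    by (subst fourier_L2_eq_iff[symmetric]) (simp only: F.scaleR fourier_multiplier_L2 M.scaleR)
  ultimately show ?thesis
    by (intro bounded_linear_intro)
qed

lemma multiplier_multiplier_L2: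
  "bounded_symbol m \<Longrightarrow> bounded_symbol k \<Longrightarrow>
    multiplier_L2 m (multiplier_L2 k f) = multiplier_L2 (\<lambda>\<xi>. m \<xi> * k \<xi>) f"
  by (subst fourier_L2_eq_iff[symmetric]) (simp only: fourier_multiplier_L2 mult_mult_L2)

lemma multiplier_L2_commute:
  "bounded_symbol m \<Longrightarrow> bounded_symbol k \<Longrightarrow>
    multiplier_L2 m (multiplier_L2 k f) = multiplier_L2 k (multiplier_L2 m f)"
  by (simp only: multiplier_multiplier_L2 mult.commute)

lemma multiplier_L2_diff_symbol:
  "bounded_symbol m \<Longrightarrow> bounded_symbol k \<Longrightarrow>
    multiplier_L2 m f - multiplier_L2 k f = multiplier_L2 (\<lambda>\<xi>. m \<xi> - k \<xi>) f"
  by (subst fourier_L2_eq_iff[symmetric])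
    (simp only: fourier_multiplier_L2 fourier_L2_diff mult_L2_diff_symbol)

lemma multiplier_L2_const: "multiplier_L2 (\<lambda>\<xi>. c) f = scaleC_L2 c f"
  by (subst fourier_L2_eq_iff[symmetric]) (simp only: fourier_multiplier_L2 mult_L2_const fourier_L2_scaleC)

lemma norm_multiplier_L2_mono:
  "bounded_symbol m \<Longrightarrow> bounded_symbol m' \<Longrightarrow> (\<And>\<xi>. norm (m \<xi>) \<le> norm (m' \<xi>)) \<Longrightarrow>
    norm (multiplier_L2 m f) \<le> norm (multiplier_L2 m' f)"
  unfolding norm_multiplier_L2 by (rule norm_mult_L2_mono)

lemma norm_multiplier_L2_le:
  "bounded_symbol m \<Longrightarrow> (\<And>\<xi>. norm (m \<xi>) \<le> K) \<Longrightarrow> norm (multiplier_L2 m f) \<le> K * norm f"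
  unfolding norm_multiplier_L2 using norm_mult_L2_le[of m K "fourier_L2 f"] by simp

text \<open>Comparison with the constant symbol 1 in both directions.\<close>

lemma norm_multiplier_L2_unimodular:
  assumes m: "bounded_symbol m" "\<And>\<xi>. norm (m \<xi>) = 1"
  shows "norm (multiplier_L2 m f) = norm f"
  using norm_multiplier_L2_mono[OF m(1) bounded_symbol_const[of 1], of f]
    norm_multiplier_L2_mono[OF bounded_symbol_const[of 1] m(1), of f] m(2)
  by (simp add: multiplier_L2_const)

text \<open>A Hermitian symbol commutes with conjugation and reflection on the Fourier side, so the
  operator commutes with conjugation and maps real functions to real ones.\<close>

lemma multiplier_L2_cnj:
  assumes m: "bounded_symbol m" and sym: "\<And>\<xi>. m (- \<xi>) = cnj (m \<xi>)"
  shows "multiplier_L2 m (cnj_L2 f) = cnj_L2 (multiplier_L2 m f)"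
proof -
  have "mult_L2 m (cnj_reflect_L2 g) = cnj_reflect_L2 (mult_L2 m g)" for g
    using square_integrable_mult[OF m rep_L2[of g]]
    by (simp add: mult_L2_def[of m g] cnj_reflect_abs_L2 sym
        cnj_reflect_abs_L2[OF rep_L2[of g], simplified]
        mult_abs_L2[OF m square_integrable_cnj_reflect[OF rep_L2[of g]]])
  then show ?thesis
    by (subst fourier_L2_eq_iff[symmetric]) (simp only: fourier_multiplier_L2 fourier_L2_cnj)
qed

lemma multiplier_L2_symmetric:
  assumes m: "bounded_symbol m" and real: "\<And>\<xi>. Im (m \<xi>) = 0"
  shows "multiplier_L2 m f \<bullet> g = f \<bullet> multiplier_L2 m g"
proof -
  have "mult_L2 m u \<bullet> v = u \<bullet> mult_L2 m v" for u v
  proof -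
    have "mult_L2 m u \<bullet> v = (LINT \<xi>|lborel. (m \<xi> * rep_L2 u \<xi>) \<bullet> rep_L2 v \<xi>)"
      using inner_abs_L2[OF square_integrable_mult[OF m rep_L2[of u]] rep_L2[of v]]
      by (simp add: mult_L2_def)
    also have "\<dots> = (LINT \<xi>|lborel. rep_L2 u \<xi> \<bullet> (m \<xi> * rep_L2 v \<xi>))"
      by (simp add: inner_complex_def real algebra_simps)
    also have "\<dots> = u \<bullet> mult_L2 m v"
      using inner_abs_L2[OF rep_L2[of u] square_integrable_mult[OF m rep_L2[of v]]]
      by (simp add: mult_L2_def)
    finally show ?thesis .
  qed
  then have "fourier_L2 (multiplier_L2 m f) \<bullet> fourier_L2 g = fourier_L2 f \<bullet> fourier_L2 (multiplier_L2 m g)"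
    by (simp only: fourier_multiplier_L2)
  then show ?thesis
    by (simp only: fourier_L2_inner)
qed

lemma fourier_integral_bounded_symbol:
  assumes "h \<in> borel_measurable borel"
  shows "bounded_symbol (fourier_integral h)"
  by (rule bounded_symbolI[OF measurable_fourier_integral[OF assms] norm_fourier_integral_le])

lemma square_integrable_mult_fourier:
  assumes "square_integrable m" "h \<in> borel_measurable borel"
  shows "square_integrable (\<lambda>\<xi>. m \<xi> * fourier_integral h \<xi>)"
  using square_integrable_mult[OF fourier_integral_bounded_symbol[OF assms(2)] assms(1)]
  by (simp add: mult.commute)

text \<open>The roles are exchanged: the transform of \<open>h\<close> is bounded by the L1 norm, so
  it serves as the symbol and acts on the square integrable \<open>m\<close>.\<close>

lemma norm_multiplier_L1_le:
  assumes m: "square_integrable m" and h: "h \<in> borel_measurable borel"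
  shows "norm (multiplier_L1 m h) \<le> 1 / sqrt (2 * pi) * (LINT x|lborel. norm (h x)) * norm (abs_L2 m)"
proof -
  have "norm (multiplier_L1 m h) = norm (abs_L2 (\<lambda>\<xi>. m \<xi> * fourier_integral h \<xi>))"
    by (metis norm_fourier_L2 fourier_multiplier_L1)
  also have "\<dots> = norm (mult_L2 (fourier_integral h) (abs_L2 m))"
    by (simp add: mult_abs_L2 fourier_integral_bounded_symbol m h mult.commute)
  also have "\<dots> \<le> 1 / sqrt (2 * pi) * (LINT x|lborel. norm (h x)) * norm (abs_L2 m)"
    by (intro norm_mult_L2_le fourier_integral_bounded_symbol norm_fourier_integral_le h)
  finally show ?thesis .
qed

lemma multiplier_L1_add:
  assumes m: "square_integrable m" and h: "integrable lborel h" "integrable lborel k"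
  shows "multiplier_L1 m (\<lambda>x. h x + k x) = multiplier_L1 m h + multiplier_L1 m k"
proof -
  note [measurable] = borel_measurable_integrable[OF h(1)] borel_measurable_integrable[OF h(2)]
  show ?thesis
    by (subst fourier_L2_eq_iff[symmetric])
      (simp add: fourier_multiplier_L1 fourier_L2_add abs_L2_add square_integrable_mult_fourier m
        fourier_integral_add h distrib_left)
qed

lemma multiplier_L1_cmult:
  assumes m: "square_integrable m" and h: "h \<in> borel_measurable borel"
  shows "multiplier_L1 m (\<lambda>x. c * h x) = scaleC_L2 c (multiplier_L1 m h)"
  by (subst fourier_L2_eq_iff[symmetric])
    (simp add: fourier_multiplier_L1 fourier_L2_scaleC scaleC_abs_L2 square_integrable_mult_fourier m h
        fourier_integral_cmult mult.left_commute)

lemma multiplier_L1_cong_AE: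
  assumes "h \<in> borel_measurable borel" "k \<in> borel_measurable borel" "AE x in lborel. h x = k x"
  shows "multiplier_L1 m h = multiplier_L1 m k"
  using fourier_integral_cong_AE[OF assms] by (simp add: multiplier_L1_def)

text \<open>Needed for the squares of the oscillating data: their decay is known for the L2
  multiplier, while the nonlinearity is defined by the L1 multiplier.\<close>

lemma multiplier_L1_eq_L2:
  assumes m: "bounded_symbol m" and h: "square_integrable h" "\<And>x. \<bar>x\<bar> > R \<Longrightarrow> h x = 0"
  shows "multiplier_L1 m h = multiplier_L2 m (abs_L2 h)"
  by (subst fourier_L2_eq_iff[symmetric])
    (simp add: fourier_multiplier_L1 fourier_multiplier_L2 fourier_L2_abs[OF h] mult_abs_L2[OF m plancherel_support(1)[OF h]])

text \<open>A real odd symbol such as that of BBM satisfies \<open>sym\<close>, and the operator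
  then sends real functions to purely imaginary ones; the factor \<open>- \<i> / 2\<close> in the
  equation makes the result real again.\<close>

lemma multiplier_L1_cnj:
  assumes m: "square_integrable m" and sym: "\<And>\<xi>. m (- \<xi>) = - cnj (m \<xi>)"
    and h: "h \<in> borel_measurable borel" and real: "\<And>x. cnj (h x) = h x"
  shows "cnj_L2 (multiplier_L1 m h) = - multiplier_L1 m h"
proof -
  have "cnj (fourier_integral h (- \<xi>)) = fourier_integral h \<xi>" for \<xi>
    using fourier_integral_cnj[of h \<xi>] by (simp add: real)
  then have "fourier_L2 (cnj_L2 (multiplier_L1 m h)) = abs_L2 (\<lambda>\<xi>. (- 1) *\<^sub>R (m \<xi> * fourier_integral h \<xi>))"
    by (simp add: fourier_L2_cnj fourier_multiplier_L1 cnj_reflect_abs_L2 square_integrable_mult_fourier m h sym)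
  also have "\<dots> = fourier_L2 ((- 1) *\<^sub>R multiplier_L1 m h)"
    by (simp only: abs_L2_scaleR[OF square_integrable_mult_fourier[OF m h], symmetric]
        linear_cmul[OF bounded_linear.linear[OF bounded_linear_fourier_L2]] fourier_multiplier_L1)
  finally show ?thesis by simp
qed

section \<open>Real L2 as the conjugation invariant part of complex L2\<close>

lift_definition Re_L2 :: "complex L2 \<Rightarrow> real L2" is "\<lambda>f x. Re (f x)"
proof -
  fix f g :: "real \<Rightarrow> complex"
  assume fg: "L2_rel f g"
  have "square_integrable (\<lambda>x. Re (f x))" if "square_integrable f" for f :: "real \<Rightarrow> complex"
  proof -
    note [measurable] = square_integrable_measurable[OF that]
    show ?thesis
      by (rule square_integrable_bound[OF that]) (auto simp: abs_Re_le_cmod)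
  qed
  then show "L2_rel (\<lambda>x. Re (f x)) (\<lambda>x. Re (g x))"
    using fg unfolding L2_rel_def by (auto elim: eventually_mono)
qed

lemma square_integrable_of_real:
  "square_integrable f \<Longrightarrow> square_integrable (\<lambda>x. complex_of_real (f x))"
  by (auto simp: square_integrable_def)

lemma square_integrable_Re: "square_integrable f \<Longrightarrow> square_integrable (\<lambda>x. Re (f x))"
  using Re_L2.rsp by (auto simp: rel_fun_def L2_rel_def)

lemma complex_abs_L2: "square_integrable f \<Longrightarrow> complex_L2 (abs_L2 f) = abs_L2 (\<lambda>x. complex_of_real (f x))"
  by (rule complex_L2.abs_eq) (auto simp: L2_rel_def)

lemma Re_complex_L2 [simp]: "Re_L2 (complex_L2 f) = f"
  by transfer (auto simp: L2_rel_def)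

lemma complex_Re_L2: "cnj_L2 g = g \<Longrightarrow> complex_L2 (Re_L2 g) = g"
proof transfer
  fix g assume "L2_rel (\<lambda>x. cnj (g x)) g"
  then show "L2_rel (\<lambda>x. complex_of_real (Re (g x))) g"
    unfolding L2_rel_def
    by (auto intro: square_integrable_of_real square_integrable_Re elim!: eventually_mono
        simp: complex_eq_iff)
qed

lemma cnj_complex_L2 [simp]: "cnj_L2 (complex_L2 f) = complex_L2 f"
  by transfer (auto simp: L2_rel_def intro: square_integrable_of_real)

lemma inner_complex_L2 [simp]: "complex_L2 f \<bullet> complex_L2 g = f \<bullet> g"
  by transfer (simp add: inner_complex_def)

lemma norm_complex_L2 [simp]: "norm (complex_L2 f) = norm f"
  by (simp add: norm_eq_sqrt_inner)

lemma bounded_linear_complex_L2: "bounded_linear complex_L2"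
proof (rule bounded_linear_intro)
  show "complex_L2 (f + g) = complex_L2 f + complex_L2 g" for f g
    by transfer (auto simp: L2_rel_def intro: square_integrable_add square_integrable_of_real)
  show "complex_L2 (r *\<^sub>R f) = r *\<^sub>R complex_L2 f" for r f
    by transfer (auto simp: L2_rel_def scaleR_conv_of_real
        intro: square_integrable_cmult square_integrable_of_real)
  show "norm (complex_L2 f) \<le> norm f * 1" for f
    by simp
qed

lemma complex_L2_eq_iff [simp]: "complex_L2 f = complex_L2 g \<longleftrightarrow> f = g"
  by (metis Re_complex_L2)

lemma complex_L2_diff: "complex_L2 (f - g) = complex_L2 f - complex_L2 g"
  by (rule linear_diff[OF bounded_linear.linear[OF bounded_linear_complex_L2]])

lemma norm_Re_L2_le: "norm (Re_L2 f) \<le> norm f"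
proof -
  have "(norm (Re_L2 f))\<^sup>2 \<le> (norm f)\<^sup>2"
    unfolding power2_norm_eq_inner
  proof transfer
    fix f :: "real \<Rightarrow> complex" assume "L2_rel f f"
    then have f: "square_integrable f" by (simp add: L2_rel_def)
    show "(LINT x|lborel. Re (f x) \<bullet> Re (f x)) \<le> (LINT x|lborel. f x \<bullet> f x)"
      by (intro integral_mono square_integrable_inner f square_integrable_Re)
        (simp add: inner_complex_def)
  qed
  then show ?thesis
    by (rule power2_le_imp_le) simp
qed

lemma bounded_linear_Re_L2: "bounded_linear Re_L2"
proof (rule bounded_linear_intro)
  show "Re_L2 (f + g) = Re_L2 f + Re_L2 g" for f g
    by transfer (auto simp: L2_rel_def intro: square_integrable_add square_integrable_Re)
  show "Re_L2 (r *\<^sub>R f) = r *\<^sub>R Re_L2 f" for r f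
    by transfer (use square_integrable_scaleR[OF square_integrable_Re] in \<open>auto simp: L2_rel_def\<close>)
  show "norm (Re_L2 f) \<le> norm f * 1" for f
    using norm_Re_L2_le by simp
qed

section \<open>The BBM group and nonlinearity on real \<open>L\<^sup>2\<close>\<close>

abbreviation bbm_csymbol :: "real \<Rightarrow> complex" where
  "bbm_csymbol \<xi> \<equiv> complex_of_real (bbm_symbol \<xi>)"

abbreviation bbm_phase :: "real \<Rightarrow> real \<Rightarrow> complex" where
  "bbm_phase t \<xi> \<equiv> exp (- (\<i> * complex_of_real (t * bbm_symbol \<xi>)))"

lemma bbm_symbol_measurable [measurable]: "bbm_symbol \<in> borel_measurable borel"
  unfolding bbm_symbol_def[abs_def] by measurable

lemma abs_bbm_symbol_le: "\<bar>bbm_symbol \<xi>\<bar> \<le> 1"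
proof -
  have "\<bar>\<xi>\<bar> \<le> 1 + \<xi>\<^sup>2"
    using sum_squares_bound[of 1 "\<bar>\<xi>\<bar>"] by auto
  moreover have "0 < 1 + \<xi>\<^sup>2"
    by (rule add_pos_nonneg) auto
  ultimately show ?thesis
    by (simp add: bbm_symbol_def abs_divide)
qed

lemma bbm_symbol_minus: "bbm_symbol (- \<xi>) = - bbm_symbol \<xi>"
  by (simp add: bbm_symbol_def)

lemma bbm_symbol_sq_le: "(bbm_symbol \<xi>)\<^sup>2 \<le> inverse (1 + \<xi>\<^sup>2)"
proof -
  have p: "0 < 1 + \<xi>\<^sup>2"
    by (rule add_pos_nonneg) auto
  have "(bbm_symbol \<xi>)\<^sup>2 = \<xi>\<^sup>2 / (1 + \<xi>\<^sup>2) * inverse (1 + \<xi>\<^sup>2)"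
    by (simp add: bbm_symbol_def power2_eq_square divide_inverse)
  also have "\<dots> \<le> 1 * inverse (1 + \<xi>\<^sup>2)"
    using p by (intro mult_right_mono) auto
  finally show ?thesis by simp
qed

lemma bounded_symbol_bbm: "bounded_symbol bbm_csymbol"
  by (rule bounded_symbolI[of _ 1]) (auto simp: abs_bbm_symbol_le)

text \<open>This decay is what lets the nonlinearity map L2 to L2 although the square of an L2
  function is only integrable.\<close>

lemma square_integrable_bbm: "square_integrable bbm_csymbol"
  unfolding square_integrable_def
proof
  have "integrable lborel (\<lambda>\<xi>::real. inverse (1 + \<xi>\<^sup>2))"
    using integrable_inverse_1_plus_square by (simp add: set_integrable_def)
  then show "integrable lborel (\<lambda>\<xi>. (norm (bbm_csymbol \<xi>))\<^sup>2)"
    by (rule Bochner_Integration.integrable_bound)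
      (use bbm_symbol_sq_le in \<open>auto intro: order_trans[OF _ abs_ge_self]\<close>)
qed measurable

lemma bounded_symbol_phase: "bounded_symbol (bbm_phase t)"
  by (rule bounded_symbolI[of _ 1]) auto

lemma norm_bbm_group [simp]: "norm (bbm_group t f) = norm f"
  unfolding bbm_group_def by (rule norm_multiplier_L2_unimodular[OF bounded_symbol_phase]) simp

lemma bounded_linear_bbm_group: "bounded_linear (bbm_group t)"
  unfolding bbm_group_def by (rule bounded_linear_multiplier_L2[OF bounded_symbol_phase])

lemma bbm_group_add: "bbm_group (s + t) f = bbm_group s (bbm_group t f)"
proof -
  have "bbm_phase s \<xi> * bbm_phase t \<xi> = bbm_phase (s + t) \<xi>" for \<xi>
    by (simp add: exp_add[symmetric] algebra_simps)
  then show ?thesis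
    by (simp only: bbm_group_def multiplier_multiplier_L2[OF bounded_symbol_phase bounded_symbol_phase])
qed

lemma bbm_group_0 [simp]: "bbm_group 0 f = f"
  by (simp add: bbm_group_def multiplier_L2_const)

lemma bbm_group_cnj: "bbm_group t (cnj_L2 f) = cnj_L2 (bbm_group t f)"
  unfolding bbm_group_def
  by (rule multiplier_L2_cnj[OF bounded_symbol_phase]) (simp add: exp_cnj bbm_symbol_minus)

text \<open>From \<open>\<bar>exp (\<i> a) - 1\<bar> \<le> \<bar>a\<bar>\<close> with
  \<open>a = - t * bbm_symbol \<xi>\<close>. Keeping the multiplier on the right, instead of
  bounding it by the norm of \<open>f\<close>, retains the gain at high frequency: on the
  oscillating data the right-hand side tends to 0.\<close>

lemma norm_bbm_group_diff_le: "norm (bbm_group t f - f) \<le> \<bar>t\<bar> * norm (multiplier_L2 bbm_csymbol f)"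
proof -
  have "norm (exp (\<i> * complex_of_real a) - 1) \<le> \<bar>a\<bar>" for a
    using iexp_approx1[of a 0] by (simp add: norm_minus_commute)
  from this[of "- (t * bbm_symbol \<xi>)" for \<xi>]
  have le: "norm (bbm_phase t \<xi> - 1) \<le> \<bar>t * bbm_symbol \<xi>\<bar>" for \<xi>
    by simp
  have b: "bounded_symbol (\<lambda>\<xi>. complex_of_real t * bbm_csymbol \<xi>)"
    by (intro bounded_symbol_mult bounded_symbol_const bounded_symbol_bbm)
  have "norm (bbm_group t f - f) = norm (multiplier_L2 (\<lambda>\<xi>. bbm_phase t \<xi> - 1) f)"
    using multiplier_L2_diff_symbol[OF bounded_symbol_phase[of t] bounded_symbol_const[of 1], of f]
    by (simp add: bbm_group_def multiplier_L2_const)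
  also have "\<dots> \<le> norm (multiplier_L2 (\<lambda>\<xi>. complex_of_real t * bbm_csymbol \<xi>) f)"
  proof (rule norm_multiplier_L2_mono[OF _ b])
    show "bounded_symbol (\<lambda>\<xi>. bbm_phase t \<xi> - 1)"
    proof (rule bounded_symbolI)
      show "norm (bbm_phase t \<xi> - 1) \<le> 2" for \<xi>
        using norm_triangle_ineq4[of "bbm_phase t \<xi>" 1] by simp
    qed measurable
    show "norm (bbm_phase t \<xi> - 1) \<le> norm (complex_of_real t * bbm_csymbol \<xi>)" for \<xi>
      using le[of \<xi>] by (simp add: norm_mult abs_mult)
  qed
  also have "multiplier_L2 (\<lambda>\<xi>. complex_of_real t * bbm_csymbol \<xi>) f = t *\<^sub>R multiplier_L2 bbm_csymbol f"
    by (simp add: multiplier_multiplier_L2[OF bounded_symbol_const bounded_symbol_bbm, symmetric]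
        multiplier_L2_const scaleC_L2_of_real)
  finally show ?thesis by simp
qed

lemma norm_multiplier_bbm_le: "norm (multiplier_L2 bbm_csymbol f) \<le> norm f"
  using norm_multiplier_L2_le[OF bounded_symbol_bbm, of 1 f] by (simp add: abs_bbm_symbol_le)

lemma norm_multiplier_bbm_group:
  "norm (multiplier_L2 bbm_csymbol (bbm_group t f)) = norm (multiplier_L2 bbm_csymbol f)"
proof -
  have "multiplier_L2 bbm_csymbol (bbm_group t f) = bbm_group t (multiplier_L2 bbm_csymbol f)"
    unfolding bbm_group_def
    by (rule multiplier_L2_commute[OF bounded_symbol_bbm bounded_symbol_phase])
  then show ?thesis by simp
qed

section \<open>The integral equation as a real bilinear problem\<close>

definition bbm_real_group :: "real \<Rightarrow> real L2 \<Rightarrow> real L2" where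
  "bbm_real_group t f = Re_L2 (bbm_group t (complex_L2 f))"

text \<open>The polarised nonlinearity. The constant of the Duhamel term is included, so that the
  equation reads \<open>u = S u0\<close> plus the integral of \<open>S\<close> applied to
  \<open>bbm_bilinear u u\<close>, without complex factors.\<close>

definition bbm_bilinear :: "real L2 \<Rightarrow> real L2 \<Rightarrow> real L2" where
  "bbm_bilinear u v = Re_L2 (scaleC_L2 (- \<i> / 2)
     (multiplier_L1 bbm_csymbol (\<lambda>x. complex_of_real (rep_L2 u x * rep_L2 v x))))"

lemma complex_bbm_real_group: "complex_L2 (bbm_real_group t f) = bbm_group t (complex_L2 f)"
  unfolding bbm_real_group_def by (rule complex_Re_L2) (simp flip: bbm_group_cnj)

lemma complex_bbm_bilinear:
  "complex_L2 (bbm_bilinear u v) = scaleC_L2 (- \<i> / 2)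
     (multiplier_L1 bbm_csymbol (\<lambda>x. complex_of_real (rep_L2 u x * rep_L2 v x)))"
  unfolding bbm_bilinear_def
proof (rule complex_Re_L2)
  have "cnj_L2 (multiplier_L1 bbm_csymbol (\<lambda>x. complex_of_real (rep_L2 u x * rep_L2 v x)))
      = - multiplier_L1 bbm_csymbol (\<lambda>x. complex_of_real (rep_L2 u x * rep_L2 v x))"
    by (rule multiplier_L1_cnj[OF square_integrable_bbm]) (auto simp: bbm_symbol_minus)
  then show "cnj_L2 (scaleC_L2 (- \<i> / 2)
        (multiplier_L1 bbm_csymbol (\<lambda>x. complex_of_real (rep_L2 u x * rep_L2 v x))))
      = scaleC_L2 (- \<i> / 2) (multiplier_L1 bbm_csymbol (\<lambda>x. complex_of_real (rep_L2 u x * rep_L2 v x)))"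
    by (simp only: cnj_scaleC_L2 scaleC_L2_minus) simp
qed

lemma complex_bbm_bilinear_nonlinearity:
  "complex_L2 (bbm_bilinear u u) = scaleC_L2 (- \<i> / 2) (bbm_nonlinearity u)"
  by (simp add: complex_bbm_bilinear bbm_nonlinearity_def power2_eq_square)

lemma norm_bbm_real_group [simp]: "norm (bbm_real_group t f) = norm f"
  by (metis norm_complex_L2 complex_bbm_real_group norm_bbm_group)

lemma bounded_linear_bbm_real_group: "bounded_linear (bbm_real_group t)"
  unfolding bbm_real_group_def
  by (intro bounded_linear_compose[OF bounded_linear_Re_L2]
      bounded_linear_compose[OF bounded_linear_bbm_group] bounded_linear_complex_L2)

lemma bbm_real_group_add: "bbm_real_group (s + t) f = bbm_real_group s (bbm_real_group t f)"
  by (subst complex_L2_eq_iff[symmetric]) (simp only: complex_bbm_real_group bbm_group_add)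

lemma bbm_real_group_0 [simp]: "bbm_real_group 0 f = f"
  by (subst complex_L2_eq_iff[symmetric]) (simp only: complex_bbm_real_group bbm_group_0)

lemma norm_bbm_real_group_diff_le:
  "norm (bbm_real_group t f - f) \<le> \<bar>t\<bar> * norm (multiplier_L2 bbm_csymbol (complex_L2 f))"
  using norm_bbm_group_diff_le[of t "complex_L2 f"]
  by (simp flip: norm_complex_L2 add: complex_L2_diff complex_bbm_real_group)

lemma integrable_rep_L2_mult: "integrable lborel (\<lambda>x. rep_L2 u x * rep_L2 v x :: real)"
  using square_integrable_inner[OF rep_L2[of u] rep_L2[of v]] by simp

lemma bbm_bilinear_commute: "bbm_bilinear u v = bbm_bilinear v u"
  by (simp add: bbm_bilinear_def mult.commute)

lemma bbm_bilinear_add_left: "bbm_bilinear (u + u') v = bbm_bilinear u v + bbm_bilinear u' v"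
proof -
  interpret R: bounded_linear "\<lambda>f. Re_L2 (scaleC_L2 (- \<i> / 2) f)"
    by (rule bounded_linear_compose[OF bounded_linear_Re_L2 bounded_linear_scaleC_L2])
  have "multiplier_L1 bbm_csymbol (\<lambda>x. complex_of_real (rep_L2 (u + u') x * rep_L2 v x))
      = multiplier_L1 bbm_csymbol (\<lambda>x. complex_of_real (rep_L2 u x * rep_L2 v x)
          + complex_of_real (rep_L2 u' x * rep_L2 v x))"
    by (rule multiplier_L1_cong_AE)
      (use rep_L2_add[of u u'] in \<open>auto simp: distrib_right elim: eventually_mono\<close>)
  also have "\<dots> = multiplier_L1 bbm_csymbol (\<lambda>x. complex_of_real (rep_L2 u x * rep_L2 v x))
      + multiplier_L1 bbm_csymbol (\<lambda>x. complex_of_real (rep_L2 u' x * rep_L2 v x))"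
    by (intro multiplier_L1_add square_integrable_bbm integrable_of_real integrable_rep_L2_mult)
  finally show ?thesis
    by (simp only: bbm_bilinear_def R.add)
qed

lemma bbm_bilinear_scaleR_left: "bbm_bilinear (r *\<^sub>R u) v = r *\<^sub>R bbm_bilinear u v"
proof -
  interpret R: bounded_linear "\<lambda>f. Re_L2 (scaleC_L2 (- \<i> / 2) f)"
    by (rule bounded_linear_compose[OF bounded_linear_Re_L2 bounded_linear_scaleC_L2])
  have "multiplier_L1 bbm_csymbol (\<lambda>x. complex_of_real (rep_L2 (r *\<^sub>R u) x * rep_L2 v x))
      = multiplier_L1 bbm_csymbol (\<lambda>x. complex_of_real r * complex_of_real (rep_L2 u x * rep_L2 v x))"
    by (rule multiplier_L1_cong_AE)
      (use rep_L2_scaleR[of r u] in \<open>auto elim: eventually_mono\<close>)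
  also have "\<dots> = r *\<^sub>R multiplier_L1 bbm_csymbol (\<lambda>x. complex_of_real (rep_L2 u x * rep_L2 v x))"
    by (subst multiplier_L1_cmult) (auto simp: square_integrable_bbm scaleC_L2_of_real)
  finally show ?thesis
    by (simp only: bbm_bilinear_def R.scaleR)
qed

text \<open>Cauchy-Schwarz bounds the L1 norm of the product, hence the supremum of its transform,
  and the symbol supplies the square integrability.\<close>

lemma norm_bbm_bilinear_le: "norm (bbm_bilinear u v) \<le> norm u * norm v * norm (abs_L2 bbm_csymbol)"
proof -
  have a: "square_integrable (\<lambda>x. \<bar>rep_L2 w x\<bar>)" for w :: "real L2"
    by (rule square_integrable_bound[OF rep_L2[of w]]) auto
  have na: "norm (abs_L2 (\<lambda>x. \<bar>rep_L2 w x\<bar>)) = norm w" for w :: "real L2"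
  proof -
    have "(norm (abs_L2 (\<lambda>x. \<bar>rep_L2 w x\<bar>)))\<^sup>2 = (norm w)\<^sup>2"
      by (simp add: norm_abs_L2[OF a] norm_rep_L2[of w])
    then show ?thesis by simp
  qed
  have "(LINT x|lborel. norm (complex_of_real (rep_L2 u x * rep_L2 v x)))
      = abs_L2 (\<lambda>x. \<bar>rep_L2 u x\<bar>) \<bullet> abs_L2 (\<lambda>x. \<bar>rep_L2 v x\<bar>)"
    by (simp add: inner_abs_L2 a norm_mult)
  also have "\<dots> \<le> norm u * norm v"
    using norm_cauchy_schwarz[of "abs_L2 (\<lambda>x. \<bar>rep_L2 u x\<bar>)" "abs_L2 (\<lambda>x. \<bar>rep_L2 v x\<bar>)"] by (simp add: na)
  finally have L1: "(LINT x|lborel. norm (complex_of_real (rep_L2 u x * rep_L2 v x))) \<le> norm u * norm v" .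
  \<comment> \<open>The factor 1/2 and the Fourier normalisation are estimated crudely by 1, so that
    the L2 norm of the symbol alone is the bilinear constant.\<close>
  have "1 / 2 * (1 / y) \<le> 1" if "1 \<le> y" for y :: real
    using that by (simp add: divide_le_eq)
  moreover have "1 \<le> sqrt (2 * pi)"
    using pi_ge_two by (intro real_le_rsqrt) simp
  ultimately have c: "1 / 2 * (1 / sqrt (2 * pi)) \<le> 1" .
  have "norm (bbm_bilinear u v) = 1 / 2 * norm (multiplier_L1 bbm_csymbol (\<lambda>x. complex_of_real (rep_L2 u x * rep_L2 v x)))"
    by (simp add: complex_bbm_bilinear norm_divide flip: norm_complex_L2)
  also have "\<dots> \<le> 1 / 2 * (1 / sqrt (2 * pi) *
      (LINT x|lborel. norm (complex_of_real (rep_L2 u x * rep_L2 v x))) * norm (abs_L2 bbm_csymbol))"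
    by (intro mult_left_mono norm_multiplier_L1_le square_integrable_bbm) auto
  also have "\<dots> \<le> 1 / 2 * (1 / sqrt (2 * pi) * (norm u * norm v) * norm (abs_L2 bbm_csymbol))"
    by (intro mult_left_mono mult_right_mono L1) auto
  also have "\<dots> = 1 / 2 * (1 / sqrt (2 * pi)) * (norm u * norm v * norm (abs_L2 bbm_csymbol))"
    by simp
  also have "\<dots> \<le> 1 * (norm u * norm v * norm (abs_L2 bbm_csymbol))"
    by (intro mult_right_mono c) auto
  finally show ?thesis by simp
qed

lemma bounded_bilinear_bbm: "bounded_bilinear bbm_bilinear"
proof
  show "bbm_bilinear (u + u') v = bbm_bilinear u v + bbm_bilinear u' v" for u u' v
    by (rule bbm_bilinear_add_left)
  show "bbm_bilinear u (v + v') = bbm_bilinear u v + bbm_bilinear u v'" for u v v'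
    by (simp add: bbm_bilinear_commute[of u] bbm_bilinear_add_left)
  show "bbm_bilinear (r *\<^sub>R u) v = r *\<^sub>R bbm_bilinear u v" for r u v
    by (rule bbm_bilinear_scaleR_left)
  show "bbm_bilinear u (r *\<^sub>R v) = r *\<^sub>R bbm_bilinear u v" for r u v
    by (simp add: bbm_bilinear_commute[of u] bbm_bilinear_scaleR_left)
  show "\<exists>K. \<forall>u v. norm (bbm_bilinear u v) \<le> norm u * norm v * K"
    using norm_bbm_bilinear_le by blast
qed

text \<open>Multiplication by \<open>- \<i> / 2\<close> and by \<open>2 * \<i>\<close> are inverse
  to each other, so one bounded linear map carries the complex integral to the real one and another
  carries it back.\<close>

lemma bbm_solution_iff:
  "bbm_solution T u0 u \<longleftrightarrow> continuous_on {0..T} u \<and>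
     (\<forall>t\<in>{0..T}. ((\<lambda>t'. bbm_real_group (t - t') (bbm_bilinear (u t') (u t')))
        has_integral (u t - bbm_real_group t u0)) {0..t})"
proof -
  have eq: "scaleC_L2 (- \<i> / 2) (bbm_group r (bbm_nonlinearity v))
      = complex_L2 (bbm_real_group r (bbm_bilinear v v))" for r v
  proof -
    have "scaleC_L2 (- \<i> / 2) (bbm_group r (bbm_nonlinearity v))
        = bbm_group r (scaleC_L2 (- \<i> / 2) (bbm_nonlinearity v))"
      unfolding bbm_group_def multiplier_L2_const[symmetric]
      by (rule multiplier_L2_commute[OF bounded_symbol_const bounded_symbol_phase])
    then show ?thesis
      by (simp add: complex_bbm_real_group complex_bbm_bilinear_nonlinearity)
  qed
  have eq': "bbm_group r (bbm_nonlinearity v)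
      = scaleC_L2 (2 * \<i>) (complex_L2 (bbm_real_group r (bbm_bilinear v v)))" for r v
    by (simp flip: eq)
  have "(\<exists>I. ((\<lambda>t'. bbm_group (t - t') (bbm_nonlinearity (u t'))) has_integral I) {0..t} \<and>
          complex_L2 (u t) = bbm_group t (complex_L2 u0) - scaleC_L2 (\<i> / 2) I) \<longleftrightarrow>
        ((\<lambda>t'. bbm_real_group (t - t') (bbm_bilinear (u t') (u t')))
          has_integral (u t - bbm_real_group t u0)) {0..t}" (is "?L \<longleftrightarrow> ?R") for t
  proof
    assume ?L
    then obtain I where I: "((\<lambda>t'. bbm_group (t - t') (bbm_nonlinearity (u t'))) has_integral I) {0..t}"
      "complex_L2 (u t) = bbm_group t (complex_L2 u0) - scaleC_L2 (\<i> / 2) I"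
      by blast
    have bl: "bounded_linear (\<lambda>f. Re_L2 (scaleC_L2 (- \<i> / 2) f))"
      by (rule bounded_linear_compose[OF bounded_linear_Re_L2 bounded_linear_scaleC_L2])
    have "complex_L2 (u t - bbm_real_group t u0) = scaleC_L2 (- \<i> / 2) I"
    proof -
      have "scaleC_L2 (- \<i> / 2) I = - scaleC_L2 (\<i> / 2) I"
        using scaleC_L2_minus[of "\<i> / 2" I]
        linear_neg[OF bounded_linear.linear[OF bounded_linear_scaleC_L2], of "\<i> / 2" I] by simp
      then show ?thesis
        using I(2) by (simp add: complex_L2_diff complex_bbm_real_group)
    qed
    then have "Re_L2 (scaleC_L2 (- \<i> / 2) I) = u t - bbm_real_group t u0"
      by (metis Re_complex_L2)
    then show ?R
      using has_integral_linear[OF I(1) bl] by (simp only: comp_def eq Re_complex_L2)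
  next
    assume R: ?R
    have bl: "bounded_linear (\<lambda>f. scaleC_L2 (2 * \<i>) (complex_L2 f))"
      by (rule bounded_linear_compose[OF bounded_linear_scaleC_L2 bounded_linear_complex_L2])
    show ?L
      using has_integral_linear[OF R bl]
      by (intro exI[of _ "scaleC_L2 (2 * \<i>) (complex_L2 (u t - bbm_real_group t u0))"])
        (auto simp: comp_def eq' complex_L2_diff complex_bbm_real_group
          scaleC_L2_of_real[of "- 1", simplified])
  qed
  then show ?thesis
    by (simp add: bbm_solution_def)
qed

section \<open>Duhamel equations with a bilinear nonlinearity\<close>

text \<open>The derivative of \<open>W\<close> is nonpositive by \<open>le\<close>, and
  \<open>W 0 = 0\<close>; so the integral of \<open>w\<close> is nonpositive, and by
  \<open>le\<close> again so is \<open>w\<close>.\<close>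

lemma gronwall_zero:
  fixes w :: "real \<Rightarrow> real"
  assumes cont: "continuous_on {0..T} w" and nonneg: "\<And>t. t \<in> {0..T} \<Longrightarrow> 0 \<le> w t"
    and le: "\<And>t. t \<in> {0..T} \<Longrightarrow> w t \<le> K * integral {0..t} w"
    and t: "t \<in> {0..T}" and "0 \<le> K"
  shows "w t = 0"
proof -
  define W where "W t = exp (- K * t) * integral {0..t} w" for t
  have deriv: "(W has_real_derivative exp (- K * r) * (w r - K * integral {0..r} w)) (at r within {0..T})"
    if "r \<in> {0..T}" for r
  proof -
    have "((\<lambda>t. integral {0..t} w) has_real_derivative w r) (at r within {0..T})"
      by (rule integral_has_real_derivative[OF cont that])
    then show ?thesis
      unfolding W_def by (auto intro!: derivative_eq_intros simp: algebra_simps)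
  qed
  have "W t \<le> W 0"
  proof (rule DERIV_nonpos_imp_decreasing_open[where f = W])
    show "\<exists>y. DERIV W r :> y \<and> y \<le> 0" if "0 < r" "r < t" for r
    proof (intro exI conjI)
      have "r \<in> {0..T}" using that t by auto
      then show "exp (- K * r) * (w r - K * integral {0..r} w) \<le> 0"
        using le by (intro mult_nonneg_nonpos) auto
      show "DERIV W r :> exp (- K * r) * (w r - K * integral {0..r} w)"
        using deriv[OF \<open>r \<in> {0..T}\<close>] that t by (simp add: at_within_Icc_at)
    qed
    have "continuous_on {0..T} W"
      using deriv by (rule DERIV_continuous_on)
    then show "continuous_on {0..t} W"
      by (rule continuous_on_subset) (use t in auto)
  qed (use t in auto)
  then have "integral {0..t} w \<le> 0"
    by (simp add: W_def mult_le_0_iff)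
  then have "w t \<le> 0"
    using le[OF t] \<open>0 \<le> K\<close> by (meson mult_nonneg_nonpos order_trans)
  then show ?thesis
    using nonneg[OF t] by simp
qed

text \<open>The abstract frame of the quadratic expansion. The Lipschitz bound in \<open>t\<close>
  expresses that the generator, here \<open>\<phi>(D)\<close>, is a bounded operator; it makes all
  Duhamel integrands norm continuous.\<close>

locale duhamel =
  fixes S :: "real \<Rightarrow> 'a::banach \<Rightarrow> 'a" and B :: "'a \<Rightarrow> 'a \<Rightarrow> 'a" and M :: real
  assumes bounded_linear_S: "bounded_linear (S t)"
    and norm_S [simp]: "norm (S t f) = norm f"
    and S_add: "S (s + t) f = S s (S t f)"
    and S_0 [simp]: "S 0 f = f"
    and norm_S_diff_le: "norm (S t f - f) \<le> \<bar>t\<bar> * norm f"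
    and bounded_bilinear_B: "bounded_bilinear B"
    and norm_B_le: "norm (B u v) \<le> M * norm u * norm v"
    and M_nonneg: "0 \<le> M"
begin

interpretation B: bounded_bilinear B
  by (rule bounded_bilinear_B)

lemma S_diff: "S t (f - g) = S t f - S t g"
  by (rule linear_diff[OF bounded_linear.linear[OF bounded_linear_S]])

lemma S_scaleR: "S t (r *\<^sub>R f) = r *\<^sub>R S t f"
  by (rule linear_cmul[OF bounded_linear.linear[OF bounded_linear_S]])

text \<open>Split the difference into \<open>S s (u - v)\<close> and
  \<open>S t (S (s - t) v - v)\<close>.\<close>

lemma norm_S_diff2_le: "norm (S s u - S t v) \<le> norm (u - v) + \<bar>s - t\<bar> * norm v"
proof -
  have "S s u - S t v = S s (u - v) + S t (S (s - t) v - v)"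
    using S_add[of t "s - t" v] by (simp add: S_diff)
  also have "norm \<dots> \<le> norm (u - v) + norm (S (s - t) v - v)"
    by (rule order_trans[OF norm_triangle_ineq]) simp
  finally show ?thesis
    using norm_S_diff_le[of "s - t" v] by simp
qed

lemma continuous_on_S:
  assumes "continuous_on A \<tau>" "continuous_on A v"
  shows "continuous_on A (\<lambda>x. S (\<tau> x) (v x))"
  unfolding continuous_on_def
proof
  fix x assume x: "x \<in> A"
  have \<tau>: "(\<tau> \<longlongrightarrow> \<tau> x) (at x within A)" and v: "(v \<longlongrightarrow> v x) (at x within A)"
    using assms x by (auto simp: continuous_on_def)
  have "((\<lambda>y. norm (v y - v x) + \<bar>\<tau> y - \<tau> x\<bar> * norm (v x)) \<longlongrightarrow> norm (v x - v x) + \<bar>\<tau> x - \<tau> x\<bar> * norm (v x)) (at x within A)"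
    by (intro tendsto_intros \<tau> v)
  then have "((\<lambda>y. norm (v y - v x) + \<bar>\<tau> y - \<tau> x\<bar> * norm (v x)) \<longlongrightarrow> 0) (at x within A)"
    by simp
  then have "((\<lambda>y. S (\<tau> y) (v y) - S (\<tau> x) (v x)) \<longlongrightarrow> 0) (at x within A)"
    by (rule Lim_null_comparison[OF always_eventually[rule_format, OF norm_S_diff2_le]])
  then show "((\<lambda>y. S (\<tau> y) (v y)) \<longlongrightarrow> S (\<tau> x) (v x)) (at x within A)"
    by (simp add: LIM_zero_iff)
qed

definition D :: "(real \<Rightarrow> 'a) \<Rightarrow> real \<Rightarrow> 'a" where
  "D v t = integral {0..t} (\<lambda>t'. S (t - t') (v t'))"

lemma continuous_on_integrand:
  "continuous_on {0..t} v \<Longrightarrow> continuous_on {0..t} (\<lambda>t'. S (t - t') (v t'))"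
  by (intro continuous_on_S continuous_intros)

lemma D_has_integral:
  "continuous_on {0..t} v \<Longrightarrow> ((\<lambda>t'. S (t - t') (v t')) has_integral D v t) {0..t}"
  unfolding D_def by (intro integrable_integral integrable_continuous_interval continuous_on_integrand)

lemma D_diff:
  assumes "continuous_on {0..t} v" "continuous_on {0..t} w"
  shows "D (\<lambda>s. v s - w s) t = D v t - D w t"
proof -
  have "((\<lambda>t'. S (t - t') (v t') - S (t - t') (w t')) has_integral (D v t - D w t)) {0..t}"
    by (intro has_integral_diff D_has_integral assms)
  then show ?thesis
    unfolding D_def[of "\<lambda>s. v s - w s"] S_diff by (rule integral_unique)
qed

lemma norm_D_le:
  assumes "0 \<le> t" "continuous_on {0..t} v" "\<And>s. s \<in> {0..t} \<Longrightarrow> norm (v s) \<le> b"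
  shows "norm (D v t) \<le> b * t"
  unfolding D_def using integral_bound[OF assms(1) continuous_on_integrand[OF assms(2)], of b] assms(3)
  by simp

text \<open>The variable \<open>t\<close> occurs both as the endpoint and in the integrand. The
  group law with negative times factors \<open>S t\<close> out and leaves an indefinite
  integral.\<close>

lemma continuous_on_D:
  assumes v: "continuous_on {0..T} v"
  shows "continuous_on {0..T} (D v)"
proof -
  have "D v t = S t (integral {0..t} (\<lambda>t'. S (- t') (v t')))" if "t \<in> {0..T}" for t
  proof -
    have "(\<lambda>t'. S (- t') (v t')) integrable_on {0..t}"
      by (intro integrable_continuous_interval continuous_on_S continuous_intros
          continuous_on_subset[OF v]) (use that in auto)
    from integral_linear[OF this bounded_linear_S[of t]]
    show ?thesis
      by (simp add: D_def comp_def flip: S_add)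
  qed
  moreover have "continuous_on {0..T} (\<lambda>t. S t (integral {0..t} (\<lambda>t'. S (- t') (v t'))))"
    by (intro continuous_on_S continuous_intros indefinite_integral_continuous_1
        integrable_continuous_interval v)
  ultimately show ?thesis
    by (metis (no_types, lifting) continuous_on_eq)
qed

section \<open>Uniqueness and local existence of solutions\<close>

definition sol :: "real \<Rightarrow> 'a \<Rightarrow> (real \<Rightarrow> 'a) \<Rightarrow> bool" where
  "sol T u0 u \<longleftrightarrow> continuous_on {0..T} u \<and>
    (\<forall>t\<in>{0..T}. ((\<lambda>t'. S (t - t') (B (u t') (u t'))) has_integral (u t - S t u0)) {0..t})"

text \<open>Continuity of \<open>u\<close> guarantees that the integral exists, so the
  \<open>has_integral\<close> form becomes a fixed point equation.\<close>

lemma sol_iff: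
  "sol T u0 u \<longleftrightarrow> continuous_on {0..T} u \<and>
    (\<forall>t\<in>{0..T}. u t = S t u0 + D (\<lambda>s. B (u s) (u s)) t)"
proof (cases "continuous_on {0..T} u")
  case True
  have "((\<lambda>t'. S (t - t') (B (u t') (u t'))) has_integral (u t - S t u0)) {0..t} \<longleftrightarrow>
      u t = S t u0 + D (\<lambda>s. B (u s) (u s)) t" if "t \<in> {0..T}" for t
  proof -
    have "continuous_on {0..t} (\<lambda>s. B (u s) (u s))"
      by (intro B.continuous_on continuous_on_subset[OF True]) (use that in auto)
    note I = D_has_integral[OF this]
    have "((\<lambda>t'. S (t - t') (B (u t') (u t'))) has_integral (u t - S t u0)) {0..t} \<longleftrightarrow>
        u t - S t u0 = D (\<lambda>s. B (u s) (u s)) t"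
      using has_integral_unique[OF _ I] I by metis
    then show ?thesis
      by (simp add: diff_eq_eq add.commute)
  qed
  with True show ?thesis
    by (simp add: sol_def)
qed (simp add: sol_def)

lemma norm_B_diff_le: "norm (B u u - B v v) \<le> M * norm (u - v) * (norm u + norm v)"
proof -
  have "B u u - B v v = B (u - v) u + B v (u - v)"
    by (simp add: B.diff_left B.diff_right)
  also have "norm \<dots> \<le> M * norm (u - v) * norm u + M * norm v * norm (u - v)"
    by (intro order_trans[OF norm_triangle_ineq] add_mono norm_B_le)
  finally show ?thesis
    by (simp add: algebra_simps)
qed

text \<open>Gronwall for the norm of the difference: on a compact interval both solutions are
  bounded, so the quadratic term is Lipschitz there with constant \<open>M * R\<close>.\<close>

lemma sol_unique:
  assumes u: "sol T u0 u" and v: "sol T u0 v" and t: "t \<in> {0..T}"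
  shows "u t = v t"
proof -
  have cu: "continuous_on {0..T} u" and cv: "continuous_on {0..T} v"
    using u v by (auto simp: sol_def)
  have "compact ((\<lambda>t. norm (u t) + norm (v t)) ` {0..T})"
    by (intro compact_continuous_image continuous_intros cu cv) auto
  then have "bdd_above ((\<lambda>t. norm (u t) + norm (v t)) ` {0..T})"
    by (intro bounded_imp_bdd_above compact_imp_bounded)
  then obtain R where "\<forall>s\<in>{0..T}. norm (u s) + norm (v s) \<le> R"
    unfolding bdd_above_def by blast
  then have R: "norm (u s) + norm (v s) \<le> R" if "s \<in> {0..T}" for s
    using that by blast
  have "0 \<le> R"
    using R[OF t] by (meson add_nonneg_nonneg norm_ge_zero order_trans)
  have "norm (u t - v t) = 0"
  proof (rule gronwall_zero[where w = "\<lambda>t. norm (u t - v t)" and K = "M * R", OF _ _ _ t])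
    show "continuous_on {0..T} (\<lambda>t. norm (u t - v t))"
      by (intro continuous_intros cu cv)
    show "0 \<le> M * R"
      using M_nonneg \<open>0 \<le> R\<close> by simp
    fix r assume r: "r \<in> {0..T}"
    have cu': "continuous_on {0..r} u" and cv': "continuous_on {0..r} v"
      using r by (auto intro: continuous_on_subset[OF cu] continuous_on_subset[OF cv])
    have cBu: "continuous_on {0..r} (\<lambda>s. B (u s) (u s))" and cBv: "continuous_on {0..r} (\<lambda>s. B (v s) (v s))"
      by (intro B.continuous_on cu' cv')+
    have "u r - v r = D (\<lambda>s. B (u s) (u s) - B (v s) (v s)) r"
      using u v r D_diff[OF cBu cBv] by (simp add: sol_iff)
    also have "norm \<dots> \<le> integral {0..r} (\<lambda>s. M * R * norm (u s - v s))"
      unfolding D_def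
    proof (rule integral_norm_bound_integral)
      show "(\<lambda>t'. S (r - t') (B (u t') (u t') - B (v t') (v t'))) integrable_on {0..r}"
        by (intro integrable_continuous_interval continuous_on_integrand continuous_intros cBu cBv)
      show "(\<lambda>s. M * R * norm (u s - v s)) integrable_on {0..r}"
        by (intro integrable_continuous_interval continuous_intros cu' cv')
      fix s assume "s \<in> {0..r}"
      then have "s \<in> {0..T}" using r by auto
      have "norm (B (u s) (u s) - B (v s) (v s)) \<le> M * norm (u s - v s) * (norm (u s) + norm (v s))"
        by (rule norm_B_diff_le)
      also have "\<dots> \<le> M * norm (u s - v s) * R"
        by (intro mult_left_mono R \<open>s \<in> {0..T}\<close> mult_nonneg_nonneg M_nonneg norm_ge_zero)
      finally show "norm (S (r - s) (B (u s) (u s) - B (v s) (v s))) \<le> M * R * norm (u s - v s)"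
        by (simp add: mult_ac)
    qed
    finally show "norm (u r - v r) \<le> M * R * integral {0..r} (\<lambda>t. norm (u t - v t))"
      by simp
  qed auto
  then show ?thesis by simp
qed

text \<open>Contraction in the ball of radius \<open>2 * r\<close>. The smallness condition makes
  the Lipschitz constant \<open>4 * M * r * T\<close> at most 1/2, and it also bounds the Duhamel
  term by \<open>r\<close>.\<close>

lemma sol_exists:
  assumes T: "0 \<le> T" and u0: "norm u0 \<le> r" and small: "8 * M * T * r \<le> 1"
  obtains u where "sol T u0 u" "\<And>t. t \<in> {0..T} \<Longrightarrow> norm (u t) \<le> 2 * r"
proof -
  have "0 \<le> r" using u0 norm_ge_zero order_trans by blast
  \<comment> \<open>Clamping time to \<open>[0,T]\<close> turns curves on the interval into
    functions on the whole line, so that the complete type of bounded continuous functions serves as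
    solution space.\<close>
  define c where "c t = max 0 (min T t)" for t :: real
  have c: "c t \<in> {0..T}" and c_id: "t \<in> {0..T} \<Longrightarrow> c t = t" for t
    using T by (auto simp: c_def)
  have c_cont: "continuous_on UNIV c"
    unfolding c_def by (intro continuous_intros)
  define G where "G u t = S (c t) u0 + D (\<lambda>s. B (u s) (u s)) (c t)" for u t
  let ?K = "PiC UNIV (\<lambda>_. cball 0 (2 * r)) :: (real \<Rightarrow>\<^sub>C 'a) set"
  have K: "x \<in> ?K \<longleftrightarrow> (\<forall>t. norm (apply_bcontfun x t) \<le> 2 * r)" for x
    by (auto simp: mem_PiC_iff)
  have cB: "continuous_on A (\<lambda>s. B (apply_bcontfun x s) (apply_bcontfun x s))" for A x
    by (intro B.continuous_on continuous_on_apply_bcontfun)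
  have Mr: "M * (2 * r) * (2 * r) * T \<le> r"
  proof -
    have "M * (2 * r) * (2 * r) * T = (8 * M * T * r) * (r / 2)"
      by (simp add: algebra_simps)
    also have "\<dots> \<le> 1 * (r / 2)"
      using small \<open>0 \<le> r\<close> by (intro mult_right_mono) auto
    finally show ?thesis using \<open>0 \<le> r\<close> by simp
  qed
  have G_bound: "norm (G (apply_bcontfun x) t) \<le> 2 * r" if "x \<in> ?K" for x t
  proof -
    have "norm (B (apply_bcontfun x s) (apply_bcontfun x s)) \<le> M * (2 * r) * (2 * r)" for s
      using that \<open>0 \<le> r\<close> M_nonneg
      by (intro order_trans[OF norm_B_le] mult_mono mult_left_mono mult_nonneg_nonneg) (auto simp: K)
    then have "norm (D (\<lambda>s. B (apply_bcontfun x s) (apply_bcontfun x s)) (c t)) \<le> M * (2 * r) * (2 * r) * c t"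
      using c[of t] by (intro norm_D_le cB) auto
    also have "\<dots> \<le> M * (2 * r) * (2 * r) * T"
      using c[of t] M_nonneg \<open>0 \<le> r\<close> by (intro mult_left_mono) auto
    finally show ?thesis
      unfolding G_def by (intro norm_triangle_le) (use Mr u0 in simp)
  qed
  have G_cont: "continuous_on UNIV (G (apply_bcontfun x))" for x
  proof -
    have "continuous_on {0..T} (\<lambda>t. S t u0 + D (\<lambda>s. B (apply_bcontfun x s) (apply_bcontfun x s)) t)"
      by (intro continuous_intros continuous_on_S continuous_on_D cB)
    then show ?thesis
      unfolding G_def by (rule continuous_on_compose2[OF _ c_cont]) (use c in auto)
  qed
  \<comment> \<open>\<open>Bcontfun\<close> returns its argument only for bounded continuous
    functions, hence \<open>\<Phi>\<close> is evaluated only on \<open>?K\<close>, where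
    \<open>G_bound\<close> applies.\<close>
  define \<Phi> where "\<Phi> x = Bcontfun (G (apply_bcontfun x))" for x
  have \<Phi>: "apply_bcontfun (\<Phi> x) = G (apply_bcontfun x)" if "x \<in> ?K" for x
    unfolding \<Phi>_def using bcontfun_normI[OF G_cont G_bound[OF that]] by (rule Bcontfun_inverse)
  have "\<exists>!x. x \<in> ?K \<and> \<Phi> x = x"
  proof (rule Banach_fix[where c = "1 / 2"])
    show "complete ?K"
      by (simp add: complete_eq_closed closed_PiC)
    show "?K \<noteq> {}"
      using \<open>0 \<le> r\<close> K[of 0] by auto
    show "\<Phi> ` ?K \<subseteq> ?K"
    proof
      fix y assume "y \<in> \<Phi> ` ?K"
      then obtain x where "x \<in> ?K" "y = \<Phi> x" by blast
      then have "apply_bcontfun y = G (apply_bcontfun x)"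
        using \<Phi> by simp
      then show "y \<in> ?K"
        unfolding K using G_bound[OF \<open>x \<in> ?K\<close>] by simp
    qed
    fix x y assume x: "x \<in> ?K" and y: "y \<in> ?K"
    show "dist (\<Phi> x) (\<Phi> y) \<le> 1 / 2 * dist x y"
    proof (rule dist_bound)
      fix t
      let ?x = "apply_bcontfun x" and ?y = "apply_bcontfun y"
      have le: "norm (B (?x s) (?x s) - B (?y s) (?y s)) \<le> M * dist x y * (4 * r)" for s
      proof -
        have "norm (?x s) \<le> 2 * r" "norm (?y s) \<le> 2 * r"
          using x y K by blast+
        then have "norm (?x s) + norm (?y s) \<le> 4 * r"
          by simp
        moreover have "norm (?x s - ?y s) \<le> dist x y"
          using dist_bounded[of x s y] by (simp add: dist_norm)
        ultimately show ?thesis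
          using M_nonneg by (intro order_trans[OF norm_B_diff_le] mult_mono mult_left_mono) auto
      qed
      have "dist (apply_bcontfun (\<Phi> x) t) (apply_bcontfun (\<Phi> y) t)
          = norm (D (\<lambda>s. B (?x s) (?x s) - B (?y s) (?y s)) (c t))"
        by (simp add: \<Phi>[OF x] \<Phi>[OF y] G_def dist_norm D_diff cB)
      also have "\<dots> \<le> M * dist x y * (4 * r) * c t"
        using c[of t] le by (intro norm_D_le continuous_intros cB) auto
      also have "\<dots> \<le> M * dist x y * (4 * r) * T"
        using c[of t] M_nonneg \<open>0 \<le> r\<close> by (intro mult_left_mono) auto
      also have "\<dots> = (8 * M * T * r) * (1 / 2 * dist x y)"
        by (simp add: algebra_simps)
      also have "\<dots> \<le> 1 * (1 / 2 * dist x y)"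
        using small by (intro mult_right_mono) auto
      finally show "dist (apply_bcontfun (\<Phi> x) t) (apply_bcontfun (\<Phi> y) t) \<le> 1 / 2 * dist x y"
        by simp
    qed
  qed auto
  then obtain x where x: "x \<in> ?K" "\<Phi> x = x"
    by blast
  then have fixed: "apply_bcontfun x = G (apply_bcontfun x)"
    using \<Phi>[OF x(1)] by simp
  have "apply_bcontfun x t = S t u0 + D (\<lambda>s. B (apply_bcontfun x s) (apply_bcontfun x s)) t"
    if "t \<in> {0..T}" for t
    using fun_cong[OF fixed, of t] unfolding G_def c_id[OF that] .
  then have "sol T u0 (apply_bcontfun x)"
    by (simp add: sol_iff)
  with x(1) show ?thesis
    by (intro that[of "apply_bcontfun x"]) (auto simp: K)
qed

section \<open>The flow and its quadratic expansion\<close>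

definition flow :: "real \<Rightarrow> 'a \<Rightarrow> 'a" where
  "flow t u0 = (THE v. \<exists>u. sol t u0 u \<and> u t = v)"

lemma flow_eq:
  assumes u: "sol t u0 u" and t: "0 \<le> t"
  shows "flow t u0 = u t"
  unfolding flow_def
proof (rule the_equality)
  show "\<exists>u'. sol t u0 u' \<and> u' t = u t"
    using u by blast
  show "v = u t" if ex: "\<exists>u'. sol t u0 u' \<and> u' t = v" for v
  proof -
    obtain u' where u': "sol t u0 u'" "u' t = v"
      using ex by blast
    show ?thesis
      using sol_unique[OF u'(1) u, of t] u'(2) t by simp
  qed
qed

lemma flow_0: "0 \<le> t \<Longrightarrow> flow t 0 = 0"
proof -
  assume t: "0 \<le> t"
  have S0: "S s 0 = 0" for s
    using S_scaleR[of s 0 0] by simp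
  then have "sol t 0 (\<lambda>s. 0)"
    by (simp add: sol_iff D_def B.zero_left)
  from flow_eq[OF this t] show ?thesis .
qed

text \<open>The term of second order in \<open>u0\<close> in the expansion of the flow: the Duhamel
  integral along the linear evolution.\<close>

definition picard2 :: "real \<Rightarrow> 'a \<Rightarrow> 'a" where
  "picard2 t u0 = D (\<lambda>s. B (S s u0) (S s u0)) t"

text \<open>The nonlinearity at the solution is compared with that at the linear evolution. The two
  arguments differ by at most \<open>4 * M * t * r^2\<close> and their norms add up to at most
  \<open>3 * r\<close>; the product with \<open>M\<close> and \<open>t\<close> gives the constant
  12.\<close>

lemma flow_expansion:
  assumes t: "0 \<le> t" and u0: "norm u0 \<le> r" and small: "8 * M * t * r \<le> 1"
  shows "norm (flow t u0 - S t u0 - picard2 t u0) \<le> 12 * M\<^sup>2 * t\<^sup>2 * r ^ 3"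
proof -
  have "0 \<le> r" using u0 norm_ge_zero order_trans by blast
  obtain u where u: "sol t u0 u" and ub: "\<And>s. s \<in> {0..t} \<Longrightarrow> norm (u s) \<le> 2 * r"
    using sol_exists[OF t u0 small] by blast
  have cu: "continuous_on {0..t} u"
    using u by (simp add: sol_def)
  have cBu: "continuous_on {0..t} (\<lambda>s. B (u s) (u s))"
    by (intro B.continuous_on cu)
  have cBS: "continuous_on {0..t} (\<lambda>s. B (S s u0) (S s u0))"
    by (intro B.continuous_on continuous_on_S continuous_intros)
  have first: "norm (u s - S s u0) \<le> 4 * M * t * r\<^sup>2" if s: "s \<in> {0..t}" for s
  proof -
    have "u s - S s u0 = D (\<lambda>s. B (u s) (u s)) s"
      using u s by (simp add: sol_iff)
    also have "norm \<dots> \<le> M * (2 * r) * (2 * r) * s"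
    proof (rule norm_D_le)
      show "continuous_on {0..s} (\<lambda>s. B (u s) (u s))"
        by (rule continuous_on_subset[OF cBu]) (use s in auto)
      show "norm (B (u s') (u s')) \<le> M * (2 * r) * (2 * r)" if "s' \<in> {0..s}" for s'
        using ub[of s'] s that \<open>0 \<le> r\<close> M_nonneg
        by (intro order_trans[OF norm_B_le] mult_mono mult_left_mono mult_nonneg_nonneg) auto
    qed (use s in auto)
    also have "\<dots> \<le> M * (2 * r) * (2 * r) * t"
      using s M_nonneg \<open>0 \<le> r\<close> by (intro mult_left_mono) auto
    finally show ?thesis
      by (simp add: power2_eq_square algebra_simps)
  qed
  have "flow t u0 - S t u0 - picard2 t u0 = D (\<lambda>s. B (u s) (u s) - B (S s u0) (S s u0)) t"
    using u t flow_eq[OF u t] by (simp add: sol_iff picard2_def D_diff[OF cBu cBS])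
  also have "norm \<dots> \<le> M * (4 * M * t * r\<^sup>2) * (3 * r) * t"
  proof (rule norm_D_le)
    show "continuous_on {0..t} (\<lambda>s. B (u s) (u s) - B (S s u0) (S s u0))"
      by (intro continuous_intros cBu cBS)
    show "norm (B (u s) (u s) - B (S s u0) (S s u0)) \<le> M * (4 * M * t * r\<^sup>2) * (3 * r)"
      if "s \<in> {0..t}" for s
      using first[OF that] ub[OF that] u0 M_nonneg t \<open>0 \<le> r\<close>
      by (intro order_trans[OF norm_B_diff_le] mult_mono mult_left_mono mult_nonneg_nonneg) auto
  qed (rule t)
  finally show ?thesis
    by (simp add: power2_eq_square power3_eq_cube algebra_simps)
qed

text \<open>Over times up to \<open>t\<close> the group moves \<open>h\<close> by at most
  \<open>t * norm h\<close>; integration gives one more factor \<open>t\<close>.\<close>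

lemma norm_D_const_le:
  assumes "0 \<le> t"
  shows "norm (D (\<lambda>s. h) t - t *\<^sub>R h) \<le> t\<^sup>2 * norm h"
proof -
  have "((\<lambda>s. S (t - s) h - h) has_integral (D (\<lambda>s. h) t - t *\<^sub>R h)) {0..t}"
    using has_integral_diff[OF D_has_integral[of t "\<lambda>s. h"] has_integral_const_real[of h 0 t]] assms
    by simp
  then have "D (\<lambda>s. h) t - t *\<^sub>R h = integral {0..t} (\<lambda>s. S (t - s) h - h)"
    by (simp add: integral_unique)
  also have "norm \<dots> \<le> t * norm h * (t - 0)"
  proof (rule integral_bound[OF assms])
    show "continuous_on {0..t} (\<lambda>s. S (t - s) h - h)"
      by (intro continuous_intros continuous_on_S)
    show "norm (S (t - s) h - h) \<le> t * norm h" if "s \<in> {0..t}" for s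
      using that by (intro order_trans[OF norm_S_diff_le] mult_right_mono) auto
  qed
  finally show ?thesis
    by (simp add: power2_eq_square mult_ac)
qed

lemma picard2_scaleR: "picard2 t (r *\<^sub>R u0) = r\<^sup>2 *\<^sub>R picard2 t u0"
  by (simp add: picard2_def D_def S_scaleR B.scaleR_left B.scaleR_right power2_eq_square)

text \<open>By \<open>near\<close> the linear evolution can be replaced by \<open>v n\<close>
  itself, uniformly for times in \<open>[0,t]\<close>, so the integrand tends uniformly to the
  constant \<open>h\<close>.\<close>

lemma picard2_tendsto:
  fixes v :: "nat \<Rightarrow> 'a"
  assumes t: "0 \<le> t" and V: "\<And>n. norm (v n) \<le> V"
    and near: "\<And>s n. norm (S s (v n) - v n) \<le> \<bar>s\<bar> * \<delta> n" and \<delta>: "\<delta> \<longlonglongrightarrow> 0"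
    and h: "(\<lambda>n. B (v n) (v n)) \<longlonglongrightarrow> h"
  shows "(\<lambda>n. picard2 t (v n)) \<longlonglongrightarrow> D (\<lambda>s. h) t"
proof -
  have \<delta>0: "0 \<le> \<delta> n" for n
    using order_trans[OF norm_ge_zero near[of 1 n]] by simp
  have V0: "0 \<le> V" using V[of 0] norm_ge_zero order_trans by blast
  define \<rho> where "\<rho> n = M * (t * \<delta> n) * (V + V) + norm (B (v n) (v n) - h)" for n
  have "norm (picard2 t (v n) - D (\<lambda>s. h) t) \<le> \<rho> n * t" for n
  proof -
    have c: "continuous_on {0..t} (\<lambda>s. B (S s (v n)) (S s (v n)))"
      by (intro B.continuous_on continuous_on_S continuous_intros)
    have "norm (D (\<lambda>s. B (S s (v n)) (S s (v n)) - h) t) \<le> \<rho> n * t"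
    proof (rule norm_D_le)
      fix s assume s: "s \<in> {0..t}"
      have "norm (B (S s (v n)) (S s (v n)) - B (v n) (v n)) \<le> M * norm (S s (v n) - v n) * (norm (S s (v n)) + norm (v n))"
        by (rule norm_B_diff_le)
      also have "\<dots> \<le> M * (t * \<delta> n) * (V + V)"
        using s near[of s n] \<delta>0[of n] V[of n] M_nonneg V0
        by (intro mult_mono mult_left_mono mult_nonneg_nonneg order_trans[OF near] mult_right_mono) auto
      finally show "norm (B (S s (v n)) (S s (v n)) - h) \<le> \<rho> n"
        unfolding \<rho>_def using norm_triangle_ineq[of "B (S s (v n)) (S s (v n)) - B (v n) (v n)" "B (v n) (v n) - h"]
        by simp
    qed (use t in \<open>auto intro!: continuous_intros c\<close>)
    then show ?thesis
      unfolding picard2_def by (simp add: D_diff[OF c])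
  qed
  then have "\<forall>\<^sub>F n in sequentially. norm (picard2 t (v n) - D (\<lambda>s. h) t) \<le> \<rho> n * t"
    by (intro always_eventually allI)
  moreover have "(\<lambda>n. \<rho> n * t) \<longlonglongrightarrow> (M * (t * 0) * (V + V) + norm (h - h)) * t"
    unfolding \<rho>_def by (intro tendsto_intros \<delta> h)
  then have "(\<lambda>n. \<rho> n * t) \<longlonglongrightarrow> 0"
    by simp
  ultimately have "(\<lambda>n. picard2 t (v n) - D (\<lambda>s. h) t) \<longlonglongrightarrow> 0"
    by (rule Lim_null_comparison)
  then show ?thesis
    by (simp add: LIM_zero_iff)
qed

text \<open>If the functional tended to 0 along the flow, letting \<open>n\<close> tend to infinity
  in the expansion would leave \<open>\<epsilon>^2 * c \<le> \<epsilon>^3 * C\<close>, with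
  \<open>c > 0\<close> and \<open>C\<close> independent of \<open>n\<close> and
  \<open>\<epsilon>\<close>. This fails for small \<open>\<epsilon>\<close>.\<close>

proposition flow_not_weakly_null:
  fixes v :: "nat \<Rightarrow> 'a" and l :: "'a \<Rightarrow> real"
  assumes lin: "bounded_linear l" and V: "\<And>n. norm (v n) \<le> V"
    and near: "\<And>s n. norm (S s (v n) - v n) \<le> \<bar>s\<bar> * \<delta> n" and \<delta>: "\<delta> \<longlonglongrightarrow> 0"
    and h: "(\<lambda>n. B (v n) (v n)) \<longlonglongrightarrow> h" and lh: "l h \<noteq> 0"
    and weak: "\<And>t. (\<lambda>n. l (S t (v n))) \<longlonglongrightarrow> 0"
  obtains T where "T > 0"
    "\<And>t. 0 < t \<Longrightarrow> t < T \<Longrightarrow> \<exists>\<epsilon>>0. \<not> (\<lambda>n. l (flow t (\<epsilon> *\<^sub>R v n))) \<longlonglongrightarrow> 0"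
proof -
  interpret lin: bounded_linear l by (rule lin)
  obtain L where L: "L > 0" "\<And>x. \<bar>l x\<bar> \<le> norm x * L"
    using lin.pos_bounded by auto
  have V0: "0 \<le> V" using V[of 0] norm_ge_zero order_trans by blast
  \<comment> \<open>Below this time the error \<open>t^2 * norm h * L\<close> is smaller than
    \<open>t * \<bar>l h\<bar>\<close>, so \<open>l\<close> does not vanish on the limit of the
    quadratic term. The summand 1 keeps the denominator positive.\<close>
  define T where "T = \<bar>l h\<bar> / (L * (norm h + 1))"
  have pos: "L * (norm h + 1) > 0"
    using L(1) by (intro mult_pos_pos add_nonneg_pos) auto
  then have "T > 0"
    using lh by (simp add: T_def)
  moreover have "\<exists>\<epsilon>>0. \<not> (\<lambda>n. l (flow t (\<epsilon> *\<^sub>R v n))) \<longlonglongrightarrow> 0" if t: "0 < t" "t < T" for t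
  proof -
    define c where "c = \<bar>l (D (\<lambda>s. h) t)\<bar>"
    have "c > 0"
    proof -
      have "\<bar>l (D (\<lambda>s. h) t) - t * l h\<bar> = \<bar>l (D (\<lambda>s. h) t - t *\<^sub>R h)\<bar>"
        by (simp add: lin.diff lin.scaleR)
      also have "\<dots> \<le> (t\<^sup>2 * norm h) * L"
        using norm_D_const_le[of t h] t L by (intro order_trans[OF L(2)] mult_right_mono) auto
      also have "\<dots> \<le> t * (t * (L * (norm h + 1)))"
        using t L(1) by (simp add: power2_eq_square algebra_simps)
      also have "\<dots> < t * \<bar>l h\<bar>"
        using t pos by (simp add: T_def pos_less_divide_eq)
      finally show ?thesis
        using t by (auto simp: c_def abs_mult)
    qed
    define C where "C = L * (12 * M\<^sup>2 * t\<^sup>2 * V ^ 3)"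
    have "0 \<le> C"
      using L V0 by (simp add: C_def)
    \<comment> \<open>The first bound makes the data small enough for existence up to time
      \<open>t\<close>; the second gives \<open>\<epsilon> * C < c\<close>. The added ones exclude
      division by zero, and the factor 1/2 serves the strict inequality.\<close>
    define \<epsilon> where "\<epsilon> = min (1 / (8 * M * t * V + 1)) (c / (C + 1) / 2)"
    have "0 \<le> 8 * M * t * V"
      using M_nonneg t V0 by simp
    then have p: "0 < 8 * M * t * V + 1"
      by linarith
    then have \<epsilon>: "\<epsilon> > 0"
      using \<open>c > 0\<close> \<open>0 \<le> C\<close> by (simp add: \<epsilon>_def)
    have "\<epsilon> \<le> 1 / (8 * M * t * V + 1)"
      by (simp add: \<epsilon>_def)
    then have "\<epsilon> * (8 * M * t * V + 1) \<le> 1"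
      using p by (simp only: pos_le_divide_eq)
    then have small: "8 * M * t * (\<epsilon> * V) \<le> 1"
      using \<epsilon> by (simp add: algebra_simps)
    have "\<epsilon> \<le> c / (C + 1) / 2"
      by (simp add: \<epsilon>_def)
    then have "\<epsilon> * (C + 1) * 2 \<le> c"
      using \<open>0 \<le> C\<close> by (simp add: field_simps)
    then have "(\<epsilon> * C) * 2 + \<epsilon> * 2 \<le> c"
      by (simp add: algebra_simps)
    moreover have "0 \<le> \<epsilon> * C"
      using \<epsilon> \<open>0 \<le> C\<close> by simp
    ultimately have "\<epsilon> * C < c"
      using \<epsilon> by linarith
    have "\<not> (\<lambda>n. l (flow t (\<epsilon> *\<^sub>R v n))) \<longlonglongrightarrow> 0"
    proof
      assume lim: "(\<lambda>n. l (flow t (\<epsilon> *\<^sub>R v n))) \<longlonglongrightarrow> 0"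
      have "\<epsilon>\<^sup>2 * \<bar>l (picard2 t (v n))\<bar>
          \<le> \<bar>l (flow t (\<epsilon> *\<^sub>R v n))\<bar> + \<epsilon> * \<bar>l (S t (v n))\<bar> + \<epsilon> ^ 3 * C" for n
      proof -
        have "norm (\<epsilon> *\<^sub>R v n) \<le> \<epsilon> * V"
          using V[of n] \<epsilon> by simp
        then have "norm (flow t (\<epsilon> *\<^sub>R v n) - S t (\<epsilon> *\<^sub>R v n) - picard2 t (\<epsilon> *\<^sub>R v n))
            \<le> 12 * M\<^sup>2 * t\<^sup>2 * (\<epsilon> * V) ^ 3"
          using t small by (intro flow_expansion) auto
        then have "\<bar>l (flow t (\<epsilon> *\<^sub>R v n) - S t (\<epsilon> *\<^sub>R v n) - picard2 t (\<epsilon> *\<^sub>R v n))\<bar>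
            \<le> 12 * M\<^sup>2 * t\<^sup>2 * (\<epsilon> * V) ^ 3 * L"
          using L by (intro order_trans[OF L(2)] mult_right_mono) auto
        also have "\<dots> = \<epsilon> ^ 3 * C"
          by (simp add: C_def power_mult_distrib)
        finally have "\<bar>l (flow t (\<epsilon> *\<^sub>R v n)) - \<epsilon> * l (S t (v n)) - \<epsilon>\<^sup>2 * l (picard2 t (v n))\<bar> \<le> \<epsilon> ^ 3 * C"
          by (simp add: lin.diff lin.scaleR S_scaleR picard2_scaleR)
        moreover have "\<bar>\<epsilon> * l (S t (v n))\<bar> = \<epsilon> * \<bar>l (S t (v n))\<bar>"
          "\<bar>\<epsilon>\<^sup>2 * l (picard2 t (v n))\<bar> = \<epsilon>\<^sup>2 * \<bar>l (picard2 t (v n))\<bar>"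
          using \<epsilon> by (simp_all add: abs_mult)
        ultimately show ?thesis
          by linarith
      qed
      moreover have "(\<lambda>n. \<epsilon>\<^sup>2 * \<bar>l (picard2 t (v n))\<bar>) \<longlonglongrightarrow> \<epsilon>\<^sup>2 * c"
        unfolding c_def using t
        by (intro tendsto_intros lin.tendsto picard2_tendsto[OF _ V near \<delta> h]) auto
      moreover have "(\<lambda>n. \<bar>l (flow t (\<epsilon> *\<^sub>R v n))\<bar> + \<epsilon> * \<bar>l (S t (v n))\<bar> + \<epsilon> ^ 3 * C)
          \<longlonglongrightarrow> \<bar>0\<bar> + \<epsilon> * \<bar>0\<bar> + \<epsilon> ^ 3 * C"
        by (intro tendsto_intros lim weak)
      ultimately have "\<epsilon>\<^sup>2 * c \<le> \<bar>0\<bar> + \<epsilon> * \<bar>0\<bar> + \<epsilon> ^ 3 * C"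
        by (intro LIMSEQ_le) auto
      then have "\<epsilon>\<^sup>2 * c \<le> \<epsilon>\<^sup>2 * (\<epsilon> * C)"
        by (simp add: power2_eq_square power3_eq_cube mult_ac)
      then show False
        using \<epsilon> \<open>\<epsilon> * C < c\<close> by simp
    qed
    with \<epsilon> show ?thesis by blast
  qed
  ultimately show ?thesis
    by (rule that)
qed

end

section \<open>Bump functions\<close>

text \<open>The exponents \<open>a\<close> and \<open>b\<close> make the span of these functions closed under
  differentiation.\<close>

definition bump :: "nat \<Rightarrow> nat \<Rightarrow> real \<Rightarrow> real" where
  "bump a b x = (if 0 < x \<and> x < 1 then exp (- 1 / x - 1 / (1 - x)) / (x ^ a * (1 - x) ^ b) else 0)"

text \<open>A single term of the exponential series is at most the whole sum.\<close>

lemma power_le_fact_exp: "0 \<le> x \<Longrightarrow> x ^ k \<le> fact k * exp (x :: real)"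
proof -
  assume x: "0 \<le> x"
  have "(\<Sum>n\<in>{k}. x ^ n /\<^sub>R fact n) \<le> (\<Sum>n. x ^ n /\<^sub>R fact n)"
    by (rule sum_le_suminf) (use x summable_exp_generic[of x] in auto)
  then show ?thesis
    by (simp add: exp_def divide_simps mult.commute)
qed

lemma exp_minus_inverse_le: "0 < x \<Longrightarrow> exp (- 1 / x) \<le> fact k * (x :: real) ^ k"
  using power_le_fact_exp[of "1 / x" k] by (simp add: exp_minus field_simps)

lemma bump_nonneg: "0 \<le> bump a b x"
  by (simp add: bump_def)

text \<open>The powers \<open>k\<close> and \<open>l\<close> are free, so they can be taken large
  enough to absorb the denominator and to leave a square at either endpoint.\<close>

lemma bump_le:
  assumes "0 < x" "x < 1"
  shows "bump a b x \<le> (fact k * x ^ k / x ^ a) * (fact l * (1 - x) ^ l / (1 - x) ^ b)"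
proof -
  have "exp (- 1 / x - 1 / (1 - x)) = exp (- 1 / x) * exp (- 1 / (1 - x))"
    by (simp flip: exp_add)
  then have "bump a b x = (exp (- 1 / x) / x ^ a) * (exp (- 1 / (1 - x)) / (1 - x) ^ b)"
    using assms by (simp add: bump_def)
  also have "\<dots> \<le> (fact k * x ^ k / x ^ a) * (fact l * (1 - x) ^ l / (1 - x) ^ b)"
    using assms by (intro mult_mono divide_right_mono exp_minus_inverse_le) auto
  finally show ?thesis .
qed

lemma bump_le_0: "\<bar>bump a b x\<bar> \<le> fact (a + 2) * fact b * x\<^sup>2"
proof (cases "0 < x \<and> x < 1")
  case True
  then show ?thesis
    using bump_le[of x a b "a + 2" b] by (simp add: bump_nonneg power_add power2_eq_square mult_ac)
qed (auto simp: bump_def)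

lemma bump_le_1: "\<bar>bump a b x\<bar> \<le> fact a * fact (b + 2) * (x - 1)\<^sup>2"
proof (cases "0 < x \<and> x < 1")
  case True
  then show ?thesis
    using bump_le[of x a b a "b + 2"] by (simp add: bump_nonneg power_add power2_commute[of x 1] power2_eq_square[of "1 - x"] mult_ac)
qed (auto simp: bump_def)

text \<open>For the points 0 and 1, where the case distinction in \<open>bump\<close> changes and
  the formula cannot be differentiated.\<close>

lemma DERIV_0_of_quadratic_bound:
  fixes f :: "real \<Rightarrow> real"
  assumes le: "\<And>x. \<bar>f x\<bar> \<le> C * (x - y)\<^sup>2"
  shows "(f has_real_derivative 0) (at y)"
proof -
  have fy: "f y = 0"
    using le[of y] by simp
  have "((\<lambda>x. C * \<bar>x - y\<bar>) \<longlongrightarrow> C * \<bar>y - y\<bar>) (at y)"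
    by (intro tendsto_intros)
  then have lim: "((\<lambda>x. C * \<bar>x - y\<bar>) \<longlongrightarrow> 0) (at y)"
    by simp
  have "((\<lambda>x. (f x - f y) / (x - y)) \<longlongrightarrow> 0) (at y)"
  proof (rule Lim_null_comparison[OF _ lim])
    have "norm ((f x - f y) / (x - y)) \<le> C * \<bar>x - y\<bar>" if "x \<noteq> y" for x
      using le[of x] that by (simp add: fy divide_le_eq power2_eq_square abs_mult_self_eq mult.assoc)
    then show "\<forall>\<^sub>F x in at y. norm ((f x - f y) / (x - y)) \<le> C * \<bar>x - y\<bar>"
      by (auto simp: eventually_at_filter)
  qed
  then show ?thesis
    by (simp add: has_field_derivative_iff)
qed

text \<open>Inside the interval the logarithmic derivative is
  \<open>1/x^2 - 1/(1-x)^2 - a/x + b/(1-x)\<close>, and each of its terms only raises one of the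
  exponents. At the endpoints both sides are 0 by the quadratic bounds.\<close>

lemma bump_deriv:
  "(bump a b has_real_derivative
     bump (a + 2) b x - bump a (b + 2) x - real a * bump (a + 1) b x + real b * bump a (b + 1) x) (at x)"
proof -
  consider "x < 0" | "x = 0" | "0 < x \<and> x < 1" | "x = 1" | "1 < x"
    by linarith
  then show ?thesis
  proof cases
    case 1
    have "((\<lambda>x. 0) has_real_derivative 0) (at x)"
      by simp
    moreover have "\<forall>\<^sub>F y in nhds x. bump a b y = 0"
      using eventually_nhds_in_open[of "{..<0}" x] 1 by (auto elim!: eventually_mono simp: bump_def)
    ultimately have "(bump a b has_real_derivative 0) (at x)"
      by (subst DERIV_cong_ev[OF refl _ refl]) auto
    then show ?thesis
      using 1 by (simp add: bump_def)
  next
    case 2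
    then show ?thesis
      using DERIV_0_of_quadratic_bound[of "bump a b" "fact (a + 2) * fact b" 0] bump_le_0
      by (simp add: bump_def)
  next
    case 3
    have "((\<lambda>x. exp (- 1 / x - 1 / (1 - x)) / (x ^ a * (1 - x) ^ b)) has_real_derivative
      bump (a + 2) b x - bump a (b + 2) x - real a * bump (a + 1) b x + real b * bump a (b + 1) x) (at x)"
    proof -
      define E where "E = exp (- 1 / x - 1 / (1 - x))"
      define y where "y = 1 - x"
      have y: "y > 0" "x > 0" using 3 by (auto simp: y_def)
      \<comment> \<open>Removes the truncated exponent \<open>k - 1\<close>; for
        \<open>k = 0\<close> both sides are 0.\<close>
      have pw: "real k * z ^ (k - 1) = real k * z ^ k / z" if "z > 0" for z k
        using that by (cases k) auto
      have xa: "real a * x ^ (a - 1) = real a * x ^ a / x" and yb: "real b * y ^ (b - 1) = real b * y ^ b / y"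
        using pw y by auto
      have "((\<lambda>x. exp (- 1 / x - 1 / (1 - x))) has_real_derivative E * (1 / x\<^sup>2 - 1 / y\<^sup>2)) (at x)"
        unfolding E_def
      proof (rule DERIV_fun_exp)
        show "((\<lambda>x. - 1 / x - 1 / (1 - x)) has_real_derivative 1 / x\<^sup>2 - 1 / y\<^sup>2) (at x)"
          using y unfolding y_def by (auto intro!: derivative_eq_intros simp: power2_eq_square)
      qed
      moreover have "((\<lambda>x. x ^ a * (1 - x) ^ b) has_real_derivative
          real a * x ^ (a - 1) * y ^ b - x ^ a * (real b * y ^ (b - 1))) (at x)"
        unfolding y_def by (auto intro!: derivative_eq_intros)
      ultimately have "((\<lambda>x. exp (- 1 / x - 1 / (1 - x)) / (x ^ a * (1 - x) ^ b)) has_real_derivative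
        (E * (1 / x\<^sup>2 - 1 / y\<^sup>2) * (x ^ a * y ^ b) - E * (real a * x ^ (a - 1) * y ^ b - x ^ a * (real b * y ^ (b - 1))))
          / ((x ^ a * y ^ b) * (x ^ a * y ^ b))) (at x)"
        unfolding E_def y_def using y by (intro DERIV_divide) (auto simp: y_def)
      moreover have "(E * (1 / x\<^sup>2 - 1 / y\<^sup>2) * (x ^ a * y ^ b) - E * (real a * x ^ (a - 1) * y ^ b - x ^ a * (real b * y ^ (b - 1))))
          / ((x ^ a * y ^ b) * (x ^ a * y ^ b))
        = bump (a + 2) b x - bump a (b + 2) x - real a * bump (a + 1) b x + real b * bump a (b + 1) x"
      proof -
        have bump_eq: "bump c d x = E / (x ^ c * y ^ d)" for c d
          using 3 by (simp add: bump_def E_def y_def)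
        show ?thesis
          using y unfolding xa yb bump_eq
          by (simp add: field_simps power2_eq_square)
      qed
      ultimately show ?thesis by simp
    qed
    moreover have "\<forall>\<^sub>F y in nhds x. bump a b y = exp (- 1 / y - 1 / (1 - y)) / (y ^ a * (1 - y) ^ b)"
      using eventually_nhds_in_open[of "{0<..<1}" x] 3 by (auto elim!: eventually_mono simp: bump_def)
    ultimately show ?thesis
      by (subst DERIV_cong_ev[OF refl _ refl]) auto
  next
    case 4
    then show ?thesis
      using DERIV_0_of_quadratic_bound[of "bump a b" "fact a * fact (b + 2)" 1] bump_le_1
      by (simp add: bump_def)
  next
    case 5
    have "((\<lambda>x. 0) has_real_derivative 0) (at x)"
      by simp
    moreover have "\<forall>\<^sub>F y in nhds x. bump a b y = 0"
      using eventually_nhds_in_open[of "{1<..}" x] 5 by (auto elim!: eventually_mono simp: bump_def)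
    ultimately have "(bump a b has_real_derivative 0) (at x)"
      by (subst DERIV_cong_ev[OF refl _ refl]) auto
    then show ?thesis
      using 5 by (simp add: bump_def)
  qed
qed

text \<open>Closure under differentiation replaces an explicit formula for the higher derivatives:
  every iterated derivative stays in the span and is therefore differentiable.\<close>

inductive_set bump_span :: "(real \<Rightarrow> complex) set" where
  base: "(\<lambda>x. complex_of_real (bump a b x)) \<in> bump_span"
| add: "f \<in> bump_span \<Longrightarrow> g \<in> bump_span \<Longrightarrow> (\<lambda>x. f x + g x) \<in> bump_span"
| cmult: "f \<in> bump_span \<Longrightarrow> (\<lambda>x. c * f x) \<in> bump_span"

lemma bump_span_deriv:
  "f \<in> bump_span \<Longrightarrow> \<exists>g\<in>bump_span. \<forall>x. (f has_vector_derivative g x) (at x)"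
proof (induction rule: bump_span.induct)
  case (base a b)
  let ?g = "\<lambda>x. (complex_of_real (bump (a + 2) b x) + (- 1) * complex_of_real (bump a (b + 2) x)) +
    ((- of_nat a) * complex_of_real (bump (a + 1) b x) + of_nat b * complex_of_real (bump a (b + 1) x))"
  have "?g \<in> bump_span"
    by (intro bump_span.intros)
  moreover have "((\<lambda>x. complex_of_real (bump a b x)) has_vector_derivative ?g x) (at x)" for x
  proof -
    have "((\<lambda>x. complex_of_real (bump a b x)) has_vector_derivative
      complex_of_real (bump (a + 2) b x - bump a (b + 2) x - real a * bump (a + 1) b x + real b * bump a (b + 1) x)) (at x)"
      by (rule has_vector_derivative_of_real[OF bump_deriv])
    then show ?thesis
      by (simp add: algebra_simps)
  qed
  ultimately show ?case
    by (intro bexI[of _ ?g] allI)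
next
  case (add f g)
  then obtain f' g' where "f' \<in> bump_span" "g' \<in> bump_span"
    "\<forall>x. (f has_vector_derivative f' x) (at x)" "\<forall>x. (g has_vector_derivative g' x) (at x)"
    by blast
  then show ?case
    by (intro bexI[of _ "\<lambda>x. f' x + g' x"]) (auto intro: bump_span.add has_vector_derivative_add)
next
  case (cmult f c)
  then obtain f' where "f' \<in> bump_span" "\<forall>x. (f has_vector_derivative f' x) (at x)"
    by blast
  then show ?case
    by (intro bexI[of _ "\<lambda>x. c * f' x"]) (auto intro: bump_span.cmult has_vector_derivative_mult_right)
qed

lemma bump_span_support: "f \<in> bump_span \<Longrightarrow> x \<notin> {0..1} \<Longrightarrow> f x = 0"
  by (induction rule: bump_span.induct) (auto simp: bump_def)

lemma bump_span_test_function: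
  assumes f: "f \<in> bump_span"
  shows "f \<in> test_functions_on {0..1}"
proof -
  have "nth_deriv n f \<in> bump_span" for n
  proof (induction n)
    case 0
    then show ?case using f by (simp add: nth_deriv_def)
  next
    case (Suc n)
    then obtain g where g: "g \<in> bump_span" "\<forall>x. (nth_deriv n f has_vector_derivative g x) (at x)"
      using bump_span_deriv by blast
    then have "nth_deriv (Suc n) f = g"
      by (auto simp: nth_deriv_def fun_eq_iff intro: vector_derivative_at)
    with g show ?case by simp
  qed
  then have "nth_deriv n f differentiable (at x)" for n x
    using bump_span_deriv differentiableI_vector by blast
  then show ?thesis
    using bump_span_support[OF f] by (auto simp: test_functions_on_def)
qed

lemma bump_span_continuous: "f \<in> bump_span \<Longrightarrow> continuous_on UNIV f"
  using test_function_continuous bump_span_test_function by blast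

lemma bump_span_support_abs: "f \<in> bump_span \<Longrightarrow> \<bar>x\<bar> > 1 \<Longrightarrow> f x = 0"
  by (rule bump_span_support) auto

lemma bump_span_square_integrable: "f \<in> bump_span \<Longrightarrow> square_integrable f"
proof -
  assume f: "f \<in> bump_span"
  obtain B where B: "\<And>x. norm (f x) \<le> B"
    using test_function_bdd_above[OF bump_span_test_function[OF f]] by (auto simp: bdd_above_def)
  show ?thesis
    by (rule square_integrable_bounded_support[OF borel_measurable_continuous_onI[OF bump_span_continuous[OF f]] B
          bump_span_support_abs[OF f]])
qed

text \<open>Integration by parts on an interval whose endpoints lie outside the support: the
  derivative of the exponential times \<open>f\<close> has integral 0.\<close>

lemma fourier_integral_derivative:
  assumes f: "\<And>x. (f has_vector_derivative f' x) (at x)" and f': "continuous_on UNIV f'"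
    and supp: "\<And>x. \<bar>x\<bar> > R \<Longrightarrow> f x = 0"
  shows "fourier_integral f' \<xi> = \<i> * complex_of_real \<xi> * fourier_integral f \<xi>"
proof -
  define r where "r = \<bar>R\<bar> + 1"
  have r: "r > R" "r > 0" by (auto simp: r_def)
  have cf: "continuous_on UNIV f"
    using f by (meson continuous_at_imp_continuous_on has_vector_derivative_continuous)
  have supp': "f' x = 0" if "\<bar>x\<bar> > R" for x
  proof -
    have "open {y. R < \<bar>y\<bar>}"
      by (intro open_Collect_less continuous_intros)
    then have "((\<lambda>y. 0) has_vector_derivative f' x) (at x)"
      by (rule has_vector_derivative_transform_within_open[OF f]) (use that supp in auto)
    then show ?thesis
      using vector_derivative_unique_at[OF _ has_vector_derivative_const] by blast
  qed
  let ?e = "\<lambda>x. exp (- (\<i> * complex_of_real (x * \<xi>)))"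
  let ?d = "\<lambda>x. ?e x * f' x - \<i> * complex_of_real \<xi> * (?e x * f x)"
  have e: "(?e has_vector_derivative (- (\<i> * complex_of_real \<xi>) * ?e x)) (at x)" for x
    by (auto intro!: derivative_eq_intros has_vector_derivative_real_field simp: has_field_derivative_def)
  have "((\<lambda>x. ?e x * f x) has_vector_derivative ?d x) (at x)" for x
    using has_vector_derivative_mult[OF e[of x] f[of x]] by (simp add: algebra_simps)
  then have "has_bochner_integral lborel (\<lambda>x. indicator {- r..r} x *\<^sub>R ?d x) (?e r * f r - ?e (- r) * f (- r))"
    using r by (intro has_bochner_integral_FTC_Icc)
      (auto intro: has_vector_derivative_at_within intro!: continuous_intros continuous_on_subset[OF cf] continuous_on_subset[OF f'])
  moreover have "indicator {- r..r} x *\<^sub>R ?d x = ?d x" for x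
    using supp[of x] supp'[of x] r by (cases "\<bar>x\<bar> > R") (auto simp: indicator_def)
  moreover have "f r = 0" "f (- r) = 0"
    using supp r by auto
  ultimately have "(LINT x|lborel. ?d x) = 0"
    by (simp add: has_bochner_integral_integral_eq)
  moreover have int: "integrable lborel g" if "continuous_on UNIV g" "\<And>x. \<bar>x\<bar> > R \<Longrightarrow> g x = 0" for g :: "real \<Rightarrow> complex"
  proof -
    have "integrable lborel (\<lambda>x. indicator {- r..r} x *\<^sub>R g x)"
      by (rule borel_integrable_compact) (auto intro: continuous_on_subset[OF that(1)])
    moreover have "indicator {- r..r} x *\<^sub>R g x = g x" for x
      using that(2)[of x] r by (cases "\<bar>x\<bar> > R") (auto simp: indicator_def)
    ultimately show ?thesis by simp
  qed
  ultimately have "(LINT x|lborel. ?e x * f' x) = (LINT x|lborel. \<i> * complex_of_real \<xi> * (?e x * f x))"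
    using integrable_exp_ii_mult[OF int[OF f' supp'], of \<xi>]
      integrable_mult_right[OF integrable_exp_ii_mult[OF int[OF cf supp], of \<xi>], of "\<i> * complex_of_real \<xi>"]
    by (simp del: integral_mult_right_zero of_real_mult)
  then show ?thesis
    by (simp only: fourier_integral_def integral_mult_right_zero mult.left_commute)
qed

section \<open>High frequency data\<close>

lemma square_integrable_modulate:
  assumes f: "square_integrable f"
  shows "square_integrable (\<lambda>x. exp (\<i> * complex_of_real (x * a)) * f x)"
proof -
  note [measurable] = square_integrable_measurable[OF f]
  show ?thesis
    by (rule square_integrable_bound[OF f]) (auto simp: norm_mult)
qed

lemma fourier_L2_modulate:
  assumes f: "square_integrable f" and supp: "\<And>x. \<bar>x\<bar> > R \<Longrightarrow> f x = 0"
  shows "fourier_L2 (abs_L2 (\<lambda>x. exp (\<i> * complex_of_real (x * a)) * f x))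
    = abs_L2 (\<lambda>\<xi>. fourier_integral f (\<xi> - a))"
  by (subst fourier_L2_abs[OF square_integrable_modulate[OF f], of R])
    (auto simp: supp fourier_integral_modulate[abs_def] simp del: of_real_mult)

text \<open>Modulation translates the transform. Translating back moves the shift into the symbol,
  which tends to 0 pointwise as it is evaluated at \<open>a n + \<xi>\<close>; boundedness of the
  symbol gives the majorant.\<close>

lemma multiplier_L2_modulate_tendsto_0:
  fixes a :: "nat \<Rightarrow> real"
  assumes m: "bounded_symbol m" and lim: "(m \<longlongrightarrow> 0) at_infinity"
    and f: "square_integrable f" and supp: "\<And>x. \<bar>x\<bar> > R \<Longrightarrow> f x = 0"
    and a: "filterlim a at_infinity sequentially"
  shows "(\<lambda>n. multiplier_L2 m (abs_L2 (\<lambda>x. exp (\<i> * complex_of_real (x * a n)) * f x))) \<longlonglongrightarrow> 0"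
proof -
  note [measurable] = square_integrable_measurable[OF f] bounded_symbol_measurable[OF m]
  let ?F = "fourier_integral f"
  have F: "square_integrable ?F"
    by (rule plancherel_support(1)[OF f supp])
  have Fa: "square_integrable (\<lambda>\<xi>. ?F (\<xi> - a n))" for n
    using square_integrable_affine[OF F, of 1 "- a n"] by simp
  obtain K where K: "\<And>\<xi>. norm (m \<xi>) \<le> K"
    using m by (auto simp: bounded_symbol_def bounded_iff)
  have eq: "(norm (multiplier_L2 m (abs_L2 (\<lambda>x. exp (\<i> * complex_of_real (x * a n)) * f x))))\<^sup>2
      = (LINT \<xi>|lborel. (norm (m (a n + \<xi>)))\<^sup>2 * (norm (?F \<xi>))\<^sup>2)" for n
  proof -
    have "(norm (multiplier_L2 m (abs_L2 (\<lambda>x. exp (\<i> * complex_of_real (x * a n)) * f x))))\<^sup>2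
        = (norm (abs_L2 (\<lambda>\<xi>. m \<xi> * ?F (\<xi> - a n))))\<^sup>2"
      by (simp only: norm_multiplier_L2 fourier_L2_modulate[OF f supp] mult_abs_L2[OF m Fa])
    also have "\<dots> = (LINT \<xi>|lborel. (norm (m \<xi>))\<^sup>2 * (norm (?F (\<xi> - a n)))\<^sup>2)"
      by (simp add: norm_abs_L2[OF square_integrable_mult[OF m Fa]] norm_mult power_mult_distrib)
    also have "\<dots> = (LINT \<xi>|lborel. (norm (m (a n + \<xi>)))\<^sup>2 * (norm (?F \<xi>))\<^sup>2)"
      by (subst lborel_integral_real_affine[of 1 _ "a n"]) auto
    finally show ?thesis .
  qed
  have "(\<lambda>n. LINT \<xi>|lborel. (norm (m (a n + \<xi>)))\<^sup>2 * (norm (?F \<xi>))\<^sup>2) \<longlonglongrightarrow> (LINT (\<xi>::real)|lborel. 0::real)"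
  proof (rule integral_dominated_convergence)
    show "integrable lborel (\<lambda>\<xi>. K\<^sup>2 * (norm (?F \<xi>))\<^sup>2)"
      using F by (simp add: square_integrable_def)
    show "AE \<xi> in lborel. (\<lambda>n. (norm (m (a n + \<xi>)))\<^sup>2 * (norm (?F \<xi>))\<^sup>2) \<longlonglongrightarrow> 0"
    proof (rule AE_I2)
      fix \<xi>
      have "filterlim (\<lambda>n. a n + \<xi>) at_infinity sequentially"
        by (rule tendsto_add_filterlim_at_infinity'[OF a tendsto_const])
      then have "(\<lambda>n. m (a n + \<xi>)) \<longlonglongrightarrow> 0"
        by (rule filterlim_compose[OF lim])
      then have "(\<lambda>n. (norm (m (a n + \<xi>)))\<^sup>2 * (norm (?F \<xi>))\<^sup>2) \<longlonglongrightarrow> (norm (0::complex))\<^sup>2 * (norm (?F \<xi>))\<^sup>2"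
        by (intro tendsto_intros)
      then show "(\<lambda>n. (norm (m (a n + \<xi>)))\<^sup>2 * (norm (?F \<xi>))\<^sup>2) \<longlonglongrightarrow> 0"
        by simp
    qed
    show "AE \<xi> in lborel. norm ((norm (m (a n + \<xi>)))\<^sup>2 * (norm (?F \<xi>))\<^sup>2) \<le> K\<^sup>2 * (norm (?F \<xi>))\<^sup>2" for n
      using K by (intro AE_I2) (simp add: mult_right_mono power_mono)
  qed measurable
  then have "(\<lambda>n. (norm (multiplier_L2 m (abs_L2 (\<lambda>x. exp (\<i> * complex_of_real (x * a n)) * f x))))\<^sup>2) \<longlonglongrightarrow> 0"
    by (simp only: eq) simp
  then have "(\<lambda>n. sqrt ((norm (multiplier_L2 m (abs_L2 (\<lambda>x. exp (\<i> * complex_of_real (x * a n)) * f x))))\<^sup>2)) \<longlonglongrightarrow> sqrt 0"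
    by (rule tendsto_real_sqrt)
  then show ?thesis
    by (simp add: tendsto_norm_zero_iff)
qed

lemma multiplier_L2_cos_tendsto_0:
  fixes a :: "nat \<Rightarrow> real"
  assumes m: "bounded_symbol m" and lim: "(m \<longlongrightarrow> 0) at_infinity"
    and f: "square_integrable f" and supp: "\<And>x. \<bar>x\<bar> > R \<Longrightarrow> f x = 0"
    and a: "filterlim a at_infinity sequentially"
  shows "(\<lambda>n. multiplier_L2 m (abs_L2 (\<lambda>x. complex_of_real (cos (a n * x)) * f x))) \<longlonglongrightarrow> 0"
proof -
  interpret M: bounded_linear "multiplier_L2 m"
    by (rule bounded_linear_multiplier_L2[OF m])
  \<comment> \<open>The cosine is half the sum of the modulations by \<open>a n\<close> and by
    \<open>- a n\<close>, so both sign choices have to escape to infinity.\<close>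
  have a': "filterlim (\<lambda>n. - a n) at_infinity sequentially"
    using a by (simp add: filterlim_at_infinity_conv_norm_at_top)
  have "abs_L2 (\<lambda>x. complex_of_real (cos (a n * x)) * f x)
      = (1/2) *\<^sub>R (abs_L2 (\<lambda>x. exp (\<i> * complex_of_real (x * a n)) * f x)
          + abs_L2 (\<lambda>x. exp (\<i> * complex_of_real (x * - a n)) * f x))" for n
  proof -
    have c: "complex_of_real (cos (a n * x)) * f x
        = (1/2) *\<^sub>R (exp (\<i> * complex_of_real (x * a n)) * f x + exp (\<i> * complex_of_real (x * - a n)) * f x)" for x
    proof -
      have E: "complex_of_real (cos (x * a n)) = (exp (\<i> * complex_of_real (x * a n)) + exp (\<i> * complex_of_real (x * - a n))) / 2"
        using cos_exp_eq[of "complex_of_real (x * a n)", unfolded cos_of_real] by simp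
      show ?thesis
        unfolding mult.commute[of "a n" x] E by (simp add: scaleR_conv_of_real distrib_right)
    qed
    show ?thesis
      by (simp only: c abs_L2_add[OF square_integrable_modulate[OF f] square_integrable_modulate[OF f]]
          abs_L2_scaleR[OF square_integrable_add[OF square_integrable_modulate[OF f] square_integrable_modulate[OF f]]])
  qed
  moreover have "(\<lambda>n. (1/2) *\<^sub>R (multiplier_L2 m (abs_L2 (\<lambda>x. exp (\<i> * complex_of_real (x * a n)) * f x))
      + multiplier_L2 m (abs_L2 (\<lambda>x. exp (\<i> * complex_of_real (x * - a n)) * f x)))) \<longlonglongrightarrow> (1/2) *\<^sub>R (0 + 0)"
    by (intro tendsto_intros multiplier_L2_modulate_tendsto_0[OF m lim f supp a]
        multiplier_L2_modulate_tendsto_0[OF m lim f supp a'])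
  ultimately show ?thesis
    by (simp add: M.add M.scaleR)
qed

lemma bbm_symbol_at_infinity: "(bbm_csymbol \<longlongrightarrow> 0) at_infinity"
proof (rule Lim_null_comparison)
  have "norm (bbm_csymbol \<xi>) \<le> inverse (norm \<xi>)" if "norm \<xi> \<ge> 1" for \<xi>
  proof -
    have "\<bar>\<xi>\<bar> > 0" "1 + \<xi>\<^sup>2 > 0" using that by (auto intro: add_pos_nonneg)
    then show ?thesis
      unfolding norm_of_real bbm_symbol_def
      by (simp add: abs_divide divide_simps power2_eq_square[symmetric])
  qed
  then show "\<forall>\<^sub>F \<xi> in at_infinity. norm (bbm_csymbol \<xi>) \<le> inverse (norm \<xi>)"
    unfolding eventually_at_infinity by blast
  show "((\<lambda>\<xi>::real. inverse (norm \<xi>)) \<longlongrightarrow> 0) at_infinity"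
    by (rule tendsto_inverse_0_at_top[OF filterlim_norm_at_top])
qed

abbreviation sobolev_symbol :: "real \<Rightarrow> real \<Rightarrow> complex" where
  "sobolev_symbol s \<xi> \<equiv> complex_of_real ((1 + \<xi>\<^sup>2) powr (s / 2))"

lemma bounded_symbol_sobolev: "s \<le> 0 \<Longrightarrow> bounded_symbol (sobolev_symbol s)"
  using powr_mono[of "s / 2" 0] by (intro bounded_symbolI[of _ 1]) auto

text \<open>Writing the Sobolev norm as the L2 norm of a multiplier with decaying symbol lets one
  lemma on high frequencies handle both this norm and the smoothing by
  \<open>\<phi>(D)\<close>.\<close>

lemma sobolev_norm_eq: "s \<le> 0 \<Longrightarrow> sobolev_norm s f = norm (multiplier_L2 (sobolev_symbol s) f)"
  unfolding sobolev_norm_def norm_multiplier_L2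
  by (rule real_sqrt_unique) (simp_all add: norm_mult_L2[OF bounded_symbol_sobolev] power2_eq_square[of "_ powr _"] flip: powr_add)

lemma sobolev_symbol_at_infinity:
  assumes "s < 0"
  shows "(sobolev_symbol s \<longlongrightarrow> 0) at_infinity"
proof -
  have "filterlim (\<lambda>\<xi>::real. 1 + \<xi>\<^sup>2) at_top at_infinity"
  proof (rule filterlim_tendsto_add_at_top[OF tendsto_const])
    show "filterlim (\<lambda>\<xi>::real. \<xi>\<^sup>2) at_top at_infinity"
      using filterlim_pow_at_top[OF _ filterlim_norm_at_top[where 'a = real], of 2] by simp
  qed
  then have "((\<lambda>\<xi>::real. (1 + \<xi>\<^sup>2) powr (s / 2)) \<longlongrightarrow> 0) at_infinity"
    using assms by (intro tendsto_neg_powr) auto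
  then show ?thesis
    using tendsto_of_real[of "\<lambda>\<xi>::real. (1 + \<xi>\<^sup>2) powr (s / 2)" 0] by simp
qed

text \<open>The group is Lipschitz in time because the symbol is bounded by 1.\<close>

interpretation bbm: duhamel bbm_real_group bbm_bilinear "norm (abs_L2 bbm_csymbol)"
proof (rule duhamel.intro)
  show "norm (bbm_real_group t f - f) \<le> \<bar>t\<bar> * norm f" for t f
    using order_trans[OF norm_bbm_real_group_diff_le mult_left_mono[OF norm_multiplier_bbm_le abs_ge_zero]] by simp
  show "norm (bbm_bilinear u v) \<le> norm (abs_L2 bbm_csymbol) * norm u * norm v" for u v
    using norm_bbm_bilinear_le[of u v] by (simp add: mult_ac)
qed (auto simp: bounded_linear_bbm_real_group bbm_real_group_add bounded_bilinear_bbm)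

lemma bbm_flow_eq: "bbm_flow t u0 = bbm.flow t u0"
  by (simp add: bbm_flow_def bbm.flow_def bbm_solution_iff bbm.sol_def)

section \<open>The oscillating data and the limit of their quadratic interaction\<close>

abbreviation eta :: "real \<Rightarrow> real" where
  "eta \<equiv> bump 0 0"

text \<open>The square root makes the smooth \<open>eta\<close> appear in the squared data, whose
  nonoscillating half survives in the limit.\<close>

definition osc :: "real \<Rightarrow> real \<Rightarrow> real" where
  "osc N x = sqrt (eta x) * cos (N * x)"

lemma measurable_bump [measurable]: "bump a b \<in> borel_measurable borel"
  using bump_deriv DERIV_isCont by (blast intro: borel_measurable_continuous_onI continuous_at_imp_continuous_on)

lemma bump_support: "\<bar>x\<bar> > 1 \<Longrightarrow> bump a b x = 0"
  by (auto simp: bump_def)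

lemma eta_le_1: "eta x \<le> 1"
proof (cases "0 < x \<and> x < 1")
  case True
  then have "0 \<le> 1 / x" "0 \<le> 1 / (1 - x)"
    by auto
  then have "exp (- (1 / x) - 1 / (1 - x)) \<le> 1"
    by (subst exp_le_one_iff) linarith
  with True show ?thesis
    by (simp add: bump_def)
qed (auto simp: bump_def)

lemma square_integrable_sqrt_eta: "square_integrable (\<lambda>x. sqrt (eta x))"
  by (rule square_integrable_bounded_support[where B = 1 and R = 1]) (auto simp: bump_support bump_nonneg eta_le_1)

lemma square_integrable_osc: "square_integrable (osc N)"
  unfolding osc_def[abs_def]
  by (rule square_integrable_bound[OF square_integrable_sqrt_eta]) (auto simp: abs_mult bump_nonneg mult_left_le)

lemma complex_osc: "complex_L2 (abs_L2 (osc N)) = abs_L2 (\<lambda>x. complex_of_real (cos (N * x)) * complex_of_real (sqrt (eta x)))"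
  by (simp add: complex_abs_L2 square_integrable_osc) (simp add: osc_def[abs_def] mult.commute)

lemma filterlim_real_at_infinity: "filterlim (\<lambda>n. c * real n) at_infinity sequentially" if "c > 0"
  using that by (intro filterlim_at_top_imp_at_infinity filterlim_tendsto_pos_mult_at_top[OF tendsto_const]
      filterlim_real_sequentially) auto

lemma multiplier_osc_tendsto_0:
  assumes "bounded_symbol m" "(m \<longlongrightarrow> 0) at_infinity"
  shows "(\<lambda>n. multiplier_L2 m (complex_L2 (abs_L2 (osc (real n))))) \<longlonglongrightarrow> 0"
  unfolding complex_osc
  using filterlim_real_at_infinity[of 1]
  by (intro multiplier_L2_cos_tendsto_0[OF assms, where R = 1])
    (auto simp: bump_support intro: square_integrable_of_real square_integrable_sqrt_eta)

lemma eta_span: "(\<lambda>x. complex_of_real (eta x)) \<in> bump_span"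
  by (rule bump_span.base)

text \<open>Doubling the angle contributes a factor 1/2, which combines with the factor
  \<open>- \<i> / 2\<close> of the equation to \<open>- \<i> / 4\<close>.\<close>

lemma bilinear_osc:
  "complex_L2 (bbm_bilinear (abs_L2 (osc N)) (abs_L2 (osc N)))
    = scaleC_L2 (- \<i> / 4) (multiplier_L2 bbm_csymbol (abs_L2 (\<lambda>x. complex_of_real (eta x)))
        + multiplier_L2 bbm_csymbol (abs_L2 (\<lambda>x. complex_of_real (cos (2 * N * x)) * complex_of_real (eta x))))"
proof -
  interpret M: bounded_linear "multiplier_L2 bbm_csymbol"
    by (rule bounded_linear_multiplier_L2[OF bounded_symbol_bbm])
  let ?e = "\<lambda>x. complex_of_real (eta x)" and ?c = "\<lambda>x. complex_of_real (cos (2 * N * x)) * complex_of_real (eta x)"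
  have e: "square_integrable ?e"
    by (rule bump_span_square_integrable[OF eta_span])
  have c: "square_integrable ?c"
    by (rule square_integrable_bound[OF e]) (auto simp: norm_mult mult_left_le_one_le)
  have sq: "complex_of_real (osc N x * osc N x) = (1/2) *\<^sub>R (?e x + ?c x)" for x
  proof -
    have "osc N x * osc N x = eta x * (cos (N * x))\<^sup>2"
      by (simp add: osc_def power2_eq_square bump_nonneg)
    also have "(cos (N * x))\<^sup>2 = (1 + cos (2 * N * x)) / 2"
      using cos_double_cos[of "N * x"] by (simp add: mult.assoc)
    also have "eta x * \<dots> = (eta x + cos (2 * N * x) * eta x) / 2"
      by (simp add: algebra_simps)
    finally have "complex_of_real (osc N x * osc N x) = complex_of_real ((eta x + cos (2 * N * x) * eta x) / 2)"
      by (simp only:)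
    then show ?thesis
      by (simp only:) (simp add: scaleR_conv_of_real)
  qed
  have "multiplier_L1 bbm_csymbol (\<lambda>x. complex_of_real (rep_L2 (abs_L2 (osc N)) x * rep_L2 (abs_L2 (osc N)) x))
      = multiplier_L1 bbm_csymbol (\<lambda>x. (1/2) *\<^sub>R (?e x + ?c x))"
    by (rule multiplier_L1_cong_AE) (use rep_abs_L2[OF square_integrable_osc[of N]] sq in \<open>auto elim: eventually_mono\<close>)
  also have "\<dots> = multiplier_L2 bbm_csymbol (abs_L2 (\<lambda>x. (1/2) *\<^sub>R (?e x + ?c x)))"
    by (rule multiplier_L1_eq_L2[OF bounded_symbol_bbm square_integrable_scaleR[OF square_integrable_add[OF e c]], of 1])
      (auto simp: bump_support)
  also have "\<dots> = (1/2) *\<^sub>R (multiplier_L2 bbm_csymbol (abs_L2 ?e) + multiplier_L2 bbm_csymbol (abs_L2 ?c))"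
    by (simp only: abs_L2_scaleR[OF square_integrable_add[OF e c], symmetric] abs_L2_add[OF e c, symmetric] M.scaleR M.add)
  finally show ?thesis
    unfolding complex_bbm_bilinear scaleC_L2_of_real[symmetric] by simp
qed

lemma bilinear_osc_tendsto:
  "(\<lambda>n. complex_L2 (bbm_bilinear (abs_L2 (osc (real n))) (abs_L2 (osc (real n)))))
    \<longlonglongrightarrow> scaleC_L2 (- \<i> / 4) (multiplier_L2 bbm_csymbol (abs_L2 (\<lambda>x. complex_of_real (eta x))))"
proof -
  have "(\<lambda>n. multiplier_L2 bbm_csymbol (abs_L2 (\<lambda>x. complex_of_real (cos (2 * real n * x)) * complex_of_real (eta x)))) \<longlonglongrightarrow> 0"
    using filterlim_real_at_infinity[of 2]
    by (intro multiplier_L2_cos_tendsto_0[OF bounded_symbol_bbm bbm_symbol_at_infinity, where R = 1])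
      (auto simp: bump_support intro: bump_span_square_integrable[OF eta_span])
  then have "(\<lambda>n. scaleC_L2 (- \<i> / 4) (multiplier_L2 bbm_csymbol (abs_L2 (\<lambda>x. complex_of_real (eta x)))
        + multiplier_L2 bbm_csymbol (abs_L2 (\<lambda>x. complex_of_real (cos (2 * real n * x)) * complex_of_real (eta x)))))
      \<longlonglongrightarrow> scaleC_L2 (- \<i> / 4) (multiplier_L2 bbm_csymbol (abs_L2 (\<lambda>x. complex_of_real (eta x))) + 0)"
    by (intro bounded_linear.tendsto[OF bounded_linear_scaleC_L2] tendsto_intros)
  then show ?thesis
    by (simp add: bilinear_osc)
qed

text \<open>Here \<open>\<psi> = \<eta>'\<close> and \<open>\<theta> = \<eta> - \<eta>''\<close>. Since \<open>\<phi>(D)\<close> is symmetric, the pairing of \<open>u\<close> with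
  \<open>\<psi>\<close> is controlled by the norm of \<open>\<phi>(D)u\<close>.\<close>

lemma eta_derivatives:
  "\<exists>\<psi>\<in>bump_span. \<exists>\<theta>.
    (\<forall>\<xi>. fourier_integral \<psi> \<xi> = \<i> * complex_of_real \<xi> * fourier_integral (\<lambda>x. complex_of_real (eta x)) \<xi>) \<and>
    abs_L2 \<psi> = scaleC_L2 \<i> (multiplier_L2 bbm_csymbol (abs_L2 \<theta>))"
proof -
  let ?e = "\<lambda>x. complex_of_real (eta x)"
  obtain e1 where e1: "e1 \<in> bump_span" "\<And>x. (?e has_vector_derivative e1 x) (at x)"
    using bump_span_deriv[OF eta_span] by blast
  obtain e2 where e2: "e2 \<in> bump_span" "\<And>x. (e1 has_vector_derivative e2 x) (at x)"
    using bump_span_deriv[OF e1(1)] by blast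
  have F1: "fourier_integral e1 \<xi> = \<i> * complex_of_real \<xi> * fourier_integral ?e \<xi>" for \<xi>
    by (rule fourier_integral_derivative[OF e1(2) bump_span_continuous[OF e1(1)] bump_span_support_abs[OF eta_span]])
  have F2: "fourier_integral e2 \<xi> = \<i> * complex_of_real \<xi> * fourier_integral e1 \<xi>" for \<xi>
    by (rule fourier_integral_derivative[OF e2(2) bump_span_continuous[OF e2(1)] bump_span_support_abs[OF e1(1)]])
  define \<theta> where "\<theta> x = ?e x + (- 1) * e2 x" for x
  have \<theta>: "\<theta> \<in> bump_span"
    unfolding \<theta>_def[abs_def] by (intro bump_span.intros eta_span e2)
  note sq = bump_span_square_integrable and supp = bump_span_support_abs
  have int: "integrable lborel f" if "f \<in> bump_span" for f
    by (rule integrable_square_integrable_support(1)[OF sq[OF that] supp[OF that]])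
  have F\<theta>: "fourier_integral \<theta> \<xi> = complex_of_real (1 + \<xi>\<^sup>2) * fourier_integral ?e \<xi>" for \<xi>
  proof -
    have "fourier_integral \<theta> \<xi> = fourier_integral ?e \<xi> + fourier_integral (\<lambda>x. (- 1) * e2 x) \<xi>"
      unfolding \<theta>_def[abs_def] by (rule fourier_integral_add[OF int[OF eta_span] int[OF bump_span.cmult[OF e2(1)]]])
    also have "\<dots> = fourier_integral ?e \<xi> - fourier_integral e2 \<xi>"
      by (simp only: fourier_integral_cmult) simp
    also have "\<dots> = complex_of_real (1 + \<xi>\<^sup>2) * fourier_integral ?e \<xi>"
      by (simp add: F2 F1 power2_eq_square algebra_simps)
    finally show ?thesis .
  qed
  \<comment> \<open>The factor \<open>1 + \<xi>^2\<close> in the transform of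
    \<open>\<theta>\<close> cancels the denominator of the symbol and leaves
    \<open>\<i> * \<xi>\<close>, which is differentiation.\<close>
  have "\<i> * (bbm_csymbol \<xi> * fourier_integral \<theta> \<xi>) = fourier_integral e1 \<xi>" for \<xi>
  proof -
    have "1 + \<xi>\<^sup>2 \<noteq> 0"
      by (metis add_pos_nonneg less_irrefl zero_le_power2 zero_less_one)
    then have "bbm_symbol \<xi> * (1 + \<xi>\<^sup>2) = \<xi>"
      by (simp add: bbm_symbol_def)
    then have "bbm_csymbol \<xi> * complex_of_real (1 + \<xi>\<^sup>2) = complex_of_real \<xi>"
      by (metis of_real_mult)
    then show ?thesis
      by (simp only: F1 F\<theta> mult.assoc[symmetric])
  qed
  then have "abs_L2 e1 = scaleC_L2 \<i> (multiplier_L2 bbm_csymbol (abs_L2 \<theta>))"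
    using plancherel_support(1)[OF sq[OF \<theta>] supp[OF \<theta>]]
    by (subst fourier_L2_eq_iff[symmetric])
      (simp add: fourier_L2_abs[OF sq supp, OF e1(1) e1(1)] fourier_L2_abs[OF sq supp, OF \<theta> \<theta>] fourier_L2_scaleC
        fourier_multiplier_L2 mult_abs_L2 bounded_symbol_bbm scaleC_abs_L2 square_integrable_mult)
  with e1(1) F1 show ?thesis
    by blast
qed

text \<open>On the Fourier side the pairing is the integral of \<open>- (1/4) * k\<close> with
  \<open>k\<close> nonnegative. If it vanished, the transform of \<open>eta\<close> would vanish
  almost everywhere, and by Plancherel so would \<open>eta\<close>, which is positive on the open
  unit interval.\<close>

lemma eta_response_nonzero:
  assumes \<psi>: "\<psi> \<in> bump_span"
    and F: "\<And>\<xi>. fourier_integral \<psi> \<xi> = \<i> * complex_of_real \<xi> * fourier_integral (\<lambda>x. complex_of_real (eta x)) \<xi>"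
  shows "scaleC_L2 (- \<i> / 4) (multiplier_L2 bbm_csymbol (abs_L2 (\<lambda>x. complex_of_real (eta x)))) \<bullet> abs_L2 \<psi> \<noteq> 0"
proof
  let ?e = "\<lambda>x. complex_of_real (eta x)"
  note sq = bump_span_square_integrable and supp = bump_span_support_abs
  have Fe: "square_integrable (fourier_integral ?e)"
    by (rule plancherel_support(1)[OF sq supp, OF eta_span eta_span])
  have F\<psi>: "square_integrable (fourier_integral \<psi>)"
    by (rule plancherel_support(1)[OF sq supp, OF \<psi> \<psi>])
  define k where "k \<xi> = \<xi> * bbm_symbol \<xi> * (norm (fourier_integral ?e \<xi>))\<^sup>2" for \<xi>
  assume "scaleC_L2 (- \<i> / 4) (multiplier_L2 bbm_csymbol (abs_L2 ?e)) \<bullet> abs_L2 \<psi> = 0"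
  then have "fourier_L2 (scaleC_L2 (- \<i> / 4) (multiplier_L2 bbm_csymbol (abs_L2 ?e))) \<bullet> fourier_L2 (abs_L2 \<psi>) = 0"
    by (simp only: fourier_L2_inner)
  moreover have m: "square_integrable (\<lambda>\<xi>. - \<i> / 4 * (bbm_csymbol \<xi> * fourier_integral ?e \<xi>))"
    by (intro square_integrable_cmult square_integrable_mult bounded_symbol_bbm Fe)
  have "fourier_L2 (scaleC_L2 (- \<i> / 4) (multiplier_L2 bbm_csymbol (abs_L2 ?e)))
      = abs_L2 (\<lambda>\<xi>. - \<i> / 4 * (bbm_csymbol \<xi> * fourier_integral ?e \<xi>))"
    by (simp only: fourier_L2_scaleC fourier_multiplier_L2 fourier_L2_abs[OF sq supp, OF eta_span eta_span]
        mult_abs_L2[OF bounded_symbol_bbm Fe] scaleC_abs_L2[OF square_integrable_mult[OF bounded_symbol_bbm Fe]])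
  moreover have "(- \<i> / 4 * (bbm_csymbol \<xi> * fourier_integral ?e \<xi>)) \<bullet> fourier_integral \<psi> \<xi> = - (1/4) * k \<xi>" for \<xi>
    unfolding F k_def cmod_power2 by (simp add: inner_complex_def algebra_simps power2_eq_square)
  ultimately have "(LINT \<xi>|lborel. - (1/4) * k \<xi>) = 0"
    by (simp only: fourier_L2_abs[OF sq supp, OF \<psi> \<psi>] inner_abs_L2[OF m F\<psi>])
  then have k0: "(LINT \<xi>|lborel. k \<xi>) = 0"
    by simp
  have "integrable lborel (\<lambda>\<xi>. - (1/4) * k \<xi>)"
    using square_integrable_inner[OF m F\<psi>]
    by (simp only: \<open>\<And>\<xi>. (- \<i> / 4 * (bbm_csymbol \<xi> * fourier_integral ?e \<xi>)) \<bullet> fourier_integral \<psi> \<xi> = - (1/4) * k \<xi>\<close>)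
  from integrable_mult_right[OF this, of "- 4"] have "integrable lborel k"
    by simp
  moreover have kpos: "k \<xi> \<ge> 0" for \<xi>
    by (simp add: k_def bbm_symbol_def)
  ultimately have "AE \<xi> in lborel. k \<xi> = 0"
    using k0 by (subst (asm) integral_nonneg_eq_0_iff_AE) auto
  moreover have "AE \<xi> in lborel. \<xi> \<noteq> (0::real)"
    by (rule AE_lborel_singleton)
  ultimately have "AE \<xi> in lborel. fourier_integral ?e \<xi> = 0"
  proof eventually_elim
    case (elim \<xi>)
    have "1 + \<xi>\<^sup>2 \<noteq> 0"
      by (metis add_pos_nonneg less_irrefl zero_le_power2 zero_less_one)
    with elim show ?case
      by (simp add: k_def bbm_symbol_def)
  qed
  then have "abs_L2 (fourier_integral ?e) = abs_L2 (\<lambda>x. 0)"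
    by (intro abs_L2_cong Fe square_integrable_zero)
  then have "norm (abs_L2 ?e) = norm (abs_L2 (\<lambda>x. 0 :: complex))"
    using plancherel_support(2)[OF sq supp, OF eta_span eta_span] by simp
  then have "(norm (abs_L2 ?e))\<^sup>2 = (norm (abs_L2 (\<lambda>x. 0 :: complex)))\<^sup>2"
    by simp
  then have "(LINT x|lborel. (norm (?e x))\<^sup>2) = 0"
    unfolding norm_abs_L2[OF sq[OF eta_span]] norm_abs_L2[OF square_integrable_zero] by simp
  then have "AE x in lborel. (norm (?e x))\<^sup>2 = 0"
    using sq[OF eta_span] by (subst (asm) integral_nonneg_eq_0_iff_AE) (auto simp: square_integrable_def)
  then have "AE x in lborel. x \<notin> {0<..<1::real}"
    by eventually_elim (auto simp: bump_def)
  then have "{0<..<1::real} \<in> null_sets lborel"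
    by (simp add: AE_iff_null_sets)
  then show False
    by (simp add: null_sets_def)
qed

section \<open>From distributional continuity to limits along sequences\<close>

lemma Re_distribution_of:
  assumes \<psi>: "\<psi> \<in> bump_span"
  shows "Re (distribution_of f \<psi>) = complex_L2 f \<bullet> abs_L2 \<psi>"
proof -
  have t: "\<psi> \<in> test_functions_on {0..1}"
    by (rule bump_span_test_function[OF \<psi>])
  then have "\<psi> \<in> test_functions"
    unfolding test_functions_def by blast
  then have "Re (distribution_of f \<psi>) = Re (LINT x|lborel. complex_of_real (rep_L2 f x) * \<psi> x)"
    by (simp add: distribution_of_def)
  also have "\<dots> = (LINT x|lborel. Re (complex_of_real (rep_L2 f x) * \<psi> x))"
    by (rule integral_Re[OF integrable_rep_L2_test_function(1)[OF t], symmetric]) simp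
  also have "\<dots> = (LINT x|lborel. complex_of_real (rep_L2 f x) \<bullet> \<psi> x)"
    by (simp add: inner_complex_def)
  also have "\<dots> = abs_L2 (\<lambda>x. complex_of_real (rep_L2 f x)) \<bullet> abs_L2 \<psi>"
    by (rule inner_abs_L2[OF square_integrable_of_real[OF rep_L2] bump_span_square_integrable[OF \<psi>], symmetric])
  also have "abs_L2 (\<lambda>x. complex_of_real (rep_L2 f x)) = complex_L2 f"
    using complex_abs_L2[OF rep_L2, of f] by simp
  finally show ?thesis .
qed

text \<open>Evaluation at \<open>\<psi>\<close> is a coordinate projection, so it is continuous on
  the distributions, and every neighbourhood of 0 in the induced topology contains a Sobolev
  ball.\<close>

lemma topcontinuous_at_flow_tendsto:
  fixes u :: "nat \<Rightarrow> real L2" and G :: "real L2 \<Rightarrow> real L2"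
  assumes cont: "topcontinuous_at (L2_sobolev_topology s) distribution_topology (\<lambda>f. distribution_of (G f)) 0"
    and u: "(\<lambda>n. sobolev_norm s (complex_L2 (u n))) \<longlonglongrightarrow> 0" and \<psi>: "\<psi> \<in> test_functions"
  shows "(\<lambda>n. distribution_of (G (u n)) \<psi>) \<longlonglongrightarrow> distribution_of (G 0) \<psi>"
proof (rule topological_tendstoI)
  fix W assume W: "open W" "distribution_of (G 0) \<psi> \<in> W"
  let ?V = "{F \<in> topspace distribution_topology. F \<psi> \<in> W}"
  have "continuous_map distribution_topology euclidean (\<lambda>F. F \<psi>)"
    unfolding distribution_topology_def
    by (intro continuous_map_from_subtopology continuous_map_product_projection \<psi>)
  then have "openin distribution_topology ?V"
    using W(1) by (intro openin_continuous_map_preimage) auto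
  moreover have "distribution_of (G 0) \<in> ?V"
    using W(2) by (simp add: distribution_of_in_distributions)
  ultimately obtain U where U: "openin (L2_sobolev_topology s) U" "0 \<in> U" "\<And>f. f \<in> U \<Longrightarrow> distribution_of (G f) \<in> ?V"
    using cont unfolding topcontinuous_at_def by meson
  then obtain r where r: "r > 0" "\<And>g. sobolev_norm s (complex_L2 (g - 0)) < r \<Longrightarrow> g \<in> U"
    unfolding openin_L2_sobolev_topology by blast
  have "\<forall>\<^sub>F n in sequentially. sobolev_norm s (complex_L2 (u n)) < r"
    using order_tendstoD(2)[OF u r(1)] .
  then show "\<forall>\<^sub>F n in sequentially. distribution_of (G (u n)) \<psi> \<in> W"
    by eventually_elim (use r(2) U(3) in auto)
qed

theorem theorem1p3:
  fixes s :: real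
  assumes "s < 0"
  shows "\<exists>T>0. \<forall>t. 0 < t \<and> t < T \<longrightarrow>
    \<not> topcontinuous_at (L2_sobolev_topology s) distribution_topology
        (\<lambda>u0. distribution_of (bbm_flow t u0)) 0"
proof -
  obtain \<psi> \<theta> where \<psi>: "\<psi> \<in> bump_span"
    and F\<psi>: "\<And>\<xi>. fourier_integral \<psi> \<xi> = \<i> * complex_of_real \<xi> * fourier_integral (\<lambda>x. complex_of_real (eta x)) \<xi>"
    and \<psi>\<theta>: "abs_L2 \<psi> = scaleC_L2 \<i> (multiplier_L2 bbm_csymbol (abs_L2 \<theta>))"
    using eta_derivatives by blast
  define v where "v n = abs_L2 (osc (real n))" for n
  define l where "l f = complex_L2 f \<bullet> abs_L2 \<psi>" for f
  define h where "h = Re_L2 (scaleC_L2 (- \<i> / 4) (multiplier_L2 bbm_csymbol (abs_L2 (\<lambda>x. complex_of_real (eta x)))))"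
  define \<delta> where "\<delta> n = norm (multiplier_L2 bbm_csymbol (complex_L2 (v n)))" for n
  have l: "bounded_linear l"
    unfolding l_def by (rule bounded_linear_compose[OF bounded_linear_inner_left bounded_linear_complex_L2])
  have \<delta>: "\<delta> \<longlonglongrightarrow> 0"
    unfolding \<delta>_def[abs_def] v_def
    by (intro tendsto_norm_zero multiplier_osc_tendsto_0 bounded_symbol_bbm bbm_symbol_at_infinity)
  have h: "(\<lambda>n. bbm_bilinear (v n) (v n)) \<longlonglongrightarrow> h"
    unfolding h_def v_def using bounded_linear.tendsto[OF bounded_linear_Re_L2 bilinear_osc_tendsto] by simp
  \<comment> \<open>As \<open>h\<close> is defined by a real part, \<open>complex_L2 h\<close> has
    to be identified first: it is the limit of functions in the range of \<open>complex_L2\<close>,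
    hence the complex limit itself.\<close>
  have lh: "l h \<noteq> 0"
  proof -
    have "complex_L2 h = scaleC_L2 (- \<i> / 4) (multiplier_L2 bbm_csymbol (abs_L2 (\<lambda>x. complex_of_real (eta x))))"
      using bounded_linear.tendsto[OF bounded_linear_complex_L2 h] bilinear_osc_tendsto
      unfolding v_def by (rule LIMSEQ_unique)
    then show ?thesis
      unfolding l_def using eta_response_nonzero[OF \<psi> F\<psi>] by simp
  qed
  have near: "norm (bbm_real_group r (v n) - v n) \<le> \<bar>r\<bar> * \<delta> n" for r n
    unfolding \<delta>_def by (rule norm_bbm_real_group_diff_le)
  have bounded: "norm (v n) \<le> norm (abs_L2 (\<lambda>x. sqrt (eta x)))" for n
  proof -
    have "(norm (v n))\<^sup>2 \<le> (norm (abs_L2 (\<lambda>x. sqrt (eta x))))\<^sup>2"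
      unfolding v_def norm_abs_L2[OF square_integrable_osc] norm_abs_L2[OF square_integrable_sqrt_eta]
      using square_integrable_osc square_integrable_sqrt_eta
      by (intro integral_mono power_mono) (auto simp: square_integrable_def osc_def abs_mult mult_left_le bump_nonneg)
    then show ?thesis
      by (rule power2_le_imp_le) simp
  qed
  have weak: "(\<lambda>n. l (bbm_real_group t (v n))) \<longlonglongrightarrow> 0" for t
  proof (rule Lim_null_comparison)
    let ?\<Phi> = "multiplier_L2 bbm_csymbol"
    have "norm (l (bbm_real_group t (v n))) \<le> \<delta> n * norm (abs_L2 \<theta>)" for n
    proof -
      \<comment> \<open>The multiplier contained in \<open>\<psi>\<close> is moved to the evolved
        data. There it commutes with the group, so the bound \<open>\<delta> n\<close> does not
        depend on \<open>t\<close>.\<close>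
      have "abs_L2 \<psi> = ?\<Phi> (scaleC_L2 \<i> (abs_L2 \<theta>))"
        unfolding \<psi>\<theta> multiplier_L2_const[symmetric]
        by (rule multiplier_L2_commute[OF bounded_symbol_const bounded_symbol_bbm])
      then have "l (bbm_real_group t (v n)) = ?\<Phi> (bbm_group t (complex_L2 (v n))) \<bullet> scaleC_L2 \<i> (abs_L2 \<theta>)"
        by (simp add: l_def complex_bbm_real_group multiplier_L2_symmetric[OF bounded_symbol_bbm])
      also have "norm \<dots> \<le> norm (?\<Phi> (bbm_group t (complex_L2 (v n)))) * norm (scaleC_L2 \<i> (abs_L2 \<theta>))"
        unfolding real_norm_def by (rule Cauchy_Schwarz_ineq2)
      finally show ?thesis
        by (simp add: norm_multiplier_bbm_group \<delta>_def)
    qed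
    then show "\<forall>\<^sub>F n in sequentially. norm (l (bbm_real_group t (v n))) \<le> \<delta> n * norm (abs_L2 \<theta>)"
      by (intro always_eventually allI)
    show "(\<lambda>n. \<delta> n * norm (abs_L2 \<theta>)) \<longlonglongrightarrow> 0"
      by (rule tendsto_mult_left_zero[OF \<delta>])
  qed
  \<comment> \<open>Nothing that enters here involves \<open>s\<close>; the exponent matters only
    for the convergence of the data to 0.\<close>
  obtain T where T: "T > 0"
    "\<And>t. 0 < t \<Longrightarrow> t < T \<Longrightarrow> \<exists>\<epsilon>>0. \<not> (\<lambda>n. l (bbm.flow t (\<epsilon> *\<^sub>R v n))) \<longlonglongrightarrow> 0"
    using bbm.flow_not_weakly_null[OF l bounded near \<delta> h lh weak] by blast
  have "\<not> topcontinuous_at (L2_sobolev_topology s) distribution_topology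
        (\<lambda>u0. distribution_of (bbm_flow t u0)) 0" if t: "0 < t" "t < T" for t
  proof
    assume cont: "topcontinuous_at (L2_sobolev_topology s) distribution_topology
        (\<lambda>u0. distribution_of (bbm_flow t u0)) 0"
    obtain \<epsilon> where \<epsilon>: "\<not> (\<lambda>n. l (bbm.flow t (\<epsilon> *\<^sub>R v n))) \<longlonglongrightarrow> 0"
      using T(2)[OF t] by blast
    have "(\<lambda>n. sobolev_norm s (complex_L2 (\<epsilon> *\<^sub>R v n))) \<longlonglongrightarrow> 0"
    proof -
      have bl: "bounded_linear (multiplier_L2 (sobolev_symbol s))"
        using assms by (intro bounded_linear_multiplier_L2 bounded_symbol_sobolev) simp
      have "sobolev_norm s (complex_L2 (\<epsilon> *\<^sub>R v n))
          = \<bar>\<epsilon>\<bar> * norm (multiplier_L2 (sobolev_symbol s) (complex_L2 (v n)))" for n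
        using assms by (simp add: sobolev_norm_eq linear_cmul[OF bounded_linear.linear[OF bl]]
            linear_cmul[OF bounded_linear.linear[OF bounded_linear_complex_L2]])
      moreover have "(\<lambda>n. norm (multiplier_L2 (sobolev_symbol s) (complex_L2 (v n)))) \<longlonglongrightarrow> 0"
        unfolding v_def using assms
        by (intro tendsto_norm_zero multiplier_osc_tendsto_0 bounded_symbol_sobolev sobolev_symbol_at_infinity) simp_all
      ultimately show ?thesis
        using tendsto_mult_right_zero by simp
    qed
    moreover have "\<psi> \<in> test_functions"
      using bump_span_test_function[OF \<psi>] unfolding test_functions_def by blast
    ultimately have "(\<lambda>n. distribution_of (bbm_flow t (\<epsilon> *\<^sub>R v n)) \<psi>) \<longlonglongrightarrow> distribution_of (bbm_flow t 0) \<psi>"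
      by (rule topcontinuous_at_flow_tendsto[OF cont])
    \<comment> \<open>The real part of the pairing with \<open>\<psi>\<close> is \<open>l\<close>,
      so continuity at the origin would force \<open>l\<close> of the flow to tend to its value for
      zero data, which is 0.\<close>
    then have "(\<lambda>n. l (bbm.flow t (\<epsilon> *\<^sub>R v n))) \<longlonglongrightarrow> l (bbm.flow t 0)"
      using tendsto_Re by (fastforce simp: Re_distribution_of[OF \<psi>] bbm_flow_eq l_def)
    moreover have "l (bbm.flow t 0) = 0"
      using t linear_0[OF bounded_linear.linear[OF l]] bbm.flow_0[of t] by simp
    ultimately show False
      using \<epsilon> by simp
  qed
  with T(1) show ?thesis
    by blast
qed

end
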